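(* If $q(\cdot)\in\mathbb{W}^{m,\infty}([t_1-\tau,t_2],\mathbb{R}^n)$ is a higher-order normal extremizer of the higher-order isoperimetric problem with time delay (P) described in the context, then there exist a number $\lambda\in\mathbb{R}$ and a polynomial $p(t)=c_0+c_1t+\dots+c_{m-1}t^{m-1}$ with constants $c_0,\dots,c_{m-1}\in\mathbb{R}^n$ such that, with $F:=L-\lambda g$, $$\sum_{i=0}^{m}(-1)^{m-i-1}\,\mathcal{S}^{m-i}\Bigl[\partial_{i+2}F[q]^m_\tau(\cdot)+\partial_{i+m+3}F[q]^m_\tau(\cdot+\tau)\Bigr](t)=p(t)\qquad\text{for } t_1\le t\le t_2-\tau,$$ and $$\sum_{i=0}^{m}(-1)^{m-i-1}\,\mathcal{S}^{m-i}\Bigl[\partial_{i+2}F[q]^m_\tau(\cdot)\Bigr](t)=p(t)\qquad\text{for } t_2-\tau\le t\le t_2.$$ Here $\mathcal{S}^0f=f$ and, for $k\ge 1$, $\mathcal{S}^k$ is the $k$-fold iterated integral based at $t_2-\tau$: $$\mathcal{S}^kf(t)=\int_{t_2-\tau}^{t}\int_{t_2-\tau}^{s_1}\cdots\int_{t_2-\tau}^{s_{k-1}}f(s_k)\,ds_k\cdots ds_2\,ds_1 .$$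
   Context: Let $m,n\ge 1$ be integers, $t_1<t_2$ real numbers and $0<\tau<t_2-t_1$. $\mathbb{W}^{m,\infty}([a,b],\mathbb{R}^n)$ is the class of functions that are absolutely continuous together with their derivatives up to order $m-1$ and whose $m$th derivative belongs to $L^\infty$. $q^{(i)}$ is the $i$th derivative of $q$, $q^{(0)}=q$. Write $$[q]^m_\tau(t)=\bigl(t,q(t),\dot q(t),\dots,q^{(m)}(t),q(t-\tau),\dot q(t-\tau),\dots,q^{(m)}(t-\tau)\bigr),$$ and $G[q]^m_\tau(t)=G([q]^m_\tau(t))$. $\partial_iG$ is the partial derivative (gradient) of $G$ with respect to its $i$th argument; thus argument $1$ is $t$, argument $i+2$ is $q^{(i)}(t)$ and argument $i+m+3$ is $q^{(i)}(t-\tau)$, $i=0,\dots,m$. Problem (P): minimize $J^\tau_m[q(\cdot)]=\int_{t_1}^{t_2}L[q]^m_\tau(t)\,dt$ over $q(\cdot)\in\mathbb{W}^{m,\infty}([t_1-\tau,t_2],\mathbb{R}^n)$ subject to the isoperimetric constraint $I^\tau_m[q(\cdot)]=\int_{t_1}^{t_2}g[q]^m_\tau(t)\,dt=l$ and the boundary conditions $q(t)=\delta(t)$ for $t\in[t_1-\tau,t_1]$, $q(t_2)=q_{t_2}$, $q^{(i)}(t_2)=q^i_{t_2}$, $i=1,\dots,m-1$. Here $L,g:[t_1,t_2]\times\mathbb{R}^{2n(m+1)}\to\mathbb{R}$ are of class $C^{m+1}$ in all their arguments, $l\in\mathbb{R}$ is given, $q_{t_2},q^i_{t_2}\in\mathbb{R}^n$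 are given, and $\delta$ is a given piecewise smooth function. An extremizer of (P) is a local minimizer or local maximizer of $J^\tau_m$ among the functions satisfying all the constraints (local with respect to the $\mathbb{W}^{m,\infty}$ norm). It is called a higher-order normal extremizer if it does not satisfy the Euler–Lagrange equations of the constraint functional, namely $$\sum_{i=0}^m(-1)^i\frac{d^i}{dt^i}\Bigl(\partial_{i+2}g[q]^m_\tau(t)+\partial_{i+m+3}g[q]^m_\tau(t+\tau)\Bigr)=0\quad (t_1\le t\le t_2-\tau),$$ $$\sum_{i=0}^m(-1)^i\frac{d^i}{dt^i}\partial_{i+2}g[q]^m_\tau(t)=0\quad (t_2-\tau\le t\le t_2).$$ Since $q^{(m)}$ is only defined almost everywhere, identities involving it are understood for almost every $t$, and derivatives of non-smooth expressions are understood in the weak (distributional) sense. *)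

theory Defs
  imports "HOL-Analysis.Analysis" "HOL-Probability.Essential_Supremum"
begin

section \<open>Smoothness classes\<close>

text \<open>
  \<open>C_k_on k f S\<close> is meant for convex \<open>S\<close> with nonempty interior (a slab \<open>[t\<^sub>1, t\<^sub>2] \<times> \<real>\<^sup>N\<close>, a
  nondegenerate interval, the whole space), where the derivative within \<open>S\<close> is unique.  At
  boundary points of \<open>S\<close> derivatives are one-sided.
\<close>

primrec C_k_on :: "nat \<Rightarrow> ('a::euclidean_space \<Rightarrow> 'b::euclidean_space) \<Rightarrow> 'a set \<Rightarrow> bool" where
  "C_k_on 0 f S \<longleftrightarrow> continuous_on S f"
| "C_k_on (Suc k) f S \<longleftrightarrow>
     (\<exists>f'. (\<forall>x\<in>S. (f has_derivative f' x) (at x within S)) \<and> (\<forall>v. C_k_on k (\<lambda>x. f' x v) S))"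

definition smooth_on :: "'a::euclidean_space set \<Rightarrow> ('a \<Rightarrow> 'b::euclidean_space) \<Rightarrow> bool" where
  "smooth_on S f \<longleftrightarrow> (\<forall>k. C_k_on k f S)"

text \<open>
  \<open>S\<close> is the set of break points.  On the closure of each piece the function, up to its values at
  the end points, is smooth.  Jumps at break points are permitted.
\<close>

definition piecewise_smooth_on :: "real \<Rightarrow> real \<Rightarrow> (real \<Rightarrow> 'b::euclidean_space) \<Rightarrow> bool" where
  "piecewise_smooth_on a b f \<longleftrightarrow>
     (\<exists>S. finite S \<and>
        (\<forall>c d. a \<le> c \<and> c < d \<and> d \<le> b \<and> {c<..<d} \<inter> S = {} \<longrightarrow>
           (\<exists>h. smooth_on {c..d} h \<and> (\<forall>t\<in>{c<..<d}. f t = h t))))"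

section \<open>The spaces \<open>W\<^sup>m\<^sup>,\<^sup>\<infinity>([a, b], \<real>\<^sup>n)\<close>\<close>

definition absolutely_continuous_on_interval ::
    "real \<Rightarrow> real \<Rightarrow> (real \<Rightarrow> 'b::real_normed_vector) \<Rightarrow> bool" where
  "absolutely_continuous_on_interval a b f \<longleftrightarrow>
     (\<forall>\<epsilon>>0. \<exists>\<delta>>0. \<forall>D. finite D \<and> (\<forall>(u, v)\<in>D. a \<le> u \<and> u \<le> v \<and> v \<le> b) \<and>
        disjoint_family_on (\<lambda>(u, v). {u<..<v}) D \<and> (\<Sum>(u, v)\<in>D. v - u) < \<delta> \<longrightarrow>
        (\<Sum>(u, v)\<in>D. norm (f v - f u)) < \<epsilon>)"

text \<open>The \<open>i\<close>th derivative of a function on \<open>[a, b]\<close>, one-sided at the end points.\<close>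

primrec nth_deriv :: "real \<Rightarrow> real \<Rightarrow> nat \<Rightarrow> (real \<Rightarrow> 'b::real_normed_vector) \<Rightarrow> real \<Rightarrow> 'b" where
  "nth_deriv a b 0 q = q"
| "nth_deriv a b (Suc i) q = (\<lambda>t. vector_derivative (nth_deriv a b i q) (at t within {a..b}))"

text \<open>
  Derivatives of order less than \<open>m\<close> exist at every point of \<open>[a, b]\<close>, the \<open>m\<close>th one almost
  everywhere.  The latter follows from absolute continuity; it is spelled out because
  \<open>vector_derivative\<close> is a total function.
\<close>

definition sobolev_inf :: "nat \<Rightarrow> real \<Rightarrow> real \<Rightarrow> (real \<Rightarrow> 'b::euclidean_space) set" where
  "sobolev_inf m a b = {q.
     (\<forall>i<m. absolutely_continuous_on_interval a b (nth_deriv a b i q)) \<and>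
     (\<forall>i. Suc i < m \<longrightarrow>
        (\<forall>t\<in>{a..b}. nth_deriv a b i q differentiable (at t within {a..b}))) \<and>
     (AE t in lebesgue_on {a..b}. nth_deriv a b (m - 1) q differentiable (at t within {a..b})) \<and>
     nth_deriv a b m q \<in> borel_measurable (lebesgue_on {a..b}) \<and>
     (\<exists>C. AE t in lebesgue_on {a..b}. norm (nth_deriv a b m q t) \<le> C)}"

definition sobolev_inf_norm :: "nat \<Rightarrow> real \<Rightarrow> real \<Rightarrow> (real \<Rightarrow> 'b::euclidean_space) \<Rightarrow> ereal" where
  "sobolev_inf_norm m a b q =
     (\<Sum>i\<le>m. esssup (lebesgue_on {a..b}) (\<lambda>t. ereal (norm (nth_deriv a b i q t))))"

section \<open>Delayed jets and partial gradients\<close>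

text \<open>
  The arguments of a Lagrangian are \<open>(t, x, y)\<close>, where \<open>x\<close> and \<open>y\<close> are families of \<open>m + 1\<close> vectors
  of \<open>\<real>\<^sup>n\<close>, indexed by a type \<open>'k\<close> with \<open>m + 1\<close> elements.  The bijection \<open>e\<close> from \<open>{..m}\<close> onto \<open>'k\<close>
  numbers the components: \<open>x $ e i\<close> stands for the \<open>i\<close>th derivative of \<open>q\<close> at \<open>t\<close>, and \<open>y $ e i\<close>
  for the one at \<open>t - \<tau>\<close>.
\<close>

type_synonym ('n, 'k) jet = "real \<times> (real ^ 'n ^ 'k) \<times> (real ^ 'n ^ 'k)"

text \<open>\<open>a\<close> and \<open>b\<close> are the end points of the interval on which \<open>q\<close> is considered.\<close>

definition delayed_jet ::
    "nat \<Rightarrow> (nat \<Rightarrow> 'k::finite) \<Rightarrow> real \<Rightarrow> real \<Rightarrow> real \<Rightarrow> (real \<Rightarrow> real ^ 'n::finite) \<Rightarrow> real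
      \<Rightarrow> ('n, 'k) jet" where
  "delayed_jet m e a b \<tau> q t =
     (t, \<chi> k. nth_deriv a b (inv_into {..m} e k) q t,
         \<chi> k. nth_deriv a b (inv_into {..m} e k) q (t - \<tau>))"

definition gradient :: "('a::real_inner \<Rightarrow> real) \<Rightarrow> 'a \<Rightarrow> 'a" where
  "gradient f x = (THE v. GDERIV f x :> v)"

text \<open>
  For \<open>k = e i\<close>, \<open>grad_cur G k\<close> is \<open>\<partial>\<^bsub>i+2\<^esub>G\<close> and \<open>grad_del G k\<close> is \<open>\<partial>\<^bsub>i+m+3\<^esub>G\<close>.
\<close>

definition grad_cur ::
    "(('n::finite, 'k::finite) jet \<Rightarrow> real) \<Rightarrow> 'k \<Rightarrow> ('n, 'k) jet \<Rightarrow> real ^ 'n" where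
  "grad_cur G k = (\<lambda>(t, x, y). gradient (\<lambda>u. G (t, \<chi> j. if j = k then u else x $ j, y)) (x $ k))"

definition grad_del ::
    "(('n::finite, 'k::finite) jet \<Rightarrow> real) \<Rightarrow> 'k \<Rightarrow> ('n, 'k) jet \<Rightarrow> real ^ 'n" where
  "grad_del G k = (\<lambda>(t, x, y). gradient (\<lambda>u. G (t, x, \<chi> j. if j = k then u else y $ j)) (y $ k))"

section \<open>The isoperimetric problem with delay\<close>

text \<open>
  Integrals are taken with respect to \<open>lebesgue\<close> rather than \<open>lborel\<close>, since the highest
  derivative of \<open>q\<close> is determined only up to a Lebesgue null set.
\<close>

definition delay_functional ::
    "nat \<Rightarrow> (nat \<Rightarrow> 'k::finite) \<Rightarrow> real \<Rightarrow> real \<Rightarrow> real \<Rightarrow> (('n::finite, 'k) jet \<Rightarrow> real)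
      \<Rightarrow> (real \<Rightarrow> real ^ 'n) \<Rightarrow> real" where
  "delay_functional m e t1 t2 \<tau> G q =
     (LINT t:{t1..t2}|lebesgue. G (delayed_jet m e (t1 - \<tau>) t2 \<tau> q t))"

text \<open>\<open>qe\<close> is the prescribed value at \<open>t2\<close>, \<open>qd i\<close> that of the \<open>i\<close>th derivative.\<close>

definition admissible ::
    "nat \<Rightarrow> (nat \<Rightarrow> 'k::finite) \<Rightarrow> real \<Rightarrow> real \<Rightarrow> real \<Rightarrow> (('n::finite, 'k) jet \<Rightarrow> real) \<Rightarrow> real
      \<Rightarrow> (real \<Rightarrow> real ^ 'n) \<Rightarrow> real ^ 'n \<Rightarrow> (nat \<Rightarrow> real ^ 'n) \<Rightarrow> (real \<Rightarrow> real ^ 'n) set" where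
  "admissible m e t1 t2 \<tau> g l \<delta> qe qd = {q \<in> sobolev_inf m (t1 - \<tau>) t2.
     delay_functional m e t1 t2 \<tau> g q = l \<and>
     (\<forall>t\<in>{t1 - \<tau>..t1}. q t = \<delta> t) \<and>
     q t2 = qe \<and>
     (\<forall>i\<in>{1..<m}. nth_deriv (t1 - \<tau>) t2 i q t2 = qd i)}"

definition local_extremizer ::
    "nat \<Rightarrow> real \<Rightarrow> real \<Rightarrow> ((real \<Rightarrow> 'b::euclidean_space) \<Rightarrow> real) \<Rightarrow> (real \<Rightarrow> 'b) set
      \<Rightarrow> (real \<Rightarrow> 'b) \<Rightarrow> bool" where
  "local_extremizer m a b J A q \<longleftrightarrow> q \<in> A \<and>
     ((\<exists>\<epsilon>>0. \<forall>x\<in>A. sobolev_inf_norm m a b (\<lambda>t. x t - q t) < ereal \<epsilon> \<longrightarrow> J q \<le> J x) \<or>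
      (\<exists>\<epsilon>>0. \<forall>x\<in>A. sobolev_inf_norm m a b (\<lambda>t. x t - q t) < ereal \<epsilon> \<longrightarrow> J x \<le> J q))"

section \<open>Euler--Lagrange equations in the sense of distributions\<close>

definition test_functions :: "real \<Rightarrow> real \<Rightarrow> (real \<Rightarrow> real) set" where
  "test_functions a b =
     {\<phi>. smooth_on UNIV \<phi> \<and> (\<exists>c d. a < c \<and> d < b \<and> (\<forall>t. t \<notin> {c..d} \<longrightarrow> \<phi> t = 0))}"

text \<open>The \<open>i\<close>th distributional derivative of \<open>f\<close> on the open interval \<open>(a, b)\<close>.\<close>

definition distr_deriv ::
    "real \<Rightarrow> real \<Rightarrow> nat \<Rightarrow> (real \<Rightarrow> 'b::euclidean_space) \<Rightarrow> (real \<Rightarrow> real) \<Rightarrow> 'b" where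
  "distr_deriv a b i f = (\<lambda>\<phi>.
     (-1) ^ i *\<^sub>R (LINT t:{a<..<b}|lebesgue. (deriv ^^ i) \<phi> t *\<^sub>R f t))"

definition euler_lagrange ::
    "nat \<Rightarrow> (nat \<Rightarrow> 'k::finite) \<Rightarrow> real \<Rightarrow> real \<Rightarrow> real \<Rightarrow> (('n::finite, 'k) jet \<Rightarrow> real)
      \<Rightarrow> (real \<Rightarrow> real ^ 'n) \<Rightarrow> bool" where
  "euler_lagrange m e t1 t2 \<tau> g q \<longleftrightarrow>
     (let z = delayed_jet m e (t1 - \<tau>) t2 \<tau> q in
       (\<forall>\<phi>\<in>test_functions t1 (t2 - \<tau>).
          (\<Sum>i\<le>m. (-1) ^ i *\<^sub>R distr_deriv t1 (t2 - \<tau>) i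
             (\<lambda>t. grad_cur g (e i) (z t) + grad_del g (e i) (z (t + \<tau>))) \<phi>) = 0) \<and>
       (\<forall>\<phi>\<in>test_functions (t2 - \<tau>) t2.
          (\<Sum>i\<le>m. (-1) ^ i *\<^sub>R distr_deriv (t2 - \<tau>) t2 i
             (\<lambda>t. grad_cur g (e i) (z t)) \<phi>) = 0))"

definition normal_extremizer ::
    "nat \<Rightarrow> (nat \<Rightarrow> 'k::finite) \<Rightarrow> real \<Rightarrow> real \<Rightarrow> real
      \<Rightarrow> (('n::finite, 'k) jet \<Rightarrow> real) \<Rightarrow> (('n, 'k) jet \<Rightarrow> real) \<Rightarrow> real
      \<Rightarrow> (real \<Rightarrow> real ^ 'n) \<Rightarrow> real ^ 'n \<Rightarrow> (nat \<Rightarrow> real ^ 'n) \<Rightarrow> (real \<Rightarrow> real ^ 'n) \<Rightarrow> bool" where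
  "normal_extremizer m e t1 t2 \<tau> L g l \<delta> qe qd q \<longleftrightarrow>
     local_extremizer m (t1 - \<tau>) t2 (delay_functional m e t1 t2 \<tau> L)
       (admissible m e t1 t2 \<tau> g l \<delta> qe qd) q \<and>
     \<not> euler_lagrange m e t1 t2 \<tau> g q"

section \<open>Iterated integrals\<close>

text \<open>
  The \<open>k\<close>-fold iterated integral based at \<open>c\<close>; integrals are oriented, so \<open>t < c\<close> is allowed.
\<close>

primrec iter_integral ::
    "real \<Rightarrow> nat \<Rightarrow> (real \<Rightarrow> 'b::euclidean_space) \<Rightarrow> real \<Rightarrow> 'b" where
  "iter_integral c 0 f = f"
| "iter_integral c (Suc k) f = (\<lambda>t. LINT s=ereal c..ereal t|lebesgue. iter_integral c k f s)"

end

(*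
The proof is by Lagrange multipliers and an iterated du Bois-Reymond lemma.

Perturb q by s1 phi v + s2 psi w with vectors v, w and scalar functions phi, psi of class C^m that
vanish up to t1 and, with their derivatives up to order m, at t1 and t2.  Both functionals become
functions of (s1, s2) that are continuous near 0 and differentiable at 0, which is all that a local
open mapping theorem needs: at a constrained extremum their gradients are parallel.  Normality
provides a psi w along which the constraint has nonzero derivative, hence a multiplier lambda such
that the first variation of F = L - lambda g vanishes.  Shifting time in the delayed terms, it reads
  SUM i<=m. INTEGRAL_{t1}^{t2} phi^(i) f_i = 0,
where f_i is the expression in the theorem of which the integral of order m - i is taken.

Choosing phi of class C^(m+1), integration by parts moves all derivatives onto phi^(m+1), whose
cofactor H is a continuous combination of iterated integrals of the f_i.  The functions phi^(m+1)
range over all continuous functions orthogonal to the polynomials of degree at most m, so H is such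
a polynomial; the theorem is H' = P' almost everywhere.  No Lebesgue differentiation is needed: an
integral vanishing over every subinterval has an integrand vanishing almost everywhere.
*)
theory Submission
  imports Defs
begin

section \<open>Integration by parts and iterated integrals\<close>

text \<open>The obstacle is regularity: the derivative of order \<open>m\<close> of \<open>q\<close>
  exists only almost everywhere and is merely bounded and measurable, and so are the f_i.
  Integration by parts and the du Bois-Reymond argument are therefore done for bounded measurable
  functions, and jets are built from representatives bounded at every time, which stay in a compact
  convex set where a Lagrangian is linearised uniformly.

  Both equations come from one identity on [t1, t2]. The shift of time leaves the delayed gradient,
  now at t + \<tau>, only for t \<le> t2 - \<tau>, so f_i is one function with two formulas. The
  base point t2 - \<tau> lies in both subintervals; on either side the iterated integrals see one
  formula only, and the same polynomial serves both.

  The multiplier is a single number because psi and w are fixed before phi and v vary. Variations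
  vanish at t1 up to order m because they are extended by zero over the delay interval. Test
  functions of the weak Euler-Lagrange equations, on either open subinterval, are variations on
  [t1, t2]; were the first variation of g zero on all variations, normality would fail.\<close>

lemma locally_small_increments_imp_eq:
  fixes D :: "real \<Rightarrow> 'b::real_normed_vector"
  assumes "a \<le> b"
    and small: "\<And>e. 0 < e \<Longrightarrow> \<exists>d>0. \<forall>u v. a \<le> u \<and> u \<le> v \<and> v \<le> b \<and> v - u < d \<longrightarrow>
                  norm (D v - D u) \<le> e * (v - u)"
  shows "D b = D a"
proof -
  \<comment> \<open>The bound is uniform over short intervals, so it controls the difference
    quotients on both sides of every point by an arbitrary \<open>e\<close>.\<close>
  have "(D has_derivative (\<lambda>h. 0)) (at x within {a..b})" if x: "x \<in> {a..b}" for x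
    unfolding has_derivative_within_alt
  proof (intro conjI allI impI)
    fix e :: real assume "0 < e"
    then obtain d where "d > 0" and d: "\<And>u v. \<lbrakk>a \<le> u; u \<le> v; v \<le> b; v - u < d\<rbrakk> \<Longrightarrow>
        norm (D v - D u) \<le> e * (v - u)"
      using small[of e] by blast
    have "norm (D y - D x - 0) \<le> e * norm (y - x)" if "y \<in> {a..b}" "norm (y - x) < d" for y
      using d[of x y] d[of y x] that x
      by (cases "x \<le> y") (auto simp: norm_minus_commute)
    with \<open>d > 0\<close> show "\<exists>d>0. \<forall>y\<in>{a..b}. norm (y - x) < d \<longrightarrow> norm (D y - D x - 0) \<le> e * norm (y - x)"
      by blast
  qed auto
  then obtain c where "\<And>x. x \<in> {a..b} \<Longrightarrow> D x = c"
    using has_derivative_zero_constant[of "{a..b}" D] by auto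
  then show ?thesis using assms(1) by auto
qed

lemma continuous_on_Icc_norm_bound:
  fixes f :: "real \<Rightarrow> 'b::real_normed_vector"
  assumes "continuous_on {a..b} f"
  obtains B where "0 \<le> B" "\<And>t. t \<in> {a..b} \<Longrightarrow> norm (f t) \<le> B"
proof -
  have "bounded (f ` {a..b})"
    using assms compact_continuous_image compact_imp_bounded by blast
  then obtain B where "0 < B" "\<forall>x\<in>f ` {a..b}. norm x \<le> B"
    unfolding bounded_pos by blast
  with that[of B] show thesis by auto
qed

lemma absolutely_integrable_bounded_measurable:
  fixes f :: "real \<Rightarrow> 'b::euclidean_space"
  assumes "f \<in> borel_measurable (lebesgue_on {a..b})" "\<And>t. t \<in> {a..b} \<Longrightarrow> norm (f t) \<le> M"
  shows "f absolutely_integrable_on {a..b}"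
  using assms by (intro measurable_bounded_by_integrable_imp_absolutely_integrable[where g="\<lambda>_. M"]) auto

lemma integrable_bounded_measurable:
  fixes f :: "real \<Rightarrow> 'b::euclidean_space"
  assumes "f \<in> borel_measurable (lebesgue_on {a..b})" "\<And>t. t \<in> {a..b} \<Longrightarrow> norm (f t) \<le> M"
  shows "f integrable_on {a..b}"
  using absolutely_integrable_bounded_measurable[OF assms] set_lebesgue_integral_eq_integral(1) by blast

lemma norm_integral_le_length:
  fixes f :: "real \<Rightarrow> 'b::euclidean_space"
  assumes "f integrable_on {u..v}" "u \<le> v" "\<And>t. t \<in> {u..v} \<Longrightarrow> norm (f t) \<le> B"
  shows "norm (integral {u..v} f) \<le> B * (v - u)"
proof -
  have "norm (integral {u..v} f) \<le> integral {u..v} (\<lambda>_. B)"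
    using assms by (intro integral_norm_bound_integral) auto
  then show ?thesis using assms by (simp add: mult.commute)
qed

lemma integral_Icc_diff:
  fixes f :: "real \<Rightarrow> 'b::euclidean_space"
  assumes "f integrable_on {a..b}" "a \<le> u" "u \<le> v" "v \<le> b"
  shows "integral {a..v} f - integral {a..u} f = integral {u..v} f"
proof -
  have "f integrable_on {a..v}"
    by (rule integrable_subinterval_real[OF assms(1)]) (use assms in auto)
  from Henstock_Kurzweil_Integration.integral_combine[OF assms(2,3) this] show ?thesis
    by (simp add: algebra_simps)
qed

lemma measurable_lebesgue_on_subinterval:
  assumes "f \<in> borel_measurable (lebesgue_on {a..b::real})" "{c..d} \<subseteq> {a..b}"
  shows "f \<in> borel_measurable (lebesgue_on {c..d})"
  using measurable_restrict_mono[OF assms] .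

lemma norm_inner_le:
  fixes x y :: "'b::real_inner"
  assumes "norm x \<le> A" "norm y \<le> B"
  shows "norm (x \<bullet> y) \<le> A * B"
proof -
  have "norm (x \<bullet> y) \<le> norm x * norm y" by (simp add: Cauchy_Schwarz_ineq2)
  also have "\<dots> \<le> A * B"
    using assms order_trans[OF norm_ge_zero assms(1)] by (intro mult_mono) auto
  finally show ?thesis .
qed

text \<open>The constant \<open>C\<close> is free because \<phi> vanishes at both ends; this is what
  later allows iterated integrals based at an interior point.\<close>

lemma integral_by_parts_bounded_measurable:
  fixes f F :: "real \<Rightarrow> 'b::euclidean_space" and \<phi> \<psi> :: "real \<Rightarrow> real"
  assumes ab: "a \<le> b"
    and f: "f \<in> borel_measurable (lebesgue_on {a..b})" "\<And>t. t \<in> {a..b} \<Longrightarrow> norm (f t) \<le> M"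
    and F: "\<And>t. t \<in> {a..b} \<Longrightarrow> F t = C + integral {a..t} f"
    and \<phi>: "\<And>t. t \<in> {a..b} \<Longrightarrow> (\<phi> has_vector_derivative \<psi> t) (at t within {a..b})"
    and \<psi>: "continuous_on {a..b} \<psi>"
    and bd: "\<phi> a = 0" "\<phi> b = 0"
  shows "integral {a..b} (\<lambda>t. \<phi> t *\<^sub>R f t) = - integral {a..b} (\<lambda>t. \<psi> t *\<^sub>R F t)"
proof -
  have fi: "f integrable_on {a..b}"
    by (rule integrable_bounded_measurable[OF f])
  have cF: "continuous_on {a..b} F"
    by (subst continuous_on_cong[OF refl F])
      (auto intro!: continuous_intros indefinite_integral_continuous_1 fi)
  have c\<phi>: "continuous_on {a..b} \<phi>"
    using \<phi> by (intro continuous_on_vector_derivative) 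
  have M0: "0 \<le> M" using f(2)[of a] ab order_trans[OF norm_ge_zero] by auto
  obtain K where K: "\<And>t. t \<in> {a..b} \<Longrightarrow> \<bar>\<psi> t\<bar> \<le> K" and K0: "0 \<le> K"
    using continuous_on_Icc_norm_bound[OF \<psi>] by auto
  have \<phi>m: "\<phi> \<in> borel_measurable (lebesgue_on {a..b})"
    by (rule continuous_imp_measurable_on_sets_lebesgue[OF c\<phi>]) simp
  obtain B where B: "\<And>t. t \<in> {a..b} \<Longrightarrow> \<bar>\<phi> t\<bar> \<le> B"
    using continuous_on_Icc_norm_bound[OF c\<phi>] by auto
  have \<phi>f: "(\<lambda>t. \<phi> t *\<^sub>R f t) integrable_on {a..b}"
  proof (rule integrable_bounded_measurable)
    show "(\<lambda>t. \<phi> t *\<^sub>R f t) \<in> borel_measurable (lebesgue_on {a..b})"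
      using \<phi>m f by simp
    show "norm (\<phi> t *\<^sub>R f t) \<le> B * M" if "t \<in> {a..b}" for t
      using B[OF that] f(2)[OF that] by (auto intro!: mult_mono)
  qed
  have \<psi>F: "(\<lambda>t. \<psi> t *\<^sub>R F t) integrable_on {a..b}"
    by (intro integrable_continuous_real continuous_intros \<psi> cF)
  \<comment> \<open>\<open>F\<close> is only Lipschitz, so \<open>D\<close> cannot be differentiated termwise, but its increments are quadratically small.\<close>
  define D where "D t = integral {a..t} (\<lambda>s. \<phi> s *\<^sub>R f s) - \<phi> t *\<^sub>R F t + integral {a..t} (\<lambda>s. \<psi> s *\<^sub>R F s)" for t
  have incr: "norm (D v - D u) \<le> (2 * K * M * (v - u)) * (v - u)" if uv: "a \<le> u" "u \<le> v" "v \<le> b" for u v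
  proof -
    have sub: "{u..v} \<subseteq> {a..b}" using uv by auto
    have [simp]: "f integrable_on {u..v}" "(\<lambda>t. \<phi> t *\<^sub>R f t) integrable_on {u..v}"
      "(\<lambda>t. \<psi> t *\<^sub>R F t) integrable_on {u..v}"
      using fi \<phi>f \<psi>F integrable_subinterval_real[OF _ sub] by auto
    have \<psi>i: "(\<psi> has_integral (\<phi> t - \<phi> s)) {s..t}" if "a \<le> s" "s \<le> t" "t \<le> b" for s t
      using that by (intro fundamental_theorem_of_calculus)
        (auto intro!: has_vector_derivative_within_subset[OF \<phi>])
    have Fd: "F t - F s = integral {s..t} f" if "a \<le> s" "s \<le> t" "t \<le> b" for s t
      using integral_Icc_diff[OF fi that] F that by auto
    have \<phi>vf: "(\<lambda>s. \<phi> v *\<^sub>R f s) integrable_on {u..v}"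
      by (rule integrable_cmul) simp
    \<comment> \<open>The increment of \<phi> F over [u, v] is \<phi>(v) (F v - F u) + (\<phi>(v) -
      \<phi>(u)) F u. Each summand is absorbed into one of the two integrals, which freezes \<phi>
      at the right end and F at the left end; both integrands are then of order v - u.\<close>
    have e1: "integral {u..v} (\<lambda>s. \<phi> s *\<^sub>R f s) - \<phi> v *\<^sub>R (F v - F u) = integral {u..v} (\<lambda>s. (\<phi> s - \<phi> v) *\<^sub>R f s)"
      unfolding Fd[OF uv] scaleR_diff_left by (subst integral_diff) (use \<phi>vf in auto)
    have \<psi>Fu: "((\<lambda>s. \<psi> s *\<^sub>R F u) has_integral (\<phi> v - \<phi> u) *\<^sub>R F u) {u..v}"
      by (intro has_integral_scaleR_left \<psi>i uv)
    have e2: "integral {u..v} (\<lambda>s. \<psi> s *\<^sub>R F s) - (\<phi> v - \<phi> u) *\<^sub>R F u = integral {u..v} (\<lambda>s. \<psi> s *\<^sub>R (F s - F u))"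
      unfolding scaleR_diff_right integral_unique[OF \<psi>Fu, symmetric]
      by (subst integral_diff) (use \<psi>Fu in \<open>auto simp: has_integral_integrable\<close>)
    have "D v - D u = integral {u..v} (\<lambda>s. \<phi> s *\<^sub>R f s) + integral {u..v} (\<lambda>s. \<psi> s *\<^sub>R F s) - (\<phi> v *\<^sub>R F v - \<phi> u *\<^sub>R F u)"
      using integral_Icc_diff[OF \<phi>f uv] integral_Icc_diff[OF \<psi>F uv] by (simp add: D_def algebra_simps)
    also have "\<dots> = integral {u..v} (\<lambda>s. (\<phi> s - \<phi> v) *\<^sub>R f s) + integral {u..v} (\<lambda>s. \<psi> s *\<^sub>R (F s - F u))"
      unfolding e1[symmetric] e2[symmetric] by (simp add: algebra_simps)
    also have "norm \<dots> \<le> (K * (v - u) * M) * (v - u) + (K * (M * (v - u))) * (v - u)"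
    proof (intro norm_triangle_le add_mono norm_integral_le_length uv)
      show "(\<lambda>s. (\<phi> s - \<phi> v) *\<^sub>R f s) integrable_on {u..v}"
        unfolding scaleR_diff_left by (intro integrable_diff) (use \<phi>vf in auto)
      show "(\<lambda>s. \<psi> s *\<^sub>R (F s - F u)) integrable_on {u..v}"
        unfolding scaleR_diff_right
        by (intro integrable_diff) (use \<psi>Fu in \<open>auto simp: has_integral_integrable\<close>)
    next
      fix t assume t: "t \<in> {u..v}"
      have "\<bar>\<phi> v - \<phi> t\<bar> \<le> K * (v - t)"
        using norm_integral_le_length[of \<psi> t v K] \<psi>i[of t v] t uv K by (auto simp: has_integral_iff)
      also have "\<dots> \<le> K * (v - u)" using t K0 by (intro mult_left_mono) auto
      finally show "norm ((\<phi> t - \<phi> v) *\<^sub>R f t) \<le> K * (v - u) * M"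
        using f(2)[of t] t uv K0 by (auto intro!: mult_mono)
      have "norm (F t - F u) \<le> M * (t - u)"
        using Fd[of u t] norm_integral_le_length[of f u t M] integrable_subinterval_real[OF fi, of u t] t uv f(2) by auto
      also have "\<dots> \<le> M * (v - u)" using t M0 by (intro mult_left_mono) auto
      finally show "norm (\<psi> t *\<^sub>R (F t - F u)) \<le> K * (M * (v - u))"
        using K[of t] t uv K0 by (auto intro!: mult_mono)
    qed
    finally show ?thesis by (simp add: algebra_simps)
  qed
  have "D b = D a"
  proof (rule locally_small_increments_imp_eq[OF ab])
    fix e :: real assume "0 < e"
    \<comment> \<open>The summand 1 keeps the denominator positive when \<open>K\<close> or
      \<open>M\<close> is 0.\<close>
    define d where "d = e / (2 * K * M + 1)"
    have pos: "0 < 2 * K * M + 1" using K0 M0 by (simp add: add_nonneg_pos)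
    have "norm (D v - D u) \<le> e * (v - u)" if "a \<le> u" "u \<le> v" "v \<le> b" "v - u < d" for u v
    proof -
      have "(2 * K * M) * (v - u) \<le> (2 * K * M + 1) * (v - u)" using that by (intro mult_right_mono) auto
      also have "\<dots> \<le> e" using that pos by (simp add: d_def field_simps)
      finally show ?thesis
        using incr[OF that(1-3)] that(2) by (meson diff_ge_0_iff_ge mult_right_mono order_trans)
    qed
    then show "\<exists>d>0. \<forall>u v. a \<le> u \<and> u \<le> v \<and> v \<le> b \<and> v - u < d \<longrightarrow> norm (D v - D u) \<le> e * (v - u)"
      using pos \<open>0 < e\<close> by (intro exI[of _ d]) (auto simp: d_def)
  qed
  then show ?thesis using bd by (simp add: D_def eq_neg_iff_add_eq_0)
qed

text \<open>Vanishing over all subintervals passes to continuous weights, which are nearly constant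
  on short intervals, and from these by bounded approximation to the weight \<open>k\<close> itself.
  Hence the integral of \<open>k t \<bullet> k t\<close> is zero.\<close>

lemma AE_zero_if_integrals_zero:
  fixes k :: "real \<Rightarrow> 'b::euclidean_space"
  assumes ab: "a \<le> b"
    and k: "k \<in> borel_measurable (lebesgue_on {a..b})" "\<And>t. t \<in> {a..b} \<Longrightarrow> norm (k t) \<le> M"
    and zero: "\<And>t. t \<in> {a..b} \<Longrightarrow> integral {a..t} k = 0"
  shows "\<exists>N. negligible N \<and> (\<forall>t\<in>{a..b} - N. k t = 0)"
proof -
  have ki: "k integrable_on {a..b}" by (rule integrable_bounded_measurable[OF k])
  have zero': "integral {u..v} k = 0" if "a \<le> u" "u \<le> v" "v \<le> b" for u v
    using integral_Icc_diff[OF ki that] zero that by auto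
  have M0: "0 \<le> M" using k(2)[of a] ab order_trans[OF norm_ge_zero] by auto
  have test: "integral {a..b} (\<lambda>t. g t \<bullet> k t) = 0" if g: "continuous_on {a..b} g" for g
  proof -
    obtain B where B: "\<And>t. t \<in> {a..b} \<Longrightarrow> norm (g t) \<le> B"
      using continuous_on_Icc_norm_bound[OF g] by auto
    have gi: "(\<lambda>t. g t \<bullet> k t) integrable_on {a..b}"
    proof (rule integrable_bounded_measurable)
      show "(\<lambda>t. g t \<bullet> k t) \<in> borel_measurable (lebesgue_on {a..b})"
        using continuous_imp_measurable_on_sets_lebesgue[OF g] k by simp
      show "norm (g t \<bullet> k t) \<le> B * M" if "t \<in> {a..b}" for t
        by (intro norm_inner_le B k(2) that)
    qed
    define D where "D t = integral {a..t} (\<lambda>t. g t \<bullet> k t)" for t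
    have "D b = D a"
    proof (rule locally_small_increments_imp_eq[OF ab])
      fix e :: real assume "0 < e"
      have pos: "0 < M + 1" using M0 by simp
      have "uniformly_continuous_on {a..b} g"
        by (rule compact_uniformly_continuous[OF g compact_Icc])
      then obtain d where "d > 0" and
        d: "\<And>s t. \<lbrakk>s \<in> {a..b}; t \<in> {a..b}; dist t s < d\<rbrakk> \<Longrightarrow> dist (g t) (g s) < e / (M + 1)"
        unfolding uniformly_continuous_on_def using divide_pos_pos[OF \<open>0 < e\<close> pos] by blast
      have "norm (D v - D u) \<le> e * (v - u)" if uv: "a \<le> u" "u \<le> v" "v \<le> b" "v - u < d" for u v
      proof -
        have sub: "{u..v} \<subseteq> {a..b}" using uv by auto
        have [simp]: "k integrable_on {u..v}" "(\<lambda>t. g t \<bullet> k t) integrable_on {u..v}"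
          using ki gi integrable_subinterval_real[OF _ sub] by auto
        have gu: "((\<lambda>t. g u \<bullet> k t) has_integral (g u \<bullet> integral {u..v} k)) {u..v}"
          using has_integral_linear[OF integrable_integral[of k "{u..v}"] bounded_linear_inner_right[of "g u"]]
          by (simp add: o_def)
        have "D v - D u = integral {u..v} (\<lambda>t. g t \<bullet> k t)"
          using integral_Icc_diff[OF gi uv(1-3)] by (simp add: D_def)
        also have "\<dots> = integral {u..v} (\<lambda>t. g t \<bullet> k t) - integral {u..v} (\<lambda>t. g u \<bullet> k t)"
          using integral_unique[OF gu] zero'[OF uv(1-3)] by simp
        also have "\<dots> = integral {u..v} (\<lambda>t. g t \<bullet> k t - g u \<bullet> k t)"
          by (rule integral_diff[symmetric]) (use gu in \<open>auto simp: has_integral_integrable\<close>)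
        also have "norm \<dots> \<le> e * (v - u)"
        proof (rule norm_integral_le_length[OF _ uv(2)])
          show "(\<lambda>t. g t \<bullet> k t - g u \<bullet> k t) integrable_on {u..v}"
            by (rule integrable_diff) (use gu in \<open>auto simp: has_integral_integrable\<close>)
          fix t assume t: "t \<in> {u..v}"
          have "norm (g t \<bullet> k t - g u \<bullet> k t) \<le> norm (g t - g u) * norm (k t)"
            using Cauchy_Schwarz_ineq2[of "g t - g u" "k t"] by (simp add: inner_diff_left)
          also have "\<dots> \<le> e / (M + 1) * M"
            using d[of u t] k(2)[of t] t uv pos \<open>0 < e\<close> by (intro mult_mono) (auto simp: dist_norm)
          also have "\<dots> \<le> e" using pos \<open>0 < e\<close> by (simp add: field_simps)
          finally show "norm (g t \<bullet> k t - g u \<bullet> k t) \<le> e" .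
        qed
        finally show ?thesis .
      qed
      with \<open>d > 0\<close> show "\<exists>d>0. \<forall>u v. a \<le> u \<and> u \<le> v \<and> v \<le> b \<and> v - u < d \<longrightarrow> norm (D v - D u) \<le> e * (v - u)"
        by blast
    qed
    then show ?thesis by (simp add: D_def)
  qed
  have "k measurable_on {a..b}"
    using k(1) by (simp add: measurable_on_iff_borel_measurable)
  then obtain N g where N: "negligible N" and g: "\<And>n. continuous_on UNIV (g n)"
    and lim: "\<And>x. x \<notin> N \<Longrightarrow> (\<lambda>n. g n x) \<longlonglongrightarrow> (if x \<in> {a..b} then k x else 0)"
    unfolding measurable_on_def by (elim exE conjE) blast
  \<comment> \<open>A continuous retraction onto the ball of radius \<open>M + 1\<close> that fixes
    all values of \<open>k\<close>. It bounds the approximants uniformly without spoiling their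
    limit. The radius exceeds \<open>M\<close> so as to be positive.\<close>
  define c where "c x = ((M + 1) / max (M + 1) (norm x)) *\<^sub>R x" for x :: 'b
  have cc: "continuous_on UNIV c"
    unfolding c_def using M0 by (intro continuous_intros) (auto simp: max_def)
  have cM: "norm (c x) \<le> M + 1" for x
    using M0 by (cases "norm x \<le> M + 1") (auto simp: c_def max_def)
  have ck: "c (k t) = k t" if "t \<in> {a..b}" for t
    using k(2)[OF that] M0 by (simp add: c_def max_def)
  \<comment> \<open>The redefinition on the null set makes the convergence hold at every point of
    the interval, as \<open>dominated_convergence\<close> asks.\<close>
  define f where "f n t = (if t \<in> N then k t \<bullet> k t else c (g n t) \<bullet> k t)" for n t
  have cg: "continuous_on {a..b} (\<lambda>t. c (g n t))" for n
    using continuous_on_compose2[OF cc g[of n]] continuous_on_subset by blast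
  have cgi: "(\<lambda>t. c (g n t) \<bullet> k t) integrable_on {a..b}" for n
  proof (rule integrable_bounded_measurable)
    show "(\<lambda>t. c (g n t) \<bullet> k t) \<in> borel_measurable (lebesgue_on {a..b})"
      using continuous_imp_measurable_on_sets_lebesgue[OF cg] k by simp
    show "norm (c (g n t) \<bullet> k t) \<le> (M + 1) * M" if "t \<in> {a..b}" for t
      by (intro norm_inner_le cM k(2) that)
  qed
  have f_int: "f n integrable_on {a..b}" for n
    by (rule integrable_spike[OF cgi[of n] N]) (simp add: f_def)
  have f_zero: "integral {a..b} (f n) = 0" for n
    using integral_spike[OF N, of "{a..b}" "f n" "\<lambda>t. c (g n t) \<bullet> k t"] test[OF cg[of n]]
    by (simp add: f_def)
  have bound: "norm (f n t) \<le> (M + 1) * (M + 1)" if "t \<in> {a..b}" for n t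
  proof -
    have "norm (k t \<bullet> k t) \<le> (M + 1) * (M + 1)" "norm (c (g n t) \<bullet> k t) \<le> (M + 1) * (M + 1)"
      using k(2)[OF that] cM[of "g n t"] by (auto intro!: norm_inner_le simp del: real_norm_def)
    then show ?thesis by (simp add: f_def)
  qed
  have lim: "(\<lambda>n. f n t) \<longlonglongrightarrow> k t \<bullet> k t" if t: "t \<in> {a..b}" for t
  proof (cases "t \<in> N")
    case False
    then have "(\<lambda>n. c (g n t)) \<longlonglongrightarrow> c (k t)"
      using lim[OF False] t cc by (auto intro: continuous_on_tendsto_compose)
    then show ?thesis using False by (auto simp: f_def ck[OF t] intro: tendsto_intros)
  qed (simp add: f_def)
  have "(\<lambda>n. integral {a..b} (f n)) \<longlonglongrightarrow> integral {a..b} (\<lambda>t. k t \<bullet> k t)"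
    by (rule dominated_convergence(2)[OF f_int _ bound lim]) auto
  then have "integral {a..b} (\<lambda>t. k t \<bullet> k t) = 0"
    by (simp add: f_zero LIMSEQ_const_iff)
  moreover have ai: "(\<lambda>t. k t \<bullet> k t) absolutely_integrable_on {a..b}"
  proof (rule absolutely_integrable_bounded_measurable)
    show "(\<lambda>t. k t \<bullet> k t) \<in> borel_measurable (lebesgue_on {a..b})" using k(1) by simp
    show "norm (k t \<bullet> k t) \<le> M * M" if "t \<in> {a..b}" for t
      using k(2)[OF that] M0 by (auto simp: dot_square_norm power2_eq_square intro!: mult_mono)
  qed
  ultimately have "integral\<^sup>L lebesgue (\<lambda>t. indicator {a..b} t *\<^sub>R (k t \<bullet> k t)) = 0"
    using set_lebesgue_integral_eq_integral(2)[OF ai] by (simp add: set_lebesgue_integral_def)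
  then have "AE t in lebesgue. indicator {a..b} t *\<^sub>R (k t \<bullet> k t) = 0"
    using ai by (subst (asm) integral_nonneg_eq_0_iff_AE) (auto simp: set_integrable_def)
  then obtain N' where "N' \<in> null_sets lebesgue" "\<And>t. t \<notin> N' \<Longrightarrow> indicator {a..b} t *\<^sub>R (k t \<bullet> k t) = 0"
    unfolding completion.AE_iff_null_sets by auto
  then show ?thesis
    by (intro exI[of _ N']) (fastforce simp: negligible_iff_null_sets indicator_def)
qed

text \<open>A difference of integrals based at the left end \<open>a\<close> hides the orientation,
  so the cases \<open>c \<le> t\<close> and \<open>t < c\<close> need no separate treatment
  afterwards.\<close>

lemma interval_LINT_eq_integral_diff:
  fixes h :: "real \<Rightarrow> 'b::euclidean_space"
  assumes h: "h absolutely_integrable_on {a..b}" and ct: "c \<in> {a..b}" "t \<in> {a..b}"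
  shows "(LINT s=ereal c..ereal t|lebesgue. h s) = integral {a..t} h - integral {a..c} h"
proof -
  have hi: "h integrable_on {a..b}"
    by (rule set_lebesgue_integral_eq_integral(1)[OF h])
  have *: "(LINT s:{u<..<v}|lebesgue. h s) = integral {a..v} h - integral {a..u} h"
    if uv: "a \<le> u" "u \<le> v" "v \<le> b" for u v
  proof -
    have "h absolutely_integrable_on {u<..<v}"
      using uv by (intro set_integrable_subset[OF h]) auto
    from set_lebesgue_integral_eq_integral(2)[OF this] integral_Icc_diff[OF hi uv] show ?thesis
      by (simp add: integral_open_interval_real)
  qed
  show ?thesis
    using *[of c t] *[of t c] ct by (auto simp: interval_lebesgue_integral_def einterval_eq)
qed

section \<open>Iterated integrals and repeated integration by parts\<close>

lemma iter_integral_regular: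
  fixes f :: "real \<Rightarrow> 'b::euclidean_space"
  assumes c: "c \<in> {a..b}"
    and f: "f \<in> borel_measurable (lebesgue_on {a..b})" "\<forall>t\<in>{a..b}. norm (f t) \<le> M"
  shows "iter_integral c k f \<in> borel_measurable (lebesgue_on {a..b})"
    and "\<exists>M. \<forall>t\<in>{a..b}. norm (iter_integral c k f t) \<le> M"
    and "k \<noteq> 0 \<Longrightarrow> continuous_on {a..b} (iter_integral c k f)"
proof -
  have "iter_integral c k f \<in> borel_measurable (lebesgue_on {a..b}) \<and>
    (\<exists>M. \<forall>t\<in>{a..b}. norm (iter_integral c k f t) \<le> M) \<and>
    (k \<noteq> 0 \<longrightarrow> continuous_on {a..b} (iter_integral c k f))"
  proof (induction k)
    case (Suc k)
    then obtain M' where M': "\<forall>t\<in>{a..b}. norm (iter_integral c k f t) \<le> M'"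
      by (elim conjE exE)
    have h: "iter_integral c k f absolutely_integrable_on {a..b}"
      using Suc M' by (intro absolutely_integrable_bounded_measurable[of _ _ _ M']) auto
    have "continuous_on {a..b} (\<lambda>t. integral {a..t} (iter_integral c k f) - integral {a..c} (iter_integral c k f))"
      by (intro continuous_on_diff continuous_on_const indefinite_integral_continuous_1
          set_lebesgue_integral_eq_integral(1)[OF h])
    then have "continuous_on {a..b} (iter_integral c (Suc k) f)"
      by (rule continuous_on_eq) (simp add: interval_LINT_eq_integral_diff[OF h c])
    moreover from this have "\<exists>M. \<forall>t\<in>{a..b}. norm (iter_integral c (Suc k) f t) \<le> M"
      using continuous_on_Icc_norm_bound[of a b "iter_integral c (Suc k) f"] by metis
    ultimately show ?case
      using continuous_imp_measurable_on_sets_lebesgue[of "{a..b}" "iter_integral c (Suc k) f"]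
      by (simp del: iter_integral.simps)
  qed (use f in auto)
  then show "iter_integral c k f \<in> borel_measurable (lebesgue_on {a..b})"
    "\<exists>M. \<forall>t\<in>{a..b}. norm (iter_integral c k f t) \<le> M"
    "k \<noteq> 0 \<Longrightarrow> continuous_on {a..b} (iter_integral c k f)" by auto
qed

lemma iter_integral_absolutely_integrable:
  fixes f :: "real \<Rightarrow> 'b::euclidean_space"
  assumes "c \<in> {a..b}"
    and "f \<in> borel_measurable (lebesgue_on {a..b})" "\<forall>t\<in>{a..b}. norm (f t) \<le> M"
  shows "iter_integral c k f absolutely_integrable_on {a..b}"
proof -
  obtain M' where M': "\<forall>t\<in>{a..b}. norm (iter_integral c k f t) \<le> M'"
    using iter_integral_regular(2)[OF assms, of k] by (elim exE)
  show ?thesis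
    by (rule absolutely_integrable_bounded_measurable[OF iter_integral_regular(1)[OF assms] bspec[OF M']])
qed

lemma iter_integral_Suc_eq:
  fixes f :: "real \<Rightarrow> 'b::euclidean_space"
  assumes "c \<in> {a..b}" "f \<in> borel_measurable (lebesgue_on {a..b})" 
    "\<forall>t\<in>{a..b}. norm (f t) \<le> M" "t \<in> {a..b}"
  shows "iter_integral c (Suc k) f t =
    integral {a..t} (iter_integral c k f) - integral {a..c} (iter_integral c k f)"
  using interval_LINT_eq_integral_diff[OF iter_integral_absolutely_integrable[OF assms(1-3)] assms(1,4)]
  by simp

text \<open>Each step integrates the factor \<open>f\<close> once more. The primitive based at
  \<open>c\<close> differs from the one based at \<open>a\<close> by a constant, which is harmless
  because the functions \<open>\<phi> j\<close> with \<open>j < n\<close> vanish at both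
  ends.\<close>

lemma integral_by_parts_iter_integral:
  fixes f :: "real \<Rightarrow> 'b::euclidean_space" and \<phi> :: "nat \<Rightarrow> real \<Rightarrow> real"
  assumes c: "c \<in> {a..b}"
    and f: "f \<in> borel_measurable (lebesgue_on {a..b})" "\<forall>t\<in>{a..b}. norm (f t) \<le> M"
    and \<phi>: "\<And>j t. j < n \<Longrightarrow> t \<in> {a..b} \<Longrightarrow> (\<phi> j has_vector_derivative \<phi> (Suc j) t) (at t within {a..b})"
    and \<phi>n: "continuous_on {a..b} (\<phi> n)"
    and bd: "\<And>j. j < n \<Longrightarrow> \<phi> j a = 0 \<and> \<phi> j b = 0"
    and k: "i + k \<le> n"
  shows "integral {a..b} (\<lambda>t. \<phi> i t *\<^sub>R f t) =
    (-1) ^ k *\<^sub>R integral {a..b} (\<lambda>t. \<phi> (i + k) t *\<^sub>R iter_integral c k f t)"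
  using k
proof (induction k)
  case (Suc k)
  have ab: "a \<le> b" using c by auto
  obtain M' where M': "\<forall>t\<in>{a..b}. norm (iter_integral c k f t) \<le> M'"
    using iter_integral_regular(2)[OF c f, of k] by (elim exE)
  have cont: "continuous_on {a..b} (\<phi> (Suc (i + k)))"
  proof (cases "Suc (i + k) = n")
    case False
    then have "\<And>t. t \<in> {a..b} \<Longrightarrow> (\<phi> (Suc (i+k)) has_vector_derivative \<phi> (Suc (Suc (i+k))) t) (at t within {a..b})"
      using Suc.prems by (intro \<phi>) auto
    then show ?thesis by (rule continuous_on_vector_derivative)
  qed (use \<phi>n in auto)
  have "integral {a..b} (\<lambda>t. \<phi> (i + k) t *\<^sub>R iter_integral c k f t) =
      - integral {a..b} (\<lambda>t. \<phi> (Suc (i + k)) t *\<^sub>R iter_integral c (Suc k) f t)"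
  proof (rule integral_by_parts_bounded_measurable[OF ab iter_integral_regular(1)[OF c f] bspec[OF M']])
    show "iter_integral c (Suc k) f t = - integral {a..c} (iter_integral c k f) + integral {a..t} (iter_integral c k f)"
      if "t \<in> {a..b}" for t
      using iter_integral_Suc_eq[OF c f that] by simp
    show "(\<phi> (i + k) has_vector_derivative \<phi> (Suc (i + k)) t) (at t within {a..b})" if "t \<in> {a..b}" for t
      using Suc.prems that by (intro \<phi>) auto
  qed (use cont bd[of "i + k"] Suc.prems in auto)
  then show ?case using Suc by simp
qed simp

section \<open>The iterated du Bois-Reymond lemma\<close>

text \<open>Induction on the number of functionals: if the last one vanishes wherever the others do,
  the others suffice; otherwise some \<open>w0\<close> is detected by the last one alone, and
  subtracting a multiple of it moves an element into the common kernel. Linearity is expressed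
  through the single operation that this correction uses.\<close>

lemma vanishing_on_kernels_imp_combination:
  fixes \<mu> :: "nat \<Rightarrow> ('a \<Rightarrow> real) \<Rightarrow> real" and \<Lambda> :: "('a \<Rightarrow> real) \<Rightarrow> 'v::real_vector"
  assumes W: "\<And>v w r. v \<in> W \<Longrightarrow> w \<in> W \<Longrightarrow> (\<lambda>t. v t - r * w t) \<in> W"
    and \<mu>: "\<And>k v w r. k < n \<Longrightarrow> v \<in> W \<Longrightarrow> w \<in> W \<Longrightarrow> \<mu> k (\<lambda>t. v t - r * w t) = \<mu> k v - r * \<mu> k w"
    and \<Lambda>: "\<And>v w r. v \<in> W \<Longrightarrow> w \<in> W \<Longrightarrow> \<Lambda> (\<lambda>t. v t - r * w t) = \<Lambda> v - r *\<^sub>R \<Lambda> w"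
    and van: "\<And>w. w \<in> W \<Longrightarrow> (\<And>k. k < n \<Longrightarrow> \<mu> k w = 0) \<Longrightarrow> \<Lambda> w = 0"
  shows "\<exists>c. \<forall>w\<in>W. \<Lambda> w = (\<Sum>k<n. \<mu> k w *\<^sub>R c k)"
  using \<mu> \<Lambda> van
proof (induction n arbitrary: \<Lambda>)
  case (Suc n)
  show ?case
  proof (cases "\<forall>w\<in>W. (\<forall>k<n. \<mu> k w = 0) \<longrightarrow> \<mu> n w = 0")
    case True
    then have "\<exists>c. \<forall>w\<in>W. \<Lambda> w = (\<Sum>k<n. \<mu> k w *\<^sub>R c k)"
      by (intro Suc.IH Suc.prems) (auto simp: less_Suc_eq)
    then obtain c where "\<And>w. w \<in> W \<Longrightarrow> \<Lambda> w = (\<Sum>k<n. \<mu> k w *\<^sub>R c k)" by blast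
    then show ?thesis by (intro exI[of _ "c(n := 0)"]) auto
  next
    case False
    then obtain w0 where w0: "w0 \<in> W" "\<And>k. k < n \<Longrightarrow> \<mu> k w0 = 0" "\<mu> n w0 \<noteq> 0" by blast
    \<comment> \<open>Evaluation at \<open>w0\<close>, where the other functionals vanish, forces
      this coefficient.\<close>
    define v where "v = (1 / \<mu> n w0) *\<^sub>R \<Lambda> w0"
    have "\<exists>c. \<forall>w\<in>W. \<Lambda> w - \<mu> n w *\<^sub>R v = (\<Sum>k<n. \<mu> k w *\<^sub>R c k)"
    proof (rule Suc.IH)
      fix w assume w: "w \<in> W" "\<And>k. k < n \<Longrightarrow> \<mu> k w = 0"
      define r where "r = \<mu> n w / \<mu> n w0"
      have "\<mu> k (\<lambda>t. w t - r * w0 t) = 0" if "k < Suc n" for k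
        using Suc.prems(1)[OF that w(1) w0(1), of r] w w0 that
        by (cases "k = n") (auto simp: r_def)
      then have "\<Lambda> (\<lambda>t. w t - r * w0 t) = 0"
        by (intro Suc.prems(3) W w(1) w0(1))
      then show "\<Lambda> w - \<mu> n w *\<^sub>R v = 0"
        using Suc.prems(2)[OF w(1) w0(1), of r] by (simp add: v_def r_def)
    next
      fix w w' r assume "w \<in> W" "w' \<in> W"
      then show "\<Lambda> (\<lambda>t. w t - r * w' t) - \<mu> n (\<lambda>t. w t - r * w' t) *\<^sub>R v
          = \<Lambda> w - \<mu> n w *\<^sub>R v - r *\<^sub>R (\<Lambda> w' - \<mu> n w' *\<^sub>R v)"
        by (subst Suc.prems(1), simp_all, subst Suc.prems(2)) (simp_all add: algebra_simps)
    qed (use Suc.prems(1) in auto)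
    then obtain c where "\<And>w. w \<in> W \<Longrightarrow> \<Lambda> w - \<mu> n w *\<^sub>R v = (\<Sum>k<n. \<mu> k w *\<^sub>R c k)" by blast
    then have "\<Lambda> w = (\<Sum>k<Suc n. \<mu> k w *\<^sub>R (c(n := v)) k)" if "w \<in> W" for w
      using that by (simp add: diff_eq_eq)
    then show ?thesis by blast
  qed
qed (use van in auto)

text \<open>Moments of a test function at the right end carry powers of b - t, whereas the theorem
  has powers of t; the binomial expansion changes the basis without raising the degree.\<close>

lemma reflected_polynomial:
  fixes c :: "nat \<Rightarrow> 'v::real_vector" and b :: real
  shows "\<exists>d. \<forall>t. (\<Sum>j<m. (b - t) ^ j *\<^sub>R c j) = (\<Sum>i<m. t ^ i *\<^sub>R d i)"
proof -
  define \<alpha> where "\<alpha> j i = (if i \<le> j then of_nat (j choose i) * (-1) ^ i * b ^ (j - i) else 0)" for j i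
  have exp: "(b - t) ^ j = (\<Sum>i<m. t ^ i * \<alpha> j i)" if "j < m" for j and t :: real
  proof -
    have "(b - t) ^ j = (- t + b) ^ j" by simp
    also have "\<dots> = (\<Sum>i\<le>j. of_nat (j choose i) * (- t) ^ i * b ^ (j - i))"
      by (rule binomial_ring)
    also have "\<dots> = (\<Sum>i\<le>j. t ^ i * \<alpha> j i)"
      by (intro sum.cong refl) (auto simp: \<alpha>_def power_minus[of t])
    also have "\<dots> = (\<Sum>i<m. t ^ i * \<alpha> j i)"
      using that by (intro sum.mono_neutral_left) (auto simp: \<alpha>_def)
    finally show ?thesis .
  qed
  have "(\<Sum>j<m. (b - t) ^ j *\<^sub>R c j) = (\<Sum>i<m. t ^ i *\<^sub>R (\<Sum>j<m. \<alpha> j i *\<^sub>R c j))" for t :: real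
  proof -
    have "(\<Sum>j<m. (b - t) ^ j *\<^sub>R c j) = (\<Sum>j<m. \<Sum>i<m. t ^ i *\<^sub>R \<alpha> j i *\<^sub>R c j)"
      by (intro sum.cong refl) (simp add: exp scaleR_sum_left)
    also have "\<dots> = (\<Sum>i<m. \<Sum>j<m. t ^ i *\<^sub>R \<alpha> j i *\<^sub>R c j)" by (rule sum.swap)
    finally show ?thesis by (simp add: scaleR_sum_right)
  qed
  then show ?thesis by (intro exI allI)
qed

section \<open>Repeated primitives of continuous functions\<close>

definition primitive :: "real \<Rightarrow> (real \<Rightarrow> real) \<Rightarrow> real \<Rightarrow> real" where
  "primitive a f = (\<lambda>t. integral {a..t} f)"

lemma continuous_on_primitive:
  assumes "continuous_on {a..b} f"
  shows "continuous_on {a..b} (primitive a f)"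
  unfolding primitive_def
  by (intro indefinite_integral_continuous_1 integrable_continuous_real assms)

lemma has_vector_derivative_primitive:
  assumes "continuous_on {a..b} f" "t \<in> {a..b}"
  shows "(primitive a f has_vector_derivative f t) (at t within {a..b})"
  unfolding primitive_def using integral_has_vector_derivative assms by blast

lemma continuous_on_iter_primitive:
  assumes "continuous_on {a..b} f"
  shows "continuous_on {a..b} ((primitive a ^^ k) f)"
  by (induction k) (auto intro: assms continuous_on_primitive)

text \<open>Cauchy's formula for repeated integration, read at the right end. The induction applies
  the hypothesis to the primitive W of \<open>w\<close> and integrates by parts: (b - s)^(k+1) W(s)
  vanishes at \<open>b\<close> through the first factor and at \<open>a\<close> through the second.
  Boundary conditions at \<open>b\<close> thereby become moment conditions on
  \<open>w\<close>.\<close>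

lemma iter_primitive_at_endpoint:
  assumes "a \<le> b" "continuous_on {a..b} w"
  shows "(primitive a ^^ Suc k) w b = integral {a..b} (\<lambda>s. (b - s) ^ k * w s) / fact k"
  using assms(2)
proof (induction k arbitrary: w)
  case (Suc k)
  have cp: "continuous_on {a..b} (primitive a w)"
    by (rule continuous_on_primitive[OF Suc.prems])
  define W where "W = primitive a w"
  have W: "(W has_real_derivative w s) (at s within {a..b})" if "s \<in> {a..b}" for s
    using has_vector_derivative_primitive[OF Suc.prems that]
    by (simp add: W_def has_real_derivative_iff_has_vector_derivative)
  have ftc: "((\<lambda>s. (b - s) ^ Suc k * w s - real (Suc k) * ((b - s) ^ k * W s)) has_integral
      (b - b) ^ Suc k * W b - (b - a) ^ Suc k * W a) {a..b}"
  proof (rule fundamental_theorem_of_calculus[OF assms(1)])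
    fix s assume s: "s \<in> {a..b}"
    have "((\<lambda>s. (b - s) ^ Suc k) has_real_derivative - (real (Suc k) * (b - s) ^ k)) (at s within {a..b})"
      by (auto intro!: derivative_eq_intros simp del: power_Suc)
    from DERIV_mult'[OF this W[OF s]] show "((\<lambda>s. (b - s) ^ Suc k * W s) has_vector_derivative
        (b - s) ^ Suc k * w s - real (Suc k) * ((b - s) ^ k * W s)) (at s within {a..b})"
      by (simp add: has_real_derivative_iff_has_vector_derivative mult.assoc del: power_Suc of_nat_Suc)
  qed
  have "integral {a..b} (\<lambda>s. (b - s) ^ Suc k * w s - real (Suc k) * ((b - s) ^ k * W s)) = 0"
    using integral_unique[OF ftc] by (simp add: W_def primitive_def)
  moreover have "integral {a..b} (\<lambda>s. (b - s) ^ Suc k * w s - real (Suc k) * ((b - s) ^ k * W s)) =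
      integral {a..b} (\<lambda>s. (b - s) ^ Suc k * w s) - real (Suc k) * integral {a..b} (\<lambda>s. (b - s) ^ k * W s)"
    using cp Suc.prems
    by (subst integral_diff)
      (auto intro!: integrable_continuous_real continuous_intros simp: W_def simp del: power_Suc of_nat_Suc)
  ultimately have "integral {a..b} (\<lambda>s. (b - s) ^ Suc k * w s) = real (Suc k) * integral {a..b} (\<lambda>s. (b - s) ^ k * W s)"
    by simp
  moreover have "(primitive a ^^ Suc (Suc k)) w b = integral {a..b} (\<lambda>s. (b - s) ^ k * W s) / fact k"
    using Suc.IH[OF cp] unfolding W_def by (simp only: funpow_Suc_right[of "Suc k"] o_apply)
  ultimately show ?case by (simp del: power_Suc funpow.simps)
qed (simp add: primitive_def)

text \<open>The tests have one derivative more than the sum involves, so every \<open>f i\<close> is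
  integrated at least once and \<open>H\<close> can be compared with a polynomial at every point.
  The derivative gained is given back at the end, at the price of a null set.\<close>

lemma du_Bois_Reymond_iterated:
  fixes f :: "nat \<Rightarrow> real \<Rightarrow> 'v::euclidean_space"
  assumes ab: "a < b" and c: "c \<in> {a..b}"
    and f: "\<And>i. i \<le> m \<Longrightarrow> f i \<in> borel_measurable (lebesgue_on {a..b})"
      "\<And>i. i \<le> m \<Longrightarrow> \<forall>t\<in>{a..b}. norm (f i t) \<le> M"
    and vanish: "\<And>\<phi> :: nat \<Rightarrow> real \<Rightarrow> real.
       (\<And>i t. i \<le> m \<Longrightarrow> t \<in> {a..b} \<Longrightarrow> (\<phi> i has_vector_derivative \<phi> (Suc i) t) (at t within {a..b})) \<Longrightarrow>
       continuous_on {a..b} (\<phi> (Suc m)) \<Longrightarrow> (\<And>i. i \<le> m \<Longrightarrow> \<phi> i a = 0 \<and> \<phi> i b = 0) \<Longrightarrow>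
       (\<Sum>i\<le>m. integral {a..b} (\<lambda>t. \<phi> i t *\<^sub>R f i t)) = 0"
  shows "\<exists>d N. negligible N \<and> (\<forall>t\<in>{a..b} - N.
     (\<Sum>i\<le>m. (-1) ^ (m - i) *\<^sub>R iter_integral c (m - i) (f i) t) = (\<Sum>i<m. t ^ i *\<^sub>R d i))"
proof -
  define H where "H t = (\<Sum>i\<le>m. (-1) ^ (Suc m - i) *\<^sub>R iter_integral c (Suc m - i) (f i) t)" for t
  define h where "h t = (\<Sum>i\<le>m. (-1) ^ (m - i) *\<^sub>R iter_integral c (m - i) (f i) t)" for t
  have cH: "continuous_on {a..b} H"
    unfolding H_def by (intro continuous_intros iter_integral_regular(3)[OF c f]) auto
  define W where "W = {w :: real \<Rightarrow> real. continuous_on {a..b} w}"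
  define \<mu> where "\<mu> k w = integral {a..b} (\<lambda>s. (b - s) ^ k * w s)" for k and w :: "real \<Rightarrow> real"
  define \<Lambda> where "\<Lambda> w = integral {a..b} (\<lambda>s. w s *\<^sub>R H s)" for w
  have "\<exists>d. \<forall>w\<in>W. \<Lambda> w = (\<Sum>k<Suc m. \<mu> k w *\<^sub>R d k)"
  proof (rule vanishing_on_kernels_imp_combination)
    fix v w and r :: real assume vw: "v \<in> W" "w \<in> W"
    show "(\<lambda>t. v t - r * w t) \<in> W"
      using vw by (auto simp: W_def intro!: continuous_intros)
    have "\<mu> k (\<lambda>t. v t - r * w t) = integral {a..b} (\<lambda>s. (b - s) ^ k * v s - r * ((b - s) ^ k * w s))" for k
      by (simp add: \<mu>_def algebra_simps)
    then show "\<mu> k (\<lambda>t. v t - r * w t) = \<mu> k v - r * \<mu> k w" for k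
      using vw by (simp add: \<mu>_def W_def integral_diff integrable_continuous_real continuous_intros)
    have "\<Lambda> (\<lambda>t. v t - r * w t) = integral {a..b} (\<lambda>s. v s *\<^sub>R H s - r *\<^sub>R (w s *\<^sub>R H s))"
      by (simp add: \<Lambda>_def algebra_simps)
    also have "\<dots> = \<Lambda> v - integral {a..b} (\<lambda>s. r *\<^sub>R (w s *\<^sub>R H s))"
      unfolding \<Lambda>_def using vw cH
      by (intro integral_diff integrable_continuous_real continuous_intros) (auto simp: W_def)
    finally show "\<Lambda> (\<lambda>t. v t - r * w t) = \<Lambda> v - r *\<^sub>R \<Lambda> w"
      by (simp only: \<Lambda>_def integral_cmul)
  next
    fix w assume "w \<in> W" and \<mu>0: "\<And>k. k < Suc m \<Longrightarrow> \<mu> k w = 0"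
    then have w: "continuous_on {a..b} w" by (simp add: W_def)
    \<comment> \<open>These primitives vanish at \<open>a\<close> by construction. At
      \<open>b\<close> the value of \<open>\<phi> i\<close> is the moment
      \<open>\<mu> (m - i) w\<close> up to a factorial, so the vanishing moments supply exactly the
      remaining boundary conditions.\<close>
    define \<phi> where "\<phi> i = (primitive a ^^ (Suc m - i)) w" for i
    have d\<phi>: "(\<phi> i has_vector_derivative \<phi> (Suc i) t) (at t within {a..b})" if "i \<le> m" "t \<in> {a..b}" for i t
      using has_vector_derivative_primitive[OF continuous_on_iter_primitive[OF w, of "m - i"] that(2)] that(1)
      by (simp add: \<phi>_def Suc_diff_le)
    have bd: "\<phi> i a = 0 \<and> \<phi> i b = 0" if "i \<le> m" for i
      using iter_primitive_at_endpoint[of a b w "m - i"] \<mu>0[of "m - i"] that ab w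
      by (simp add: \<phi>_def Suc_diff_le \<mu>_def) (simp add: primitive_def)
    have top: "\<phi> (Suc m) = w" by (simp add: \<phi>_def)
    have "integral {a..b} (\<lambda>t. \<phi> i t *\<^sub>R f i t) =
        integral {a..b} (\<lambda>t. w t *\<^sub>R ((-1) ^ (Suc m - i) *\<^sub>R iter_integral c (Suc m - i) (f i) t))"
      if i: "i \<le> m" for i
    proof -
      have "integral {a..b} (\<lambda>t. \<phi> i t *\<^sub>R f i t) = (-1) ^ (Suc m - i) *\<^sub>R
          integral {a..b} (\<lambda>t. \<phi> (i + (Suc m - i)) t *\<^sub>R iter_integral c (Suc m - i) (f i) t)"
        using i w top by (intro integral_by_parts_iter_integral[OF c f(1)[OF i] f(2)[OF i], of "Suc m"] d\<phi> bd) auto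
      also have "i + (Suc m - i) = Suc m" using i by simp
      finally show ?thesis unfolding top integral_cmul[symmetric] by (simp add: mult.commute)
    qed
    moreover have van0: "(\<Sum>i\<le>m. integral {a..b} (\<lambda>t. \<phi> i t *\<^sub>R f i t)) = 0"
      by (rule vanish[of \<phi>]) (simp_all add: d\<phi> bd top w)
    ultimately have "0 = (\<Sum>i\<le>m. integral {a..b} (\<lambda>t. w t *\<^sub>R ((-1) ^ (Suc m - i) *\<^sub>R iter_integral c (Suc m - i) (f i) t)))"
      by simp
    also have "\<dots> = integral {a..b} (\<lambda>t. \<Sum>i\<le>m. w t *\<^sub>R ((-1) ^ (Suc m - i) *\<^sub>R iter_integral c (Suc m - i) (f i) t))"
      by (intro integral_sum[symmetric] integrable_continuous_real continuous_intros w
          iter_integral_regular(3)[OF c f]) auto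
    also have "\<dots> = \<Lambda> w"
      by (simp add: \<Lambda>_def H_def scaleR_sum_right)
    finally show "\<Lambda> w = 0" by simp
  qed
  then obtain d where d: "\<And>w. continuous_on {a..b} w \<Longrightarrow> \<Lambda> w = (\<Sum>k<Suc m. \<mu> k w *\<^sub>R d k)"
    by (auto simp: W_def)
  \<comment> \<open>The combination of moments just found is the integral of \<open>w\<close>
    against this polynomial.\<close>
  define P where "P t = (\<Sum>k<Suc m. (b - t) ^ k *\<^sub>R d k)" for t
  have cP: "continuous_on {a..b} P" unfolding P_def by (intro continuous_intros)
  have HP: "H t = P t" if t: "t \<in> {a..b}" for t
  proof -
    have orth: "integral {a..b} (\<lambda>s. w s *\<^sub>R (H s - P s)) = 0" if w: "continuous_on {a..b} w" for w
    proof -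
      have "integral {a..b} (\<lambda>s. w s *\<^sub>R P s) = integral {a..b} (\<lambda>s. \<Sum>k<Suc m. ((b - s) ^ k * w s) *\<^sub>R d k)"
        by (simp add: P_def scaleR_sum_right mult.commute scaleR_add_right)
      also have "\<dots> = (\<Sum>k<Suc m. \<mu> k w *\<^sub>R d k)"
      proof (rule integral_unique, rule has_integral_sum)
        show "((\<lambda>s. ((b - s) ^ k * w s) *\<^sub>R d k) has_integral \<mu> k w *\<^sub>R d k) {a..b}" for k
          unfolding \<mu>_def
          by (intro has_integral_scaleR_left integrable_integral integrable_continuous_real continuous_intros w)
      qed simp
      finally have "integral {a..b} (\<lambda>s. w s *\<^sub>R H s) - integral {a..b} (\<lambda>s. w s *\<^sub>R P s) = 0"
        using d[OF w] by (simp add: \<Lambda>_def del: sum.lessThan_Suc)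
      then show ?thesis
        unfolding scaleR_diff_right
        by (subst integral_diff) (intro integrable_continuous_real continuous_intros w cH cP | assumption)+
    qed
    have "(H t - P t) \<bullet> u = 0" if "u \<in> Basis" for u
    proof -
      \<comment> \<open>A component of \<open>H - P\<close> is itself a continuous weight; testing
        against it leaves the integral of its square.\<close>
      define r where "r s = (H s - P s) \<bullet> u" for s
      have r: "continuous_on {a..b} r" unfolding r_def by (intro continuous_intros cH cP)
      have "(\<lambda>s. r s *\<^sub>R (H s - P s)) integrable_on {a..b}"
        by (intro integrable_continuous_real continuous_intros r cH cP)
      from integral_component_eq[OF this, of u]
      have "integral {a..b} (\<lambda>s. r s * r s) = 0"
        unfolding orth[OF r] by (simp add: r_def)
      moreover have "continuous_on {a..b} (\<lambda>s. r s * r s)"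
        by (intro continuous_intros r)
      ultimately have "\<forall>s\<in>{a..b}. r s * r s = 0"
        using integral_eq_0_iff[of a b "\<lambda>s. r s * r s"] ab by simp
      then show ?thesis using t by (simp add: r_def)
    qed
    then have "H t - P t = 0" using euclidean_all_zero_iff[of "H t - P t"] by simp
    then show ?thesis by simp
  qed
  \<comment> \<open>\<open>- Q\<close> is the derivative of \<open>P\<close>: the term
    \<open>d 0\<close> drops out, and the degree falls from at most m to at most m - 1, as the
    theorem requires.\<close>
  define Q where "Q t = (\<Sum>j<m. (b - t) ^ j *\<^sub>R (real (Suc j) *\<^sub>R d (Suc j)))" for t
  have PQ: "(P has_vector_derivative - Q t) (at t within S)" for t S
  proof -
    have "P = (\<lambda>t. d 0 + (\<Sum>j<m. (b - t) ^ Suc j *\<^sub>R d (Suc j)))"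
      unfolding P_def sum.lessThan_Suc_shift by simp
    moreover have "((\<lambda>t. d 0 + (\<Sum>j<m. (b - t) ^ Suc j *\<^sub>R d (Suc j))) has_vector_derivative
        0 + (\<Sum>j<m. (- (real (Suc j) * (b - t) ^ j)) *\<^sub>R d (Suc j))) (at t within S)"
    proof (intro has_vector_derivative_add has_vector_derivative_const has_vector_derivative_sum)
      fix j
      have "((\<lambda>t. (b - t) ^ Suc j) has_real_derivative - (real (Suc j) * (b - t) ^ j)) (at t within S)"
        by (auto intro!: derivative_eq_intros simp del: power_Suc)
      then show "((\<lambda>t. (b - t) ^ Suc j *\<^sub>R d (Suc j)) has_vector_derivative
          (- (real (Suc j) * (b - t) ^ j)) *\<^sub>R d (Suc j)) (at t within S)"
        using has_vector_derivative_scaleR[OF _ has_vector_derivative_const] by fastforce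
    qed
    ultimately show ?thesis
      by (simp add: Q_def sum_negf mult.commute)
  qed
  \<comment> \<open>Formally \<open>H\<close> has derivative \<open>- h\<close>, and
    \<open>P\<close> has derivative \<open>- Q\<close>. In integrated form, the integral of
    \<open>k\<close> over [a, t] is (H a - H t) + (P t - P a), which is 0 because \<open>H\<close>
    and \<open>P\<close> agree; \<open>H\<close> itself is never differentiated.\<close>
  define k where "k t = h t - Q t" for t
  have cQ: "continuous_on {a..b} Q" unfolding Q_def by (intro continuous_intros)
  have hm: "h \<in> borel_measurable (lebesgue_on {a..b})"
    unfolding h_def
    by (intro borel_measurable_sum borel_measurable_scaleR borel_measurable_const iter_integral_regular(1)[OF c f]) auto
  have "\<forall>i. \<exists>B. i \<le> m \<longrightarrow> (\<forall>t\<in>{a..b}. norm (iter_integral c (m - i) (f i) t) \<le> B)"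
    using iter_integral_regular(2)[OF c f] by auto
  then obtain B where B: "\<And>i t. i \<le> m \<Longrightarrow> t \<in> {a..b} \<Longrightarrow> norm (iter_integral c (m - i) (f i) t) \<le> B i"
    by metis
  have hB: "norm (h t) \<le> (\<Sum>i\<le>m. B i)" if "t \<in> {a..b}" for t
    unfolding h_def by (rule sum_norm_le) (use B that in auto)
  obtain BQ where BQ: "\<And>t. t \<in> {a..b} \<Longrightarrow> norm (Q t) \<le> BQ"
    using continuous_on_Icc_norm_bound[OF cQ] by auto
  have "\<exists>N. negligible N \<and> (\<forall>t\<in>{a..b} - N. k t = 0)"
  proof (rule AE_zero_if_integrals_zero)
    show "k \<in> borel_measurable (lebesgue_on {a..b})"
      unfolding k_def using hm continuous_imp_measurable_on_sets_lebesgue[OF cQ] by simp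
    show "norm (k t) \<le> (\<Sum>i\<le>m. B i) + BQ" if "t \<in> {a..b}" for t
      unfolding k_def using hB[OF that] BQ[OF that] norm_triangle_ineq4[of "h t" "Q t"] by linarith
    fix t assume t: "t \<in> {a..b}"
    have sub: "{a..t} \<subseteq> {a..b}" using t by auto
    have ii: "iter_integral c (m - i) (f i) integrable_on {a..t}" if "i \<le> m" for i
      by (rule integrable_subinterval_real[OF set_lebesgue_integral_eq_integral(1)[OF
            iter_integral_absolutely_integrable[OF c f(1)[OF that] f(2)[OF that]]] sub])
    have "(h has_integral (\<Sum>i\<le>m. (-1) ^ (m - i) *\<^sub>R integral {a..t} (iter_integral c (m - i) (f i)))) {a..t}"
      unfolding h_def by (intro has_integral_sum has_integral_cmul integrable_integral ii) auto
    also have "(\<Sum>i\<le>m. (-1) ^ (m - i) *\<^sub>R integral {a..t} (iter_integral c (m - i) (f i))) = H a - H t"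
      unfolding H_def sum_subtractf[symmetric]
    proof (rule sum.cong[OF refl])
      fix i assume "i \<in> {..m}"
      then have i: "i \<le> m" by simp
      have *: "iter_integral c (Suc (m - i)) (f i) t - iter_integral c (Suc (m - i)) (f i) a
          = integral {a..t} (iter_integral c (m - i) (f i))"
        using iter_integral_Suc_eq[OF c f(1)[OF i] f(2)[OF i], of _ "m - i"] t ab by simp
      show "(-1) ^ (m - i) *\<^sub>R integral {a..t} (iter_integral c (m - i) (f i)) =
          (-1) ^ (Suc m - i) *\<^sub>R iter_integral c (Suc m - i) (f i) a
          - (-1) ^ (Suc m - i) *\<^sub>R iter_integral c (Suc m - i) (f i) t"
        using i unfolding *[symmetric] by (simp add: Suc_diff_le scaleR_diff_right del: iter_integral.simps)
    qed
    finally have hI: "(h has_integral H a - H t) {a..t}" .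
    have "((\<lambda>s. - Q s) has_integral P t - P a) {a..t}"
      using t by (intro fundamental_theorem_of_calculus PQ) auto
    from has_integral_add[OF hI this] show "integral {a..t} k = 0"
      using HP[of a] HP[OF t] ab by (simp add: k_def[abs_def] integral_unique)
  qed (use ab in simp)
  moreover obtain d' where "\<And>t. Q t = (\<Sum>i<m. t ^ i *\<^sub>R d' i)"
    using reflected_polynomial[where m=m and b=b and c="\<lambda>j. real (Suc j) *\<^sub>R d (Suc j)"] by (auto simp: Q_def)
  ultimately show ?thesis by (auto simp: k_def h_def)
qed

section \<open>Differentiation of integral functionals\<close>

lemma compact_image_norm_bound:
  fixes g :: "'a::euclidean_space \<Rightarrow> 'b::real_normed_vector"
  assumes "compact K" "continuous_on K g"
  shows "\<exists>B\<ge>0. \<forall>x\<in>K. norm (g x) \<le> B"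
proof -
  have "bounded (g ` K)"
    using assms compact_continuous_image compact_imp_bounded by blast
  then obtain B where "0 < B" "\<forall>x\<in>g ` K. norm x \<le> B"
    unfolding bounded_pos by blast
  then show ?thesis by (intro exI[of _ B]) auto
qed

lemma measurable_continuous_compose:
  fixes g :: "'a::euclidean_space \<Rightarrow> 'b::euclidean_space" and X :: "real \<Rightarrow> 'a"
  assumes "continuous_on K g" "X \<in> borel_measurable (lebesgue_on {a..b})" "\<forall>t\<in>{a..b}. X t \<in> K"
  shows "(\<lambda>t. g (X t)) \<in> borel_measurable (lebesgue_on {a..b})"
proof (rule measurable_compose[where g=g and f=X and N="restrict_space borel K"])
  show "X \<in> lebesgue_on {a..b} \<rightarrow>\<^sub>M restrict_space borel K"
    using assms by (intro measurable_restrict_space2) auto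
  show "g \<in> restrict_space borel K \<rightarrow>\<^sub>M borel"
    by (rule borel_measurable_continuous_on_restrict[OF assms(1)])
qed

lemma integrable_continuous_compose:
  fixes g :: "'a::euclidean_space \<Rightarrow> 'b::euclidean_space" and X :: "real \<Rightarrow> 'a"
  assumes "compact K" "continuous_on K g" "X \<in> borel_measurable (lebesgue_on {a..b})" "\<forall>t\<in>{a..b}. X t \<in> K"
  shows "(\<lambda>t. g (X t)) absolutely_integrable_on {a..b}"
proof -
  obtain B where "\<forall>x\<in>K. norm (g x) \<le> B"
    using compact_image_norm_bound[OF assms(1,2)] by (elim exE conjE)
  then show ?thesis
    using assms(4) by (intro absolutely_integrable_bounded_measurable[of _ _ _ B]
        measurable_continuous_compose[OF assms(2,3,4)]) auto
qed

text \<open>The vector that represents a linear functional. Continuous differentiability is given as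
  continuity of \<open>G' x v\<close> in \<open>x\<close> for each fixed \<open>v\<close>; the
  representative, a finite sum over the basis, is then continuous in \<open>x\<close> as a
  vector.\<close>

definition riesz :: "('a::euclidean_space \<Rightarrow> real) \<Rightarrow> 'a" where
  "riesz f = (\<Sum>b\<in>Basis. f b *\<^sub>R b)"

lemma riesz_inner:
  fixes f :: "'a::euclidean_space \<Rightarrow> real"
  assumes "linear f"
  shows "riesz f \<bullet> v = f v"
proof -
  have "f v = f (\<Sum>b\<in>Basis. (v \<bullet> b) *\<^sub>R b)" by (simp add: euclidean_representation)
  also have "\<dots> = (\<Sum>b\<in>Basis. (v \<bullet> b) * f b)"
    by (simp add: linear_sum[OF assms] linear_scale[OF assms])
  finally show ?thesis
    by (simp add: riesz_def inner_sum_right inner_commute[of _ v] mult.commute)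
qed

text \<open>The representative of the derivative is uniformly continuous on the compact set, and
  convexity makes the mean value estimate available on its intersection with a ball. Uniformity in
  \<open>x\<close> is what allows the error to be integrated along a curve.\<close>

lemma uniform_linearization:
  fixes G :: "'a::euclidean_space \<Rightarrow> real"
  assumes K: "compact K" "convex K"
    and G: "\<And>x. x \<in> K \<Longrightarrow> (G has_derivative G' x) (at x within K)"
    and cG: "\<And>v. continuous_on K (\<lambda>x. G' x v)"
    and e: "0 < e"
  shows "\<exists>d>0. \<forall>x\<in>K. \<forall>y\<in>K. norm (y - x) < d \<longrightarrow> \<bar>G y - G x - G' x (y - x)\<bar> \<le> e * norm (y - x)"
proof -
  have lin: "linear (G' x)" if "x \<in> K" for x
    using has_derivative_linear[OF G[OF that]] .
  define h where "h x = riesz (G' x)" for x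
  have h: "h x \<bullet> v = G' x v" if "x \<in> K" for x v
    using riesz_inner[OF lin[OF that]] by (simp add: h_def)
  have "continuous_on K h"
    unfolding h_def riesz_def by (intro continuous_intros cG)
  then have "uniformly_continuous_on K h"
    by (rule compact_uniformly_continuous[OF _ K(1)])
  then obtain d where "0 < d" and d: "\<forall>x\<in>K. \<forall>x'\<in>K. dist x' x < d \<longrightarrow> dist (h x') (h x) < e"
    using e unfolding uniformly_continuous_on_def by meson
  have "\<bar>G y - G x - G' x (y - x)\<bar> \<le> e * norm (y - x)" if xy: "x \<in> K" "y \<in> K" "norm (y - x) < d" for x y
  proof -
    have cvx: "convex (K \<inter> ball x d)" using K by (intro convex_Int convex_ball)
    have "norm (G y - G x - G' x (y - x)) \<le> norm (y - x) * e"
    proof (rule differentiable_bound_linearization[where S="K \<inter> ball x d"])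
      show "x + t *\<^sub>R (y - x) \<in> K \<inter> ball x d" if "t \<in> {0..1}" for t
        using convexD_alt[OF cvx, of x y t] that xy \<open>0 < d\<close>
        by (auto simp: algebra_simps dist_norm norm_minus_commute)
      show "(G has_derivative G' z) (at z within K \<inter> ball x d)" if "z \<in> K \<inter> ball x d" for z
        using G[of z] that by (auto intro: has_derivative_subset)
      show "onorm (G' z - G' x) \<le> e" if z: "z \<in> K \<inter> ball x d" for z
      proof (rule onorm_bound)
        show "0 \<le> e" using e by simp
        fix v
        have "(G' z - G' x) v = (h z - h x) \<bullet> v"
          using h z xy(1) by (simp add: inner_diff_left)
        moreover have "norm (h z - h x) \<le> e"
          using d xy(1) z by (simp add: dist_norm[symmetric] dist_commute less_imp_le)
        ultimately show "norm ((G' z - G' x) v) \<le> e * norm v"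
          using norm_inner_le[of "h z - h x" e v "norm v"] by simp
      qed
      show "x \<in> K \<inter> ball x d" using xy \<open>0 < d\<close> by simp
    qed
    then show ?thesis by (simp add: mult.commute)
  qed
  with \<open>0 < d\<close> show ?thesis by blast
qed

text \<open>The linearisation error is small relative to the displacement, uniformly in time, and
  the displacement is at most \<open>2 * B * norm s\<close>; integrating the pointwise error gives
  the derivative at 0. Continuity elsewhere comes from uniform continuity of \<open>G\<close> on
  \<open>K\<close>.\<close>

lemma
  fixes G :: "'a::euclidean_space \<Rightarrow> real" and Z \<zeta>1 \<zeta>2 :: "real \<Rightarrow> 'a"
  assumes ab: "a \<le> b" and K: "compact K" "convex K"
    and G: "\<And>x. x \<in> K \<Longrightarrow> (G has_derivative G' x) (at x within K)"
    and cG: "\<And>v. continuous_on K (\<lambda>x. G' x v)"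
    and meas: "Z \<in> borel_measurable (lebesgue_on {a..b})" "\<zeta>1 \<in> borel_measurable (lebesgue_on {a..b})"
      "\<zeta>2 \<in> borel_measurable (lebesgue_on {a..b})"
    and bnd: "\<forall>t\<in>{a..b}. norm (\<zeta>1 t) \<le> B" "\<forall>t\<in>{a..b}. norm (\<zeta>2 t) \<le> B"
    and inK: "\<And>t s. t \<in> {a..b} \<Longrightarrow> norm s < 1 \<Longrightarrow> Z t + fst s *\<^sub>R \<zeta>1 t + snd s *\<^sub>R \<zeta>2 t \<in> K"
  shows has_derivative_parametric_integral:
    "((\<lambda>s::real \<times> real. integral {a..b} (\<lambda>t. G (Z t + fst s *\<^sub>R \<zeta>1 t + snd s *\<^sub>R \<zeta>2 t))) has_derivative
      (\<lambda>s. fst s * integral {a..b} (\<lambda>t. G' (Z t) (\<zeta>1 t)) + snd s * integral {a..b} (\<lambda>t. G' (Z t) (\<zeta>2 t))))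
      (at 0)" (is "(?\<Phi> has_derivative ?D) _")
    and continuous_on_parametric_integral:
    "continuous_on (ball 0 1) (\<lambda>s::real \<times> real. integral {a..b} (\<lambda>t. G (Z t + fst s *\<^sub>R \<zeta>1 t + snd s *\<^sub>R \<zeta>2 t)))"
proof -
  define X where "X s t = Z t + fst s *\<^sub>R \<zeta>1 t + snd s *\<^sub>R \<zeta>2 t" for s :: "real \<times> real" and t
  have abs_fst_le: "\<bar>fst s\<bar> \<le> norm s" and abs_snd_le: "\<bar>snd s\<bar> \<le> norm s" for s :: "real \<times> real"
    using norm_fst_le[of "fst s" "snd s"] norm_snd_le[of "snd s" "fst s"] by simp_all
  have contG: "continuous_on K G"
    using G has_derivative_continuous continuous_on_eq_continuous_within by blast
  have lin: "linear (G' x)" if "x \<in> K" for x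
    using has_derivative_linear[OF G[OF that]] .
  have B0: "0 \<le> B" using bnd ab order_trans[OF norm_ge_zero, of "\<zeta>1 a" B] by auto
  have XK: "X s t \<in> K" if "t \<in> {a..b}" "norm s < 1" for s t
    using inK[OF that] by (simp add: X_def)
  have Xm: "X s \<in> borel_measurable (lebesgue_on {a..b})" for s
    unfolding X_def using meas by (intro borel_measurable_add borel_measurable_scaleR) auto
  have GX: "(\<lambda>t. G (X s t)) integrable_on {a..b}" if "norm s < 1" for s
    using integrable_continuous_compose[OF K(1) contG Xm[of s]] XK that
      set_lebesgue_integral_eq_integral(1) by blast
  have diffX: "norm (X s t - X s' t) \<le> 2 * B * norm (s - s')" if "t \<in> {a..b}" for s s' t
  proof -
    have "X s t - X s' t = fst (s - s') *\<^sub>R \<zeta>1 t + snd (s - s') *\<^sub>R \<zeta>2 t"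
      by (simp add: X_def algebra_simps)
    also have "norm \<dots> \<le> norm (s - s') * B + norm (s - s') * B"
      using bnd that by (intro norm_triangle_le add_mono)
        (auto simp del: fst_diff snd_diff intro!: mult_mono abs_fst_le abs_snd_le)
    finally show ?thesis by (simp add: algebra_simps)
  qed
  have Z: "Z t \<in> K" if "t \<in> {a..b}" for t using XK[OF that, of 0] by (simp add: X_def)
  have X0: "X 0 = Z" by (simp add: X_def fun_eq_iff)
  define h where "h x = riesz (G' x)" for x
  have h: "h x \<bullet> v = G' x v" if "x \<in> K" for x v
    using riesz_inner[OF lin[OF that]] by (simp add: h_def)
  have ch: "continuous_on K h"
    unfolding h_def riesz_def by (intro continuous_intros cG)
  have hm: "(\<lambda>t. h (Z t)) \<in> borel_measurable (lebesgue_on {a..b})"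
    using measurable_continuous_compose[OF ch meas(1)] Z by blast
  obtain C where C: "\<forall>x\<in>K. norm (h x) \<le> C"
    using compact_image_norm_bound[OF K(1) ch] by (elim exE conjE)
  have G'i: "(\<lambda>t. G' (Z t) (\<zeta> t)) integrable_on {a..b}"
    if "\<zeta> \<in> borel_measurable (lebesgue_on {a..b})" "\<forall>t\<in>{a..b}. norm (\<zeta> t) \<le> B" for \<zeta>
  proof -
    have "(\<lambda>t. h (Z t) \<bullet> \<zeta> t) integrable_on {a..b}"
    proof (rule integrable_bounded_measurable)
      show "(\<lambda>t. h (Z t) \<bullet> \<zeta> t) \<in> borel_measurable (lebesgue_on {a..b})"
        using hm that(1) by (rule borel_measurable_inner)
      show "norm (h (Z t) \<bullet> \<zeta> t) \<le> C * B" if "t \<in> {a..b}" for t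
        using C Z[OF that] \<open>\<forall>t\<in>{a..b}. norm (\<zeta> t) \<le> B\<close> that by (intro norm_inner_le) auto
    qed
    then show ?thesis
      by (rule integrable_eq) (simp add: h Z)
  qed
  note i1 = G'i[OF meas(2) bnd(1)] and i2 = G'i[OF meas(3) bnd(2)]
  have \<Phi>: "?\<Phi> = (\<lambda>s. integral {a..b} (\<lambda>t. G (X s t)))" by (simp add: X_def)
  have L0: "0 < 2 * B * (b - a) + 1" using B0 ab by (simp add: add_nonneg_pos)
  show "(?\<Phi> has_derivative ?D) (at 0)"
    unfolding \<Phi> has_derivative_within_alt
  proof (intro conjI allI impI)
    show "bounded_linear ?D"
      by (intro bounded_linear_add bounded_linear_mult_const bounded_linear_fst bounded_linear_snd)
    fix e :: real assume "0 < e"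
    \<comment> \<open>Here \<open>2 * B\<close> bounds the displacement per unit of
      \<open>s\<close>, and \<open>b - a\<close> is the length of the interval of integration; the
      summand 1 keeps the denominator positive.\<close>
    define e' where "e' = e / (2 * B * (b - a) + 1)"
    have e': "0 < e'" using \<open>0 < e\<close> L0 by (simp add: e'_def)
    have "\<exists>d>0. \<forall>x\<in>K. \<forall>y\<in>K. norm (y - x) < d \<longrightarrow> \<bar>G y - G x - G' x (y - x)\<bar> \<le> e' * norm (y - x)"
      by (rule uniform_linearization[OF K]) (simp_all add: G cG e')
    then obtain d where "0 < d" and
      d: "\<forall>x\<in>K. \<forall>y\<in>K. norm (y - x) < d \<longrightarrow> \<bar>G y - G x - G' x (y - x)\<bar> \<le> e' * norm (y - x)"
      by (elim exE conjE)
    \<comment> \<open>The bound 1 on \<open>s\<close> keeps the perturbed curve in \<open>K\<close>;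
      the other bound keeps the displacement below \<open>d\<close>.\<close>
    have "norm (integral {a..b} (\<lambda>t. G (X s t)) - integral {a..b} (\<lambda>t. G (X 0 t)) - ?D (s - 0)) \<le> e * norm (s - 0)"
      if s: "norm (s - 0) < min 1 (d / (2 * B + 1))" for s
    proof -
      have s1: "norm s < 1" and s2: "2 * B * norm s < d"
      proof -
        have "norm s * (2 * B + 1) < d" using s B0 by (simp add: pos_less_divide_eq)
        moreover have "norm s * (2 * B + 1) = 2 * B * norm s + norm s" by (simp add: algebra_simps)
        ultimately show "2 * B * norm s < d" using norm_ge_zero[of s] by linarith
      qed (use s in simp)
      have lin_split: "G' (Z t) (X s t - Z t) = fst s * G' (Z t) (\<zeta>1 t) + snd s * G' (Z t) (\<zeta>2 t)"
        if "t \<in> {a..b}" for t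
        using lin[OF Z[OF that]] by (simp add: X_def linear_add linear_scale)
      have hi: "((\<lambda>t. G (X s t) - G (Z t) - (fst s * G' (Z t) (\<zeta>1 t) + snd s * G' (Z t) (\<zeta>2 t))) has_integral
          integral {a..b} (\<lambda>t. G (X s t)) - integral {a..b} (\<lambda>t. G (Z t)) - ?D s) {a..b}"
        using GX[OF s1] GX[of 0] i1 i2 unfolding X0
        by (intro has_integral_diff has_integral_add has_integral_mult_right integrable_integral) simp_all
      have bd: "norm (G (X s t) - G (Z t) - (fst s * G' (Z t) (\<zeta>1 t) + snd s * G' (Z t) (\<zeta>2 t)))
          \<le> e' * (2 * B * norm s)" if t: "t \<in> {a..b}" for t
      proof -
        have n: "norm (X s t - Z t) \<le> 2 * B * norm s" using diffX[OF t, of s 0] by (simp add: X0)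
        then have "norm (G (X s t) - G (Z t) - G' (Z t) (X s t - Z t)) \<le> e' * norm (X s t - Z t)"
          using d[rule_format, OF Z[OF t] XK[OF t s1]] s2 by simp
        also have "\<dots> \<le> e' * (2 * B * norm s)" using n e' by (intro mult_left_mono) auto
        finally show ?thesis by (simp add: lin_split[OF t])
      qed
      have "norm (integral {a..b} (\<lambda>t. G (X s t)) - integral {a..b} (\<lambda>t. G (Z t)) - ?D s)
          \<le> e' * (2 * B * norm s) * (b - a)"
        using norm_integral_le_length[OF has_integral_integrable[OF hi] ab bd]
        unfolding integral_unique[OF hi] .
      also have "\<dots> = e' * (2 * B * (b - a)) * norm s" by (simp add: algebra_simps)
      also have "\<dots> \<le> e * norm s"
      proof (rule mult_right_mono)
        have "e' * (2 * B * (b - a)) \<le> e' * (2 * B * (b - a) + 1)" using e' by (intro mult_left_mono) auto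
        also have "\<dots> = e" using L0 by (simp add: e'_def)
        finally show "e' * (2 * B * (b - a)) \<le> e" .
      qed simp
      finally show ?thesis by (simp add: X0)
    qed
    then show "\<exists>d>0. \<forall>y\<in>UNIV. norm (y - 0) < d \<longrightarrow>
        norm (integral {a..b} (\<lambda>t. G (X y t)) - integral {a..b} (\<lambda>t. G (X 0 t)) - ?D (y - 0)) \<le> e * norm (y - 0)"
      using \<open>0 < d\<close> B0 by (intro exI[of _ "min 1 (d / (2 * B + 1))"]) auto
  qed
  show "continuous_on (ball 0 1) ?\<Phi>"
    unfolding \<Phi> continuous_on_iff
  proof (intro ballI allI impI)
    fix s :: "real \<times> real" and e :: real assume s: "s \<in> ball 0 1" and "0 < e"
    \<comment> \<open>Adding 1 to the length covers the case \<open>a = b\<close> and makes the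
      final estimate strict.\<close>
    define e' where "e' = e / (b - a + 1)"
    have e': "0 < e'" using \<open>0 < e\<close> ab by (simp add: e'_def)
    have "uniformly_continuous_on K G" by (rule compact_uniformly_continuous[OF contG K(1)])
    then obtain d where "0 < d" and d: "\<forall>x\<in>K. \<forall>x'\<in>K. dist x' x < d \<longrightarrow> dist (G x') (G x) < e'"
      using e' unfolding uniformly_continuous_on_def by meson
    have "dist (integral {a..b} (\<lambda>t. G (X s' t))) (integral {a..b} (\<lambda>t. G (X s t))) < e"
      if s': "s' \<in> ball 0 1" "dist s' s < d / (2 * B + 1)" for s'
    proof -
      have n1: "norm s' < 1" "norm s < 1" using s s' by (simp_all add: dist_norm)
      have "norm (s' - s) * (2 * B + 1) < d" using s'(2) B0 by (simp add: dist_norm pos_less_divide_eq)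
      moreover have "norm (s' - s) * (2 * B + 1) = 2 * B * norm (s' - s) + norm (s' - s)" by (simp add: algebra_simps)
      ultimately have sd: "2 * B * norm (s' - s) < d" using norm_ge_zero[of "s' - s"] by linarith
      have "integral {a..b} (\<lambda>t. G (X s' t)) - integral {a..b} (\<lambda>t. G (X s t))
          = integral {a..b} (\<lambda>t. G (X s' t) - G (X s t))"
        by (rule integral_diff[symmetric]) (use GX n1 in auto)
      also have "norm \<dots> \<le> e' * (b - a)"
      proof (rule norm_integral_le_length[OF _ ab])
        show "(\<lambda>t. G (X s' t) - G (X s t)) integrable_on {a..b}"
          by (intro integrable_diff GX n1)
        fix t assume t: "t \<in> {a..b}"
        have "dist (X s' t) (X s t) < d" using diffX[OF t, of s' s] sd by (simp add: dist_norm)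
        then have "dist (G (X s' t)) (G (X s t)) < e'" using d XK[OF t n1(1)] XK[OF t n1(2)] by blast
        then show "norm (G (X s' t) - G (X s t)) \<le> e'" by (simp add: dist_norm)
      qed
      also have "\<dots> < e' * (b - a + 1)" using e' by (intro mult_strict_left_mono) auto
      also have "\<dots> = e" using ab by (simp add: e'_def)
      finally show ?thesis by (simp add: dist_norm)
    qed
    then show "\<exists>d>0. \<forall>s'\<in>ball 0 1. dist s' s < d \<longrightarrow>
        dist (integral {a..b} (\<lambda>t. G (X s' t))) (integral {a..b} (\<lambda>t. G (X s t))) < e"
      using \<open>0 < d\<close> B0 by (intro exI[of _ "d / (2 * B + 1)"]) auto
  qed
qed

text \<open>With a nonzero determinant the derivative of (J, I) at 0 would be onto, and the values
  of (J, I) near 0 would fill a neighbourhood of (J 0, I 0); a smaller value of \<open>J\<close>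
  would then occur with the constraint intact. Away from 0 continuity is enough for
  \<open>sussmann_open_mapping\<close>.\<close>

lemma constrained_min_two_parameters:
  fixes J I :: "real \<times> real \<Rightarrow> real"
  assumes r: "0 < r" and cont: "continuous_on (ball 0 r) J" "continuous_on (ball 0 r) I"
    and J: "(J has_derivative (\<lambda>s. fst s * A1 + snd s * A2)) (at 0)"
    and I: "(I has_derivative (\<lambda>s. fst s * B1 + snd s * B2)) (at 0)"
    and min: "\<And>s. s \<in> ball 0 r \<Longrightarrow> I s = I 0 \<Longrightarrow> J 0 \<le> J s"
  shows "A1 * B2 = A2 * B1"
proof (rule ccontr)
  assume "A1 * B2 \<noteq> A2 * B1"
  then have D: "A1 * B2 - A2 * B1 \<noteq> 0" (is "?D \<noteq> 0") by simp
  define f where "f s = (J s, I s)" for s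
  \<comment> \<open>The inverse of the 2 by 2 derivative, by Cramer's rule.\<close>
  define g' where "g' = (\<lambda>s::real\<times>real. ((fst s * B2 - snd s * A2) / ?D, (snd s * A1 - fst s * B1) / ?D))"
  have "f 0 \<in> interior (f ` ball 0 r)"
  proof (rule sussmann_open_mapping[of "ball 0 r"])
    show "continuous_on (ball 0 r) f"
      unfolding f_def by (intro continuous_on_Pair cont)
    show "(f has_derivative (\<lambda>s. (fst s * A1 + snd s * A2, fst s * B1 + snd s * B2))) (at 0)"
      unfolding f_def by (intro has_derivative_Pair J I)
    show "bounded_linear g'"
      unfolding g'_def divide_inverse
      by (intro bounded_linear_Pair bounded_linear_mult_const bounded_linear_sub bounded_linear_fst bounded_linear_snd)
    show "(\<lambda>s. (fst s * A1 + snd s * A2, fst s * B1 + snd s * B2)) \<circ> g' = id"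
    proof
      fix s :: "real \<times> real"
      have 1: "(fst s * B2 - snd s * A2) / ?D * A1 + (snd s * A1 - fst s * B1) / ?D * A2 = fst s"
        using D by (simp add: add_divide_distrib[symmetric] nonzero_divide_eq_eq) (simp add: algebra_simps)
      have 2: "(fst s * B2 - snd s * A2) / ?D * B1 + (snd s * A1 - fst s * B1) / ?D * B2 = snd s"
        using D by (simp add: add_divide_distrib[symmetric] nonzero_divide_eq_eq) (simp add: algebra_simps)
      show "((\<lambda>s. (fst s * A1 + snd s * A2, fst s * B1 + snd s * B2)) \<circ> g') s = id s"
        using 1 2 by (simp add: g'_def prod_eq_iff)
    qed
    show "0 \<in> interior (ball (0::real \<times> real) r)" using r by simp
  qed (use r in auto)
  then obtain d where "0 < d" "ball (f 0) d \<subseteq> f ` ball 0 r"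
    unfolding mem_interior by (elim exE conjE)
  moreover have "(J 0 - d / 2, I 0) \<in> ball (f 0) d"
    using \<open>0 < d\<close> by (simp add: f_def dist_Pair_Pair dist_real_def)
  ultimately obtain s where "s \<in> ball 0 r" "(J 0 - d / 2, I 0) = f s" by blast
  then show False using min[of s] \<open>0 < d\<close> by (simp add: f_def)
qed

section \<open>Partial gradients of continuously differentiable Lagrangians\<close>

lemma C_k_on_imp_continuous_on: "C_k_on k f S \<Longrightarrow> continuous_on S f"
proof (cases k)
  case (Suc j)
  assume "C_k_on k f S"
  then obtain f' where "\<forall>x\<in>S. (f has_derivative f' x) (at x within S)"
    unfolding Suc C_k_on.simps by (elim exE conjE)
  then show ?thesis
    using has_derivative_continuous continuous_on_eq_continuous_within by blast
qed simp

lemma C_k_on_derivative: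
  assumes "C_k_on (Suc k) f S"
  shows "\<exists>f'. (\<forall>x\<in>S. (f has_derivative f' x) (at x within S)) \<and> (\<forall>v. continuous_on S (\<lambda>x. f' x v))"
proof -
  obtain f' where f': "\<forall>x\<in>S. (f has_derivative f' x) (at x within S)" "\<forall>v. C_k_on k (\<lambda>x. f' x v) S"
    using assms unfolding C_k_on.simps by (elim exE conjE)
  then show ?thesis
    by (intro exI[of _ f'] conjI allI C_k_on_imp_continuous_on[of k]) auto
qed

lemma gradient_eqI:
  assumes "GDERIV f x :> v"
  shows "gradient f x = v"
  unfolding gradient_def
proof (rule the_equality[of "\<lambda>v. GDERIV f x :> v", OF assms])
  fix w assume "GDERIV f x :> w"
  then have "(\<lambda>h. h \<bullet> w) = (\<lambda>h. h \<bullet> v)"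
    using assms unfolding gderiv_def by (rule has_derivative_unique)
  then have "(w - v) \<bullet> w = (w - v) \<bullet> v" by (rule fun_cong)
  then have "(w - v) \<bullet> (w - v) = 0" by (simp add: inner_diff_right)
  then show "w = v" by simp
qed

lemma gradient_inner:
  fixes f :: "'a::euclidean_space \<Rightarrow> real"
  assumes "(f has_derivative D) (at x)"
  shows "gradient f x \<bullet> u = D u"
proof -
  have lin: "linear D" using has_derivative_linear[OF assms] .
  have "GDERIV f x :> riesz D"
    unfolding gderiv_def using assms riesz_inner[OF lin] by (simp add: inner_commute)
  from gradient_eqI[OF this] show ?thesis using riesz_inner[OF lin] by simp
qed

lemma bounded_linear_axis: "bounded_linear (axis k :: 'a::euclidean_space \<Rightarrow> 'a ^ 'k::finite)"
  by (rule linear_conv_bounded_linear[THEN iffD1], rule linearI) (auto simp: axis_def vec_eq_iff)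

lemma replace_component: "(\<chi> j. if j = k then u else x $ j) = x + axis k (u - x $ k)"
  for x :: "'a::euclidean_space ^ 'k::finite"
  by (auto simp: vec_eq_iff axis_def)

text \<open>At the ends of the time interval \<open>G\<close> is differentiable only within the
  slab. The affine map that moves a single component keeps \<open>t\<close> fixed and never leaves
  the slab, so composition with it has an unrestricted derivative, as \<open>gradient\<close>
  demands.\<close>

lemma inner_grad_cur:
  fixes G :: "('n::finite, 'k::finite) jet \<Rightarrow> real"
  assumes "(G has_derivative D) (at (t, x, y) within T \<times> UNIV)" "t \<in> T"
  shows "grad_cur G k (t, x, y) \<bullet> u = D (0, axis k u, 0)"
proof -
  define \<phi> where "\<phi> u = (t, x + axis k (u - x $ k), y)" for u
  have \<phi>: "(\<phi> has_derivative (\<lambda>h. (0, axis k h, 0))) (at (x $ k))"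
    unfolding \<phi>_def
    by (auto intro!: derivative_eq_intros bounded_linear.has_derivative[OF bounded_linear_axis])
  have \<phi>x: "\<phi> (x $ k) = (t, x, y)" by (simp add: \<phi>_def axis_def vec_eq_iff)
  have "(G has_derivative D) (at (\<phi> (x $ k)) within range \<phi>)"
    unfolding \<phi>x by (rule has_derivative_subset[OF assms(1)]) (use assms(2) in \<open>auto simp: \<phi>_def\<close>)
  from has_derivative_in_compose[OF \<phi> this]
  have "((\<lambda>u. G (\<phi> u)) has_derivative (\<lambda>h. D (0, axis k h, 0))) (at (x $ k))" .
  from gradient_inner[OF this, of u] show ?thesis
    by (simp add: grad_cur_def replace_component \<phi>_def)
qed

lemma inner_grad_del:
  fixes G :: "('n::finite, 'k::finite) jet \<Rightarrow> real"
  assumes "(G has_derivative D) (at (t, x, y) within T \<times> UNIV)" "t \<in> T"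
  shows "grad_del G k (t, x, y) \<bullet> u = D (0, 0, axis k u)"
proof -
  define \<phi> where "\<phi> u = (t, x, y + axis k (u - y $ k))" for u
  have \<phi>: "(\<phi> has_derivative (\<lambda>h. (0, 0, axis k h))) (at (y $ k))"
    unfolding \<phi>_def
    by (auto intro!: derivative_eq_intros bounded_linear.has_derivative[OF bounded_linear_axis])
  have \<phi>y: "\<phi> (y $ k) = (t, x, y)" by (simp add: \<phi>_def axis_def vec_eq_iff)
  have "(G has_derivative D) (at (\<phi> (y $ k)) within range \<phi>)"
    unfolding \<phi>y by (rule has_derivative_subset[OF assms(1)]) (use assms(2) in \<open>auto simp: \<phi>_def\<close>)
  from has_derivative_in_compose[OF \<phi> this]
  have "((\<lambda>u. G (\<phi> u)) has_derivative (\<lambda>h. D (0, 0, axis k h))) (at (y $ k))" .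
  from gradient_inner[OF this, of u] show ?thesis
    by (simp add: grad_del_def replace_component \<phi>_def)
qed

lemma sum_axis_components: "(\<Sum>k\<in>UNIV. axis k (X $ k)) = X" for X :: "'a::euclidean_space ^ 'k::finite"
  by (simp add: vec_eq_iff axis_def sum.delta')

text \<open>The time component of the direction is 0 because a variation changes the curve and not
  the time, so the partial derivative in t does not enter.\<close>

lemma derivative_eq_gradients:
  fixes G :: "('n::finite, 'k::finite) jet \<Rightarrow> real"
  assumes G: "(G has_derivative D) (at w within T \<times> UNIV)" and w: "fst w \<in> T"
  shows "D (0, X, Y) = (\<Sum>k\<in>UNIV. grad_cur G k w \<bullet> X $ k + grad_del G k w \<bullet> Y $ k)"
proof -
  obtain t x y where wt: "w = (t, x, y)" by (cases w)
  have lin: "linear D" using has_derivative_linear[OF G] .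
  have "(0, X, Y) = (\<Sum>k\<in>UNIV. (0, axis k (X $ k), 0) + (0, 0, axis k (Y $ k)))"
    by (simp add: prod_eq_iff fst_sum snd_sum sum_axis_components)
  then have "D (0, X, Y) = D (\<Sum>k\<in>UNIV. (0, axis k (X $ k), 0) + (0, 0, axis k (Y $ k)))"
    by (rule arg_cong)
  also have "\<dots> = (\<Sum>k\<in>UNIV. D (0, axis k (X $ k), 0) + D (0, 0, axis k (Y $ k)))"
    by (simp only: linear_sum[OF lin] linear_add[OF lin])
  finally show ?thesis
    using inner_grad_cur[of G D t x y T] inner_grad_del[of G D t x y T] G w by (simp add: wt)
qed

lemma continuous_on_gradients:
  fixes G :: "('n::finite, 'k::finite) jet \<Rightarrow> real"
  assumes G: "\<And>w. w \<in> T \<times> UNIV \<Longrightarrow> (G has_derivative G' w) (at w within T \<times> UNIV)"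
    and cG: "\<And>v. continuous_on (T \<times> UNIV) (\<lambda>w. G' w v)"
  shows "continuous_on (T \<times> UNIV) (grad_cur G k)" "continuous_on (T \<times> UNIV) (grad_del G k)"
proof -
  have "grad_cur G k w \<bullet> b = G' w (0, axis k b, 0) \<and> grad_del G k w \<bullet> b = G' w (0, 0, axis k b)"
    if "w \<in> T \<times> UNIV" for w b
    using inner_grad_cur[of G "G' w" "fst w" "fst (snd w)" "snd (snd w)" T k b]
      inner_grad_del[of G "G' w" "fst w" "fst (snd w)" "snd (snd w)" T k b] G[OF that] that by auto
  then have "continuous_on (T \<times> UNIV) (\<lambda>w. grad_cur G k w \<bullet> b)" "continuous_on (T \<times> UNIV) (\<lambda>w. grad_del G k w \<bullet> b)" for b
    using continuous_on_eq[OF cG] by (metis (no_types, lifting))+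
  then show "continuous_on (T \<times> UNIV) (grad_cur G k)" "continuous_on (T \<times> UNIV) (grad_del G k)"
    using continuous_on_componentwise by blast+
qed

text \<open>As a definite description, \<open>gradient\<close> respects linear combinations only
  where the functions are known to be differentiable; the two sides are compared through their inner
  products with an arbitrary \<open>u\<close>.\<close>

lemma gradients_diff_scale:
  fixes L g :: "('n::finite, 'k::finite) jet \<Rightarrow> real"
  assumes L: "(L has_derivative DL) (at w within T \<times> UNIV)" 
    and g: "(g has_derivative Dg) (at w within T \<times> UNIV)" and w: "fst w \<in> T"
  shows "grad_cur (\<lambda>w. L w - r * g w) k w = grad_cur L k w - r *\<^sub>R grad_cur g k w"
    "grad_del (\<lambda>w. L w - r * g w) k w = grad_del L k w - r *\<^sub>R grad_del g k w"
proof -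
  obtain t x y where wt: "w = (t, x, y)" by (cases w)
  have F: "((\<lambda>w. L w - r * g w) has_derivative (\<lambda>h. DL h - r * Dg h)) (at w within T \<times> UNIV)"
    by (intro has_derivative_diff has_derivative_mult_right L g)
  have "grad_cur (\<lambda>w. L w - r * g w) k w \<bullet> u = (grad_cur L k w - r *\<^sub>R grad_cur g k w) \<bullet> u" for u
    using inner_grad_cur[OF F[unfolded wt], of k u] inner_grad_cur[OF L[unfolded wt], of k u]
      inner_grad_cur[OF g[unfolded wt], of k u] w
    by (simp add: wt inner_diff_left)
  then show "grad_cur (\<lambda>w. L w - r * g w) k w = grad_cur L k w - r *\<^sub>R grad_cur g k w"
    using vector_eq_rdot by blast
  have "grad_del (\<lambda>w. L w - r * g w) k w \<bullet> u = (grad_del L k w - r *\<^sub>R grad_del g k w) \<bullet> u" for u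
    using inner_grad_del[OF F[unfolded wt], of k u] inner_grad_del[OF L[unfolded wt], of k u]
      inner_grad_del[OF g[unfolded wt], of k u] w
    by (simp add: wt inner_diff_left)
  then show "grad_del (\<lambda>w. L w - r * g w) k w = grad_del L k w - r *\<^sub>R grad_del g k w"
    using vector_eq_rdot by blast
qed

text \<open>Explicit null sets can be united over the orders of derivatives and translated by the
  delay; this is the passage between them and the \<open>AE\<close> statements of the definitions
  and of the theorem.\<close>

lemma AE_lebesgue_on_iff_negligible:
  assumes "S \<in> sets lebesgue"
  shows "(AE t in lebesgue_on S. P t) \<longleftrightarrow> (\<exists>N. negligible N \<and> (\<forall>t\<in>S - N. P t))"
proof -
  have "(AE t in lebesgue_on S. P t) \<longleftrightarrow> (AE t in lebesgue. t \<in> S \<longrightarrow> P t)"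
    using assms by (simp add: AE_restrict_space_iff)
  also have "\<dots> \<longleftrightarrow> (\<exists>N. N \<in> null_sets lebesgue \<and> (\<forall>t\<in>S - N. P t))"
  proof
    assume "AE t in lebesgue. t \<in> S \<longrightarrow> P t"
    then obtain N where "N \<in> null_sets lebesgue" "{t \<in> space lebesgue. \<not> (t \<in> S \<longrightarrow> P t)} \<subseteq> N"
      by (auto simp: eventually_ae_filter)
    then show "\<exists>N. N \<in> null_sets lebesgue \<and> (\<forall>t\<in>S - N. P t)"
      by (intro exI[of _ N]) auto
  next
    assume "\<exists>N. N \<in> null_sets lebesgue \<and> (\<forall>t\<in>S - N. P t)"
    then obtain N where N: "N \<in> null_sets lebesgue" "\<forall>t\<in>S - N. P t" by (elim exE conjE)
    show "AE t in lebesgue. t \<in> S \<longrightarrow> P t"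
      by (rule AE_I'[OF N(1)]) (use N(2) in auto)
  qed
  finally show ?thesis by (simp add: negligible_iff_null_sets)
qed

lemma measurable_lebesgue_on_spike:
  fixes f g :: "real \<Rightarrow> 'b::euclidean_space"
  assumes "f \<in> borel_measurable (lebesgue_on {a..b})" "negligible N" "\<forall>t\<in>{a..b} - N. g t = f t"
  shows "g \<in> borel_measurable (lebesgue_on {a..b})"
proof -
  have "f measurable_on {a..b}"
    using assms(1) by (simp add: measurable_on_iff_borel_measurable)
  then have "g measurable_on {a..b}"
    by (rule measurable_on_spike[OF _ assms(2)]) (use assms(3) in auto)
  then show ?thesis by (simp add: measurable_on_iff_borel_measurable)
qed

section \<open>Perturbations in Sobolev spaces\<close>

lemma absolutely_continuous_add:
  assumes "absolutely_continuous_on_interval a b f" "absolutely_continuous_on_interval a b h"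
  shows "absolutely_continuous_on_interval a b (\<lambda>t. f t + h t)"
  unfolding absolutely_continuous_on_interval_def
proof (intro allI impI)
  fix e :: real assume "0 < e"
  then have e2: "0 < e / 2" by simp
  obtain d1 where d1: "d1 > 0" "\<And>D. finite D \<and> (\<forall>(u, v)\<in>D. a \<le> u \<and> u \<le> v \<and> v \<le> b) \<and>
        disjoint_family_on (\<lambda>(u, v). {u<..<v}) D \<and> (\<Sum>(u, v)\<in>D. v - u) < d1 \<Longrightarrow>
        (\<Sum>(u, v)\<in>D. norm (f v - f u)) < e / 2"
    using assms(1)[unfolded absolutely_continuous_on_interval_def, rule_format, OF e2] by auto
  obtain d2 where d2: "d2 > 0" "\<And>D. finite D \<and> (\<forall>(u, v)\<in>D. a \<le> u \<and> u \<le> v \<and> v \<le> b) \<and>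
        disjoint_family_on (\<lambda>(u, v). {u<..<v}) D \<and> (\<Sum>(u, v)\<in>D. v - u) < d2 \<Longrightarrow>
        (\<Sum>(u, v)\<in>D. norm (h v - h u)) < e / 2"
    using assms(2)[unfolded absolutely_continuous_on_interval_def, rule_format, OF e2] by auto
  have "(\<Sum>(u, v)\<in>D. norm (f v + h v - (f u + h u))) < e"
    if D: "finite D \<and> (\<forall>(u, v)\<in>D. a \<le> u \<and> u \<le> v \<and> v \<le> b) \<and>
        disjoint_family_on (\<lambda>(u, v). {u<..<v}) D \<and> (\<Sum>(u, v)\<in>D. v - u) < min d1 d2" for D
  proof -
    have "(\<Sum>(u, v)\<in>D. norm (f v + h v - (f u + h u)))
        \<le> (\<Sum>x\<in>D. (case x of (u, v) \<Rightarrow> norm (f v - f u)) + (case x of (u, v) \<Rightarrow> norm (h v - h u)))"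
      by (intro sum_mono) (auto simp: add_diff_add norm_triangle_ineq)
    also have "\<dots> < e / 2 + e / 2"
      unfolding sum.distrib using D by (intro add_strict_mono d1(2) d2(2)) simp_all
    finally show ?thesis by simp
  qed
  with d1(1) d2(1) show "\<exists>\<delta>>0. \<forall>D. finite D \<and> (\<forall>(u, v)\<in>D. a \<le> u \<and> u \<le> v \<and> v \<le> b) \<and>
        disjoint_family_on (\<lambda>(u, v). {u<..<v}) D \<and> (\<Sum>(u, v)\<in>D. v - u) < \<delta> \<longrightarrow>
        (\<Sum>(u, v)\<in>D. norm (f v + h v - (f u + h u))) < e"
    by (intro exI[of _ "min d1 d2"]) simp
qed

lemma absolutely_continuous_cong:
  assumes "\<forall>t\<in>{a..b}. f t = h t"
  shows "absolutely_continuous_on_interval a b f = absolutely_continuous_on_interval a b h"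
proof -
  have "(\<Sum>(u, v)\<in>D. norm (f v - f u)) = (\<Sum>(u, v)\<in>D. norm (h v - h u))"
    if "\<forall>(u, v)\<in>D. a \<le> u \<and> u \<le> v \<and> v \<le> b" for D
    using that assms by (intro sum.cong) auto
  then show ?thesis
    unfolding absolutely_continuous_on_interval_def by (intro all_cong1 imp_cong ex_cong1 conj_cong refl) auto
qed

lemma Lipschitz_imp_absolutely_continuous:
  assumes "0 \<le> C" and lip: "\<And>u v. a \<le> u \<Longrightarrow> u \<le> v \<Longrightarrow> v \<le> b \<Longrightarrow> norm (f v - f u) \<le> C * (v - u)"
  shows "absolutely_continuous_on_interval a b f"
  unfolding absolutely_continuous_on_interval_def
proof (intro allI impI)
  fix e :: real assume "0 < e"
  have "(\<Sum>(u, v)\<in>D. norm (f v - f u)) < e"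
    if D: "finite D \<and> (\<forall>(u, v)\<in>D. a \<le> u \<and> u \<le> v \<and> v \<le> b) \<and>
        disjoint_family_on (\<lambda>(u, v). {u<..<v}) D \<and> (\<Sum>(u, v)\<in>D. v - u) < e / (C + 1)" for D
  proof -
    have "(\<Sum>(u, v)\<in>D. norm (f v - f u)) \<le> (\<Sum>x\<in>D. (C + 1) * (case x of (u, v) \<Rightarrow> v - u))"
    proof (rule sum_mono)
      fix x assume "x \<in> D"
      then obtain u v where x: "x = (u, v)" "a \<le> u" "u \<le> v" "v \<le> b" using D by (cases x) auto
      have "norm (f v - f u) \<le> C * (v - u)" by (rule lip[OF x(2-4)])
      also have "\<dots> \<le> (C + 1) * (v - u)" using x by (intro mult_right_mono) auto
      finally show "(case x of (u, v) \<Rightarrow> norm (f v - f u)) \<le> (C + 1) * (case x of (u, v) \<Rightarrow> v - u)"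
        by (simp add: x)
    qed
    also have "\<dots> = (C + 1) * (\<Sum>(u, v)\<in>D. v - u)" by (rule sum_distrib_left[symmetric])
    also have "\<dots> < e" using D \<open>0 \<le> C\<close> by (simp add: pos_less_divide_eq mult.commute)
    finally show ?thesis .
  qed
  then show "\<exists>\<delta>>0. \<forall>D. finite D \<and> (\<forall>(u, v)\<in>D. a \<le> u \<and> u \<le> v \<and> v \<le> b) \<and>
        disjoint_family_on (\<lambda>(u, v). {u<..<v}) D \<and> (\<Sum>(u, v)\<in>D. v - u) < \<delta> \<longrightarrow>
        (\<Sum>(u, v)\<in>D. norm (f v - f u)) < e"
    using \<open>0 < e\<close> \<open>0 \<le> C\<close> by (intro exI[of _ "e / (C + 1)"]) simp
qed

lemma absolutely_continuous_imp_continuous_on: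
  assumes "absolutely_continuous_on_interval a b f"
  shows "continuous_on {a..b} f"
  unfolding continuous_on_iff
proof (intro ballI allI impI)
  fix x and e :: real assume x: "x \<in> {a..b}" and "0 < e"
  obtain d where d: "d > 0" "\<And>D. finite D \<and> (\<forall>(u, v)\<in>D. a \<le> u \<and> u \<le> v \<and> v \<le> b) \<and>
        disjoint_family_on (\<lambda>(u, v). {u<..<v}) D \<and> (\<Sum>(u, v)\<in>D. v - u) < d \<Longrightarrow>
        (\<Sum>(u, v)\<in>D. norm (f v - f u)) < e"
    using assms[unfolded absolutely_continuous_on_interval_def, rule_format, OF \<open>0 < e\<close>] by auto
  have *: "norm (f v - f u) < e" if "a \<le> u" "u \<le> v" "v \<le> b" "v - u < d" for u v
    using d(2)[of "{(u, v)}"] that by (simp add: disjoint_family_on_def)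
  have "dist (f y) (f x) < e" if "y \<in> {a..b}" "dist y x < d" for y
    using *[of x y] *[of y x] that x
    by (cases "x \<le> y") (auto simp: dist_norm dist_real_def norm_minus_commute)
  with d(1) show "\<exists>d>0. \<forall>y\<in>{a..b}. dist y x < d \<longrightarrow> dist (f y) (f x) < e" by blast
qed

text \<open>A function \<open>\<eta> 0\<close> of class C^m together with its derivatives. Naming
  the derivatives avoids evaluating the total function \<open>vector_derivative\<close> on
  variations.\<close>

definition derivative_chain :: "nat \<Rightarrow> real \<Rightarrow> real \<Rightarrow> (nat \<Rightarrow> real \<Rightarrow> 'b::euclidean_space) \<Rightarrow> bool" where
  "derivative_chain m a b \<eta> \<longleftrightarrow>
     (\<forall>i<m. \<forall>t\<in>{a..b}. (\<eta> i has_vector_derivative \<eta> (Suc i) t) (at t within {a..b})) \<and>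
     continuous_on {a..b} (\<eta> m)"

lemma derivative_chain_continuous:
  assumes "derivative_chain m a b \<eta>" "i \<le> m"
  shows "continuous_on {a..b} (\<eta> i)"
proof (cases "i = m")
  case False
  then have "\<forall>t\<in>{a..b}. (\<eta> i has_vector_derivative \<eta> (Suc i) t) (at t within {a..b})"
    using assms by (simp add: derivative_chain_def)
  then show ?thesis by (intro continuous_on_vector_derivative) auto
qed (use assms in \<open>simp add: derivative_chain_def\<close>)

lemma derivative_chain_absolutely_continuous:
  assumes \<eta>: "derivative_chain m a b \<eta>" and i: "i < m"
  shows "absolutely_continuous_on_interval a b (\<eta> i)"
proof -
  have c: "continuous_on {a..b} (\<eta> (Suc i))"
    using derivative_chain_continuous[OF \<eta>] i by simp
  obtain C where C: "0 \<le> C" "\<And>t. t \<in> {a..b} \<Longrightarrow> norm (\<eta> (Suc i) t) \<le> C"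
    by (rule continuous_on_Icc_norm_bound[OF c]) (rule that)
  show ?thesis
  proof (rule Lipschitz_imp_absolutely_continuous[OF C(1)])
    fix u v assume uv: "a \<le> u" "u \<le> v" "v \<le> b"
    have "(\<eta> (Suc i) has_integral \<eta> i v - \<eta> i u) {u..v}"
    proof (rule fundamental_theorem_of_calculus[OF uv(2)])
      fix t assume "t \<in> {u..v}"
      then have "(\<eta> i has_vector_derivative \<eta> (Suc i) t) (at t within {a..b})"
        using \<eta> i uv by (simp add: derivative_chain_def)
      then show "(\<eta> i has_vector_derivative \<eta> (Suc i) t) (at t within {u..v})"
        by (rule has_vector_derivative_within_subset) (use uv in auto)
    qed
    then show "norm (\<eta> i v - \<eta> i u) \<le> C * (v - u)"
      using norm_integral_le_length[of "\<eta> (Suc i)" u v C] C(2) uv by (auto simp: has_integral_iff)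
  qed
qed

text \<open>Existence can fail only at the last differentiation and only on a null set; the
  disjunction retains it everywhere at lower orders. Iteration depends on this, since a derivative
  at one point involves the function at all nearby points.\<close>

lemma sobolev_inf_differentiable:
  assumes q: "q \<in> sobolev_inf m a b" and m: "1 \<le> m"
  shows "\<exists>N. negligible N \<and> (\<forall>i<m. \<forall>t\<in>{a..b}. t \<notin> N \<or> Suc i < m \<longrightarrow>
     (nth_deriv a b i q has_vector_derivative nth_deriv a b (Suc i) q t) (at t within {a..b}))"
proof -
  have "AE t in lebesgue_on {a..b}. nth_deriv a b (m - 1) q differentiable (at t within {a..b})"
    using q by (simp add: sobolev_inf_def)
  then obtain N where "negligible N" and
    N: "\<forall>t\<in>{a..b} - N. nth_deriv a b (m - 1) q differentiable (at t within {a..b})"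
    using AE_lebesgue_on_iff_negligible[of "{a..b}"] by auto
  have diff: "nth_deriv a b i q differentiable (at t within {a..b})"
    if "i < m" "t \<in> {a..b}" "t \<notin> N \<or> Suc i < m" for i t
  proof (cases "Suc i < m")
    case True
    then show ?thesis using q that by (simp add: sobolev_inf_def)
  next
    case False
    then have "i = m - 1" using that by simp
    then show ?thesis using N that False by simp
  qed
  show ?thesis
  proof (intro exI conjI allI impI ballI)
    show "negligible N" by fact
    show "(nth_deriv a b i q has_vector_derivative nth_deriv a b (Suc i) q t) (at t within {a..b})"
      if "i < m" "t \<in> {a..b}" "t \<notin> N \<or> Suc i < m" for i t
      using diff[OF that] unfolding nth_deriv.simps vector_derivative_works[symmetric] .
  qed
qed

text \<open>Passing from order i to i + 1 at a point uses the formula of order i on the whole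
  interval. It holds there as long as i < m, so the null set enters only at the last step.\<close>

lemma nth_deriv_add_chain:
  assumes ab: "a < b" and m: "1 \<le> m" and q: "q \<in> sobolev_inf m a b" and \<eta>: "derivative_chain m a b \<eta>"
  shows "\<exists>N. negligible N \<and> (\<forall>i\<le>m. \<forall>t\<in>{a..b}. t \<notin> N \<or> i < m \<longrightarrow>
     nth_deriv a b i (\<lambda>t. q t + \<eta> 0 t) t = nth_deriv a b i q t + \<eta> i t) \<and>
     (\<forall>i<m. \<forall>t\<in>{a..b}. t \<notin> N \<or> Suc i < m \<longrightarrow>
        nth_deriv a b i (\<lambda>t. q t + \<eta> 0 t) differentiable (at t within {a..b}))"
proof -
  obtain N where N: "negligible N" "\<forall>i<m. \<forall>t\<in>{a..b}. t \<notin> N \<or> Suc i < m \<longrightarrow>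
     (nth_deriv a b i q has_vector_derivative nth_deriv a b (Suc i) q t) (at t within {a..b})"
    using sobolev_inf_differentiable[OF q m] by (elim exE conjE)
  define p where "p = (\<lambda>t. q t + \<eta> 0 t)"
  have step: "(nth_deriv a b i p has_vector_derivative nth_deriv a b (Suc i) q t + \<eta> (Suc i) t) (at t within {a..b})"
    if eq: "\<forall>t\<in>{a..b}. nth_deriv a b i p t = nth_deriv a b i q t + \<eta> i t"
      and i: "i < m" "t \<in> {a..b}" "t \<notin> N \<or> Suc i < m" for i t
  proof (rule has_vector_derivative_transform[OF i(2)])
    show "\<And>s. s \<in> {a..b} \<Longrightarrow> nth_deriv a b i p s = nth_deriv a b i q s + \<eta> i s" using eq by simp
    show "((\<lambda>s. nth_deriv a b i q s + \<eta> i s) has_vector_derivative nth_deriv a b (Suc i) q t + \<eta> (Suc i) t)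
        (at t within {a..b})"
      using N(2) \<eta> i by (intro has_vector_derivative_add) (simp_all add: derivative_chain_def del: nth_deriv.simps)
  qed
  have low: "i < m \<Longrightarrow> \<forall>t\<in>{a..b}. nth_deriv a b i p t = nth_deriv a b i q t + \<eta> i t" for i
  proof (induction i)
    case (Suc i)
    then have "\<forall>t\<in>{a..b}. nth_deriv a b i p t = nth_deriv a b i q t + \<eta> i t" by simp
    from step[OF this] Suc.prems
    have "(nth_deriv a b i p has_vector_derivative nth_deriv a b (Suc i) q t + \<eta> (Suc i) t) (at t within {a..b})"
      if "t \<in> {a..b}" for t using that by simp
    from vector_derivative_within_closed_interval[OF ab _ this] show ?case by simp
  qed (simp add: p_def)
  have all: "nth_deriv a b i p t = nth_deriv a b i q t + \<eta> i t"
    if i: "i \<le> m" "t \<in> {a..b}" "t \<notin> N \<or> i < m" for i t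
  proof (cases "i < m")
    case False
    then obtain j where j: "i = Suc j" "j < m" using m i by (cases i) auto
    from vector_derivative_within_closed_interval[OF ab i(2) step[OF low[OF j(2)] j(2) i(2)]] False i j
    show ?thesis by simp
  qed (use low i in auto)
  have "nth_deriv a b i p differentiable (at t within {a..b})"
    if "i < m" "t \<in> {a..b}" "t \<notin> N \<or> Suc i < m" for i t
    using step[OF low[OF that(1)] that] by (rule differentiableI_vector)
  with N(1) all show ?thesis
    unfolding p_def[symmetric] by (intro exI[of _ N]) simp
qed

lemma sobolev_inf_add_chain:
  assumes ab: "a < b" and m: "1 \<le> m" and q: "q \<in> sobolev_inf m a b" and \<eta>: "derivative_chain m a b \<eta>"
  shows "(\<lambda>t. q t + \<eta> 0 t) \<in> sobolev_inf m a b"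
proof -
  define p where "p = (\<lambda>t. q t + \<eta> 0 t)"
  obtain N where N: "negligible N" and
    eq: "\<forall>i\<le>m. \<forall>t\<in>{a..b}. t \<notin> N \<or> i < m \<longrightarrow> nth_deriv a b i p t = nth_deriv a b i q t + \<eta> i t" and
    diff: "\<forall>i<m. \<forall>t\<in>{a..b}. t \<notin> N \<or> Suc i < m \<longrightarrow> nth_deriv a b i p differentiable (at t within {a..b})"
    using nth_deriv_add_chain[OF assms] unfolding p_def by (elim exE conjE)
  have ac: "absolutely_continuous_on_interval a b (nth_deriv a b i p)" if i: "i < m" for i
  proof -
    have "absolutely_continuous_on_interval a b (\<lambda>t. nth_deriv a b i q t + \<eta> i t)"
      using q i by (intro absolutely_continuous_add derivative_chain_absolutely_continuous[OF \<eta>])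
        (simp_all add: sobolev_inf_def)
    then show ?thesis
      using absolutely_continuous_cong[of a b "nth_deriv a b i p" "\<lambda>t. nth_deriv a b i q t + \<eta> i t"] eq i by simp
  qed
  have c\<eta>: "continuous_on {a..b} (\<eta> m)" using derivative_chain_continuous[OF \<eta>] by simp
  have top: "\<forall>t\<in>{a..b} - N. nth_deriv a b m p t = nth_deriv a b m q t + \<eta> m t" using eq by simp
  have meas: "nth_deriv a b m p \<in> borel_measurable (lebesgue_on {a..b})"
  proof (rule measurable_lebesgue_on_spike[OF _ N top])
    show "(\<lambda>t. nth_deriv a b m q t + \<eta> m t) \<in> borel_measurable (lebesgue_on {a..b})"
      using q by (intro borel_measurable_add continuous_imp_measurable_on_sets_lebesgue[OF c\<eta>])
        (simp_all add: sobolev_inf_def)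
  qed
  have "\<exists>C. AE t in lebesgue_on {a..b}. norm (nth_deriv a b m q t) \<le> C"
    using q by (simp add: sobolev_inf_def)
  then obtain C N' where N': "negligible N'" "\<forall>t\<in>{a..b} - N'. norm (nth_deriv a b m q t) \<le> C"
    using AE_lebesgue_on_iff_negligible[of "{a..b}"] by auto
  obtain B where B: "\<And>t. t \<in> {a..b} \<Longrightarrow> norm (\<eta> m t) \<le> B"
    by (rule continuous_on_Icc_norm_bound[OF c\<eta>]) (rule that)
  have "norm (nth_deriv a b m p t) \<le> C + B" if "t \<in> {a..b} - (N \<union> N')" for t
  proof -
    have "nth_deriv a b m p t = nth_deriv a b m q t + \<eta> m t" using top that by simp
    also have "norm \<dots> \<le> C + B"
      using N'(2) B[of t] that by (intro norm_triangle_le add_mono) simp_all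
    finally show ?thesis .
  qed
  then have bound: "\<exists>C. AE t in lebesgue_on {a..b}. norm (nth_deriv a b m p t) \<le> C"
    using N N'(1) by (intro exI[of _ "C + B"] AE_lebesgue_on_iff_negligible[THEN iffD2] exI[of _ "N \<union> N'"]) simp_all
  have top_diff: "AE t in lebesgue_on {a..b}. nth_deriv a b (m - 1) p differentiable (at t within {a..b})"
    using N diff m by (intro AE_lebesgue_on_iff_negligible[THEN iffD2] exI[of _ N]) simp_all
  have low_diff: "\<forall>i. Suc i < m \<longrightarrow> (\<forall>t\<in>{a..b}. nth_deriv a b i p differentiable (at t within {a..b}))"
    using diff by simp
  have ac': "\<forall>i<m. absolutely_continuous_on_interval a b (nth_deriv a b i p)" using ac by simp
  show ?thesis
    unfolding sobolev_inf_def p_def[symmetric] mem_Collect_eq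
    using ac' low_diff top_diff meas bound by (intro conjI)
qed

lemma nth_deriv_chain:
  assumes ab: "a < b" and \<eta>: "derivative_chain m a b \<eta>"
  shows "i \<le> m \<Longrightarrow> \<forall>t\<in>{a..b}. nth_deriv a b i (\<eta> 0) t = \<eta> i t"
proof (induction i)
  case (Suc i)
  have "(nth_deriv a b i (\<eta> 0) has_vector_derivative \<eta> (Suc i) t) (at t within {a..b})"
    if t: "t \<in> {a..b}" for t
  proof (rule has_vector_derivative_transform[OF t])
    show "\<And>s. s \<in> {a..b} \<Longrightarrow> nth_deriv a b i (\<eta> 0) s = \<eta> i s" using Suc by simp
    show "(\<eta> i has_vector_derivative \<eta> (Suc i) t) (at t within {a..b})"
      using \<eta> Suc.prems t by (simp add: derivative_chain_def)
  qed
  from vector_derivative_within_closed_interval[OF ab _ this] show ?case by simp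
qed simp

lemma sobolev_inf_norm_chain_le:
  assumes ab: "a < b" and \<eta>: "derivative_chain m a b \<eta>"
    and B: "\<forall>i\<le>m. \<forall>t\<in>{a..b}. norm (\<eta> i t) \<le> B"
  shows "sobolev_inf_norm m a b (\<eta> 0) \<le> ereal (real (Suc m) * B)"
proof -
  have "sobolev_inf_norm m a b (\<eta> 0) \<le> (\<Sum>i\<le>m. ereal B)"
    unfolding sobolev_inf_norm_def
  proof (rule sum_mono)
    fix i assume "i \<in> {..m}"
    then have i: "i \<le> m" by simp
    have "continuous_on {a..b} (\<lambda>t. norm (nth_deriv a b i (\<eta> 0) t))"
      by (rule continuous_on_eq[OF continuous_on_norm[OF derivative_chain_continuous[OF \<eta> i]]])
        (use nth_deriv_chain[OF ab \<eta> i] in simp)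
    then have "(\<lambda>t. norm (nth_deriv a b i (\<eta> 0) t)) \<in> borel_measurable (lebesgue_on {a..b})"
      by (rule continuous_imp_measurable_on_sets_lebesgue) simp
    then show "esssup (lebesgue_on {a..b}) (\<lambda>t. ereal (norm (nth_deriv a b i (\<eta> 0) t))) \<le> ereal B"
      using nth_deriv_chain[OF ab \<eta> i] B i
      by (intro esssup_I) (auto intro!: AE_I2)
  qed
  then show ?thesis by simp
qed

text \<open>Composition with a general continuous map may destroy Lebesgue measurability.
  Translations are safe, being a special case of \<open>lebesgue_affine_measurable\<close>.\<close>

lemma measurable_lebesgue_on_shift:
  fixes f :: "real \<Rightarrow> 'b::euclidean_space"
  assumes "f \<in> borel_measurable (lebesgue_on {a..b})"
  shows "(\<lambda>t. f (t + r)) \<in> borel_measurable (lebesgue_on {a - r..b - r})"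
proof -
  have "(\<lambda>t. r + (\<Sum>j\<in>Basis. (1 * (t \<bullet> j)) *\<^sub>R j)) \<in> lebesgue \<rightarrow>\<^sub>M lebesgue" for r :: real
    by (rule lebesgue_affine_measurable) simp
  from this[of r] have "(\<lambda>t. r + t) \<in> lebesgue \<rightarrow>\<^sub>M lebesgue" by simp
  then have "(\<lambda>t. t + r) \<in> lebesgue \<rightarrow>\<^sub>M lebesgue" by (simp only: add.commute)
  then have "(\<lambda>t. t + r) \<in> lebesgue_on {a - r..b - r} \<rightarrow>\<^sub>M lebesgue_on {a..b}"
    by (rule measurable_restrict_space3) auto
  from measurable_compose[OF this assms] show ?thesis .
qed

text \<open>Integration ignores null sets, so the exceptional set does not grow with
  \<open>k\<close>.\<close>

lemma iter_integral_cong_negligible: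
  fixes f h :: "real \<Rightarrow> 'b::euclidean_space"
  assumes c: "c \<in> {a..b}"
    and f: "f \<in> borel_measurable (lebesgue_on {a..b})" "\<forall>t\<in>{a..b}. norm (f t) \<le> M"
    and N: "negligible N" "\<forall>t\<in>{a..b} - N. h t = f t"
  shows "\<forall>t\<in>{a..b} - N. iter_integral c k h t = iter_integral c k f t"
proof (induction k)
  case (Suc k)
  have int: "iter_integral c k f absolutely_integrable_on {a..b}"
    by (rule iter_integral_absolutely_integrable[OF c f])
  have h: "iter_integral c k h absolutely_integrable_on {a..b}"
    by (rule absolutely_integrable_spike[OF int N(1)]) (use Suc in auto)
  have eq: "integral {a..t} (iter_integral c k h) = integral {a..t} (iter_integral c k f)"
    if "t \<in> {a..b}" for t
    by (rule integral_spike[OF N(1), symmetric]) (use Suc that in auto)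
  show ?case
    using interval_LINT_eq_integral_diff[OF int c] interval_LINT_eq_integral_diff[OF h c] eq eq[OF c] by simp
qed (use N in simp)

text \<open>Only the top derivative has to be altered, and only on a null set; those of lower order
  are continuous and hence bounded on the interval. Bounds at every point are wanted so that the
  jets lie in a compact set at every time.\<close>

lemma sobolev_inf_regularised_derivatives:
  fixes q :: "real \<Rightarrow> 'b::euclidean_space"
  assumes q: "q \<in> sobolev_inf m a b"
  shows "\<exists>y N M. negligible N \<and> (\<forall>i\<le>m. \<forall>t\<in>{a..b} - N. nth_deriv a b i q t = y i t) \<and>
    (\<forall>i\<le>m. y i \<in> borel_measurable (lebesgue_on {a..b}) \<and> (\<forall>t\<in>{a..b}. norm (y i t) \<le> M))"
proof -
  have "\<exists>C. AE t in lebesgue_on {a..b}. norm (nth_deriv a b m q t) \<le> C"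
    using q by (simp add: sobolev_inf_def)
  then obtain C N where N: "negligible N" "\<forall>t\<in>{a..b} - N. norm (nth_deriv a b m q t) \<le> C"
    using AE_lebesgue_on_iff_negligible[of "{a..b}"] by auto
  \<comment> \<open>The value 0 on \<open>N\<close> explains the bound \<open>max C 0\<close> below:
    \<open>C\<close> is not assumed to be nonnegative.\<close>
  define y where "y = (\<lambda>i t. if i = m \<and> t \<in> N then 0 else nth_deriv a b i q t)"
  have cont: "continuous_on {a..b} (nth_deriv a b i q)" if "i < m" for i
    using q that by (intro absolutely_continuous_imp_continuous_on) (simp add: sobolev_inf_def)
  have meas: "y i \<in> borel_measurable (lebesgue_on {a..b})" if "i \<le> m" for i
  proof (rule measurable_lebesgue_on_spike[OF _ N(1)])
    show "nth_deriv a b i q \<in> borel_measurable (lebesgue_on {a..b})"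
    proof (cases "i = m")
      case False
      then show ?thesis
        using cont[of i] that by (intro continuous_imp_measurable_on_sets_lebesgue) auto
    qed (use q in \<open>simp add: sobolev_inf_def\<close>)
  qed (simp add: y_def)
  have "\<exists>B. \<forall>t\<in>{a..b}. norm (y i t) \<le> B" if "i \<le> m" for i
  proof (cases "i = m")
    case True
    then have "\<forall>t\<in>{a..b}. norm (y i t) \<le> max C 0" using N(2) by (auto simp: y_def le_max_iff_disj)
    then show ?thesis ..
  next
    case False
    then have "continuous_on {a..b} (nth_deriv a b i q)" using cont that by simp
    then obtain B where "\<And>t. t \<in> {a..b} \<Longrightarrow> norm (nth_deriv a b i q t) \<le> B"
      by (rule continuous_on_Icc_norm_bound) (rule that)
    then have "\<forall>t\<in>{a..b}. norm (y i t) \<le> B" using False by (simp add: y_def)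
    then show ?thesis ..
  qed
  then have "\<forall>i. \<exists>B. i \<le> m \<longrightarrow> (\<forall>t\<in>{a..b}. norm (y i t) \<le> B)" by blast
  from choice[OF this] obtain B where B: "\<And>i. i \<le> m \<Longrightarrow> \<forall>t\<in>{a..b}. norm (y i t) \<le> B i"
    by auto
  have "norm (y i t) \<le> (\<Sum>i\<le>m. \<bar>B i\<bar>)" if "i \<le> m" "t \<in> {a..b}" for i t
  proof -
    have "norm (y i t) \<le> \<bar>B i\<bar>" using B[OF that(1)] that(2) by fastforce
    also have "\<dots> \<le> (\<Sum>i\<le>m. \<bar>B i\<bar>)" by (rule member_le_sum) (use that in auto)
    finally show ?thesis .
  qed
  with N(1) meas show ?thesis
    by (intro exI[of _ y] exI[of _ N] exI[of _ "\<Sum>i\<le>m. \<bar>B i\<bar>"]) (simp add: y_def)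
qed

section \<open>Jets of families of functions and extension of variations\<close>

definition delay_pair ::
    "nat \<Rightarrow> (nat \<Rightarrow> 'k::finite) \<Rightarrow> real \<Rightarrow> (nat \<Rightarrow> real \<Rightarrow> 'a) \<Rightarrow> real \<Rightarrow> ('a ^ 'k) \<times> ('a ^ 'k)" where
  "delay_pair m e \<tau> Y t = (\<chi> k. Y (inv_into {..m} e k) t, \<chi> k. Y (inv_into {..m} e k) (t - \<tau>))"

lemma delayed_jet_eq_delay_pair:
  "delayed_jet m e a b \<tau> q t = (t, delay_pair m e \<tau> (\<lambda>i. nth_deriv a b i q) t)"
  by (simp add: delayed_jet_def delay_pair_def)

text \<open>Linearity in the family makes the perturbed jet affine in the parameters, which is the
  form in which the parametric integral is differentiated.\<close>

lemma delay_pair_add: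
  "delay_pair m e \<tau> (\<lambda>i t. Y i t + X i t) t = delay_pair m e \<tau> Y t + delay_pair m e \<tau> X t"
  by (simp add: delay_pair_def vec_eq_iff)

lemma delay_pair_scaleR:
  "delay_pair m e \<tau> (\<lambda>i t. r *\<^sub>R Y i t) t = r *\<^sub>R delay_pair m e \<tau> Y t"
  by (simp add: delay_pair_def vec_eq_iff)

lemma measurable_delay_pair:
  fixes Y :: "nat \<Rightarrow> real \<Rightarrow> 'a::euclidean_space"
  assumes e: "bij_betw e {..m} UNIV" and \<tau>: "0 < \<tau>"
    and Y: "\<forall>i\<le>m. Y i \<in> borel_measurable (lebesgue_on {t1 - \<tau>..t2})"
  shows "delay_pair m e \<tau> Y \<in> borel_measurable (lebesgue_on {t1..t2})"
proof -
  have i: "inv_into {..m} e k \<le> m" for k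
    using bij_betw_imp_surj_on[OF e] inv_into_into[of k e "{..m}"] by auto
  have vec: "(\<lambda>t. \<chi> k. f k t) \<in> borel_measurable (lebesgue_on {t1..t2})"
    if "\<And>k. f k \<in> borel_measurable (lebesgue_on {t1..t2})" for f :: "'b \<Rightarrow> real \<Rightarrow> 'a"
  proof -
    \<comment> \<open>The vector is assembled from its measurable components by the linear
      embeddings \<open>axis k\<close>.\<close>
    have "(\<lambda>t. \<Sum>k\<in>UNIV. axis k (f k t)) \<in> borel_measurable (lebesgue_on {t1..t2})"
      by (intro borel_measurable_sum measurable_compose[OF that]
          borel_measurable_continuous_onI linear_continuous_on bounded_linear_axis)
    then show ?thesis using sum_axis_components[of "\<chi> k. f k _"] by simp
  qed
  have Y1: "Y j \<in> borel_measurable (lebesgue_on {t1..t2})" if "j \<le> m" for j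
    by (rule measurable_lebesgue_on_subinterval[of "Y j" "t1 - \<tau>" t2]) (use Y that \<tau> in auto)
  have Y2: "(\<lambda>t. Y j (t - \<tau>)) \<in> borel_measurable (lebesgue_on {t1..t2})" if "j \<le> m" for j
    by (rule measurable_lebesgue_on_subinterval[of "\<lambda>t. Y j (t - \<tau>)" "t1" "t2 + \<tau>"])
      (use measurable_lebesgue_on_shift[of "Y j" "t1 - \<tau>" t2 "- \<tau>"] Y that \<tau> in auto)
  show ?thesis
    unfolding delay_pair_def by (intro borel_measurable_Pair vec Y1[OF i] Y2[OF i])
qed

lemma norm_vec_le:
  fixes x :: "'a::real_normed_vector ^ 'k::finite"
  assumes "\<And>k. norm (x $ k) \<le> B"
  shows "norm x \<le> real CARD('k) * B"
proof -
  have "norm x \<le> (\<Sum>k\<in>UNIV. norm (x $ k))"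
    unfolding norm_vec_def by (rule L2_set_le_sum) simp
  also have "\<dots> \<le> real CARD('k) * B"
    using sum_bounded_above[of UNIV "\<lambda>k. norm (x $ k)" B] assms by simp
  finally show ?thesis .
qed

lemma delay_pair_mem_cball:
  fixes Y :: "nat \<Rightarrow> real \<Rightarrow> 'a::euclidean_space" and e :: "nat \<Rightarrow> 'k::finite"
  assumes e: "bij_betw e {..m} UNIV"
    and Y: "\<forall>i\<le>m. \<forall>t\<in>{t1 - \<tau>..t2}. norm (Y i t) \<le> M" and t: "t \<in> {t1..t2}" and \<tau>: "0 < \<tau>"
  shows "delay_pair m e \<tau> Y t \<in> cball 0 (real CARD('k) * M) \<times> cball 0 (real CARD('k) * M)"
proof -
  have i: "inv_into {..m} e k \<le> m" for k
    using bij_betw_imp_surj_on[OF e] inv_into_into[of k e "{..m}"] by auto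
  show ?thesis
    using t \<tau> Y i by (auto simp: delay_pair_def intro!: norm_vec_le)
qed

text \<open>Scalar functions suffice, since a curve is perturbed by multiples of a fixed vector.
  Order \<open>m\<close> is included in the condition at \<open>a\<close> so that the extension by
  zero to the left is again of class C^m.\<close>

definition is_variation :: "nat \<Rightarrow> real \<Rightarrow> real \<Rightarrow> (nat \<Rightarrow> real \<Rightarrow> real) \<Rightarrow> bool" where
  "is_variation m a b \<phi> \<longleftrightarrow> derivative_chain m a b \<phi> \<and> (\<forall>i\<le>m. \<phi> i a = 0 \<and> \<phi> i b = 0)"

definition zero_before :: "real \<Rightarrow> (real \<Rightarrow> 'b::zero) \<Rightarrow> real \<Rightarrow> 'b" where
  "zero_before c f t = (if t < c then 0 else f t)"

text \<open>The closures of the two pieces meet only at \<open>c\<close>, where a function of the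
  chain and its derivative both vanish, so the one-sided derivatives agree with those of 0. The top
  function is pasted by continuity alone.\<close>

lemma derivative_chain_zero_before:
  fixes \<phi> :: "nat \<Rightarrow> real \<Rightarrow> 'b::euclidean_space"
  assumes ac: "a < c" "c < b" and \<phi>: "derivative_chain m c b \<phi>" and z: "\<forall>i\<le>m. \<phi> i c = 0"
  shows "derivative_chain m a b (\<lambda>i. zero_before c (\<phi> i))"
  unfolding derivative_chain_def
proof (intro conjI allI impI ballI)
  fix i t assume i: "i < m" and t: "t \<in> {a..b}"
  have "((\<lambda>s. if s \<in> {a..<c} then 0 else \<phi> i s) has_vector_derivative
      (if t \<in> {a..<c} then 0 else \<phi> (Suc i) t)) (at t within {a..b})"
  proof (rule has_vector_derivative_If_within_closures[where T="{c..b}"])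
    show "t \<in> {a..<c} \<union> {c..b}" "{a..b} = {a..<c} \<union> {c..b}" using t ac by auto
    have cl: "closure {a..<c} \<inter> closure {c..b} = {c}" using ac by auto
    show "((\<lambda>s. 0) has_vector_derivative 0) (at t within {a..<c} \<union> closure {a..<c} \<inter> closure {c..b})"
      by simp
    show "(\<phi> i has_vector_derivative \<phi> (Suc i) t) (at t within {c..b} \<union> closure {a..<c} \<inter> closure {c..b})"
      if "t \<in> {c..b} \<union> closure {a..<c} \<inter> closure {c..b}"
    proof -
      have eq: "{c..b} \<union> closure {a..<c} \<inter> closure {c..b} = {c..b}" unfolding cl using ac by auto
      show ?thesis using \<phi> i that unfolding eq by (simp add: derivative_chain_def)
    qed
    fix s assume "s \<in> closure {a..<c}" "s \<in> closure {c..b}"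
    then have "s = c" using cl by blast
    then show "0 = \<phi> i s" "0 = \<phi> (Suc i) s" using z i by simp_all
  qed
  then show "(zero_before c (\<phi> i) has_vector_derivative zero_before c (\<phi> (Suc i)) t) (at t within {a..b})"
    by (rule has_vector_derivative_transform[OF t, rotated, THEN has_vector_derivative_eq_rhs])
      (use t in \<open>auto simp: zero_before_def\<close>)
next
  have "continuous_on ({a..c} \<union> {c..b}) (\<lambda>t. if t \<le> c then 0 else \<phi> m t)"
    using \<phi> z by (intro continuous_on_If) (auto simp: derivative_chain_def)
  moreover have "{a..c} \<union> {c..b} = {a..b}" using ac by auto
  ultimately show "continuous_on {a..b} (zero_before c (\<phi> m))"
    by (simp add: zero_before_def) (erule continuous_on_eq, use z in auto)
qed

lemma derivative_chain_lincomb: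
  fixes \<phi> \<psi> :: "nat \<Rightarrow> real \<Rightarrow> real" and v w :: "'b::euclidean_space"
  assumes "derivative_chain m a b \<phi>" "derivative_chain m a b \<psi>"
  shows "derivative_chain m a b (\<lambda>i t. r *\<^sub>R (\<phi> i t *\<^sub>R v) + s *\<^sub>R (\<psi> i t *\<^sub>R w))"
  unfolding derivative_chain_def
proof (intro conjI allI impI ballI)
  have lin: "bounded_linear (\<lambda>x. r *\<^sub>R (x *\<^sub>R u))" for r :: real and u :: 'b
    by (intro bounded_linear_intros)
  fix i t assume "i < m" "t \<in> {a..b}"
  then have "(\<phi> i has_vector_derivative \<phi> (Suc i) t) (at t within {a..b})"
    "(\<psi> i has_vector_derivative \<psi> (Suc i) t) (at t within {a..b})"
    using assms by (simp_all add: derivative_chain_def)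
  then show "((\<lambda>t. r *\<^sub>R (\<phi> i t *\<^sub>R v) + s *\<^sub>R (\<psi> i t *\<^sub>R w)) has_vector_derivative
      r *\<^sub>R (\<phi> (Suc i) t *\<^sub>R v) + s *\<^sub>R (\<psi> (Suc i) t *\<^sub>R w)) (at t within {a..b})"
    by (intro has_vector_derivative_add bounded_linear.has_vector_derivative[OF lin])
qed (use assms in \<open>auto simp: derivative_chain_def intro!: continuous_intros\<close>)

section \<open>The delayed isoperimetric problem\<close>

text \<open>
  \<open>y i\<close> is a representative of the \<open>i\<close>th derivative of \<open>q\<close> that is bounded everywhere, so that the jet
  \<open>Z\<close> stays in a compact convex set.
\<close>

locale regularised_curve =
  fixes m :: nat and e :: "nat \<Rightarrow> 'k::finite" and t1 t2 \<tau> :: real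
    and q :: "real \<Rightarrow> real ^ 'n::finite" and y :: "nat \<Rightarrow> real \<Rightarrow> real ^ 'n" and N :: "real set" and M :: real
  assumes m: "1 \<le> m" and e: "bij_betw e {..m} UNIV"
    and t12: "t1 < t2" and \<tau>: "0 < \<tau>" "\<tau> < t2 - t1"
    and q: "q \<in> sobolev_inf m (t1 - \<tau>) t2" and N: "negligible N"
    and y_eq: "\<forall>i\<le>m. \<forall>t\<in>{t1 - \<tau>..t2} - N. nth_deriv (t1 - \<tau>) t2 i q t = y i t"
    and y_meas: "\<forall>i\<le>m. y i \<in> borel_measurable (lebesgue_on {t1 - \<tau>..t2})"
    and y_bound: "\<forall>i\<le>m. \<forall>t\<in>{t1 - \<tau>..t2}. norm (y i t) \<le> M"
begin

text \<open>Agrees with the delayed jet of \<open>q\<close> off a null set, but is bounded at every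
  time of the interval.\<close>

definition Z :: "real \<Rightarrow> ('n, 'k) jet" where
  "Z t = (t, delay_pair m e \<tau> y t)"

text \<open>The factor \<open>CARD('k)\<close> turns a bound on each component into a bound on the
  norm of the whole family of vectors.\<close>

definition box :: "real \<Rightarrow> ('n, 'k) jet set" where
  "box R = {t1..t2} \<times> cball 0 (real CARD('k) * R) \<times> cball 0 (real CARD('k) * R)"

lemma compact_box: "compact (box R)"
  unfolding box_def by (intro compact_Times compact_Icc compact_cball)

lemma convex_box: "convex (box R)"
  unfolding box_def by (intro convex_Times convex_real_interval convex_cball)

lemma box_subset: "box R \<subseteq> {t1..t2} \<times> UNIV"
  by (auto simp: box_def)

lemma jet_in_box:
  assumes "\<forall>i\<le>m. \<forall>t\<in>{t1 - \<tau>..t2}. norm (Y i t) \<le> R" "t \<in> {t1..t2}"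
  shows "(t, delay_pair m e \<tau> Y t) \<in> box R"
  using delay_pair_mem_cball[OF e assms \<tau>(1)] assms(2) by (auto simp: box_def)

lemma measurable_jet:
  fixes Y :: "nat \<Rightarrow> real \<Rightarrow> real ^ 'n"
  assumes "\<forall>i\<le>m. Y i \<in> borel_measurable (lebesgue_on {t1 - \<tau>..t2})"
    and "f \<in> borel_measurable (lebesgue_on {t1..t2})"
  shows "(\<lambda>t. (f t :: real, delay_pair m e \<tau> Y t)) \<in> borel_measurable (lebesgue_on {t1..t2})"
  by (intro borel_measurable_Pair assms measurable_delay_pair[OF e \<tau>(1)])

lemma Z_measurable: "Z \<in> borel_measurable (lebesgue_on {t1..t2})"
  using measurable_jet[OF y_meas continuous_imp_measurable_on_sets_lebesgue[OF continuous_on_id]]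
  by (simp add: Z_def[abs_def])

lemma Z_in_box: "t \<in> {t1..t2} \<Longrightarrow> Z t \<in> box M"
  using jet_in_box[OF y_bound] by (simp add: Z_def)

lemma chain_regular:
  fixes \<eta> :: "nat \<Rightarrow> real \<Rightarrow> real ^ 'n"
  assumes \<eta>: "derivative_chain m (t1 - \<tau>) t2 \<eta>"
  shows "\<forall>i\<le>m. \<eta> i \<in> borel_measurable (lebesgue_on {t1 - \<tau>..t2})"
    "\<exists>B\<ge>0. \<forall>i\<le>m. \<forall>t\<in>{t1 - \<tau>..t2}. norm (\<eta> i t) \<le> B"
proof -
  show "\<forall>i\<le>m. \<eta> i \<in> borel_measurable (lebesgue_on {t1 - \<tau>..t2})"
    using derivative_chain_continuous[OF \<eta>]
    by (intro allI impI continuous_imp_measurable_on_sets_lebesgue) auto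
  have "\<forall>i. \<exists>B. i \<le> m \<longrightarrow> (0 \<le> B \<and> (\<forall>t\<in>{t1 - \<tau>..t2}. norm (\<eta> i t) \<le> B))"
  proof
    fix i
    show "\<exists>B. i \<le> m \<longrightarrow> (0 \<le> B \<and> (\<forall>t\<in>{t1 - \<tau>..t2}. norm (\<eta> i t) \<le> B))"
    proof (cases "i \<le> m")
      case True
      from derivative_chain_continuous[OF \<eta> this]
      obtain B where "0 \<le> B" "\<And>t. t \<in> {t1 - \<tau>..t2} \<Longrightarrow> norm (\<eta> i t) \<le> B"
        by (rule continuous_on_Icc_norm_bound) (rule that)
      then show ?thesis by (intro exI[of _ B]) simp
    qed simp
  qed
  from choice[OF this] obtain B where B: "\<forall>i. i \<le> m \<longrightarrow> (0 \<le> B i \<and> (\<forall>t\<in>{t1 - \<tau>..t2}. norm (\<eta> i t) \<le> B i))" ..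
  have "norm (\<eta> i t) \<le> (\<Sum>i\<le>m. B i)" if "i \<le> m" "t \<in> {t1 - \<tau>..t2}" for i t
  proof -
    have "norm (\<eta> i t) \<le> B i" using B that by simp
    also have "\<dots> \<le> (\<Sum>i\<le>m. B i)" by (rule member_le_sum) (use that B in auto)
    finally show ?thesis .
  qed
  moreover have "0 \<le> (\<Sum>i\<le>m. B i)" using B by (intro sum_nonneg) simp
  ultimately show "\<exists>B\<ge>0. \<forall>i\<le>m. \<forall>t\<in>{t1 - \<tau>..t2}. norm (\<eta> i t) \<le> B" by auto
qed

lemma delayed_jet_perturbed:
  fixes \<eta> :: "nat \<Rightarrow> real \<Rightarrow> real ^ 'n"
  assumes \<eta>: "derivative_chain m (t1 - \<tau>) t2 \<eta>"
  shows "\<exists>N'. negligible N' \<and> (\<forall>t\<in>{t1..t2} - N'.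
    delayed_jet m e (t1 - \<tau>) t2 \<tau> (\<lambda>t. q t + \<eta> 0 t) t = (t, delay_pair m e \<tau> (\<lambda>i t. y i t + \<eta> i t) t))"
proof -
  have ab: "t1 - \<tau> < t2" using t12 \<tau> by simp
  obtain A where A: "negligible A" "\<forall>i\<le>m. \<forall>t\<in>{t1 - \<tau>..t2}. t \<notin> A \<or> i < m \<longrightarrow>
     nth_deriv (t1 - \<tau>) t2 i (\<lambda>t. q t + \<eta> 0 t) t = nth_deriv (t1 - \<tau>) t2 i q t + \<eta> i t"
    using nth_deriv_add_chain[OF ab m q \<eta>] by (elim exE conjE)
  have i: "inv_into {..m} e k \<le> m" for k
    using bij_betw_imp_surj_on[OF e] inv_into_into[of k e "{..m}"] by auto
  \<comment> \<open>A time \<open>t\<close> is exceptional also when \<open>t - \<tau>\<close> is,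
    because the jet reads the curve at both; this accounts for the translate.\<close>
  have neg: "negligible ((N \<union> A) \<union> (+) \<tau> ` (N \<union> A))"
    using N A(1) by (intro negligible_Un negligible_translation) auto
  have "delayed_jet m e (t1 - \<tau>) t2 \<tau> (\<lambda>t. q t + \<eta> 0 t) t = (t, delay_pair m e \<tau> (\<lambda>i t. y i t + \<eta> i t) t)"
    if t: "t \<in> {t1..t2} - ((N \<union> A) \<union> (+) \<tau> ` (N \<union> A))" for t
  proof -
    have *: "nth_deriv (t1 - \<tau>) t2 i (\<lambda>t. q t + \<eta> 0 t) s = y i s + \<eta> i s"
      if "i \<le> m" "s \<in> {t1 - \<tau>..t2}" "s \<notin> N \<union> A" for i s
      using A(2) y_eq that by simp
    have "t - \<tau> \<notin> N \<union> A"
    proof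
      assume "t - \<tau> \<in> N \<union> A"
      then have "\<tau> + (t - \<tau>) \<in> (+) \<tau> ` (N \<union> A)" by (rule imageI)
      then show False using t by simp
    qed
    then have "nth_deriv (t1 - \<tau>) t2 i (\<lambda>t. q t + \<eta> 0 t) t = y i t + \<eta> i t"
      "nth_deriv (t1 - \<tau>) t2 i (\<lambda>t. q t + \<eta> 0 t) (t - \<tau>) = y i (t - \<tau>) + \<eta> i (t - \<tau>)" if "i \<le> m" for i
      using t that \<tau> by (intro *; simp)+
    then show ?thesis
      unfolding delayed_jet_eq_delay_pair by (simp add: delay_pair_def vec_eq_iff i)
  qed
  with neg show ?thesis by (intro exI[of _ "(N \<union> A) \<union> (+) \<tau> ` (N \<union> A)"] conjI ballI)
qed

lemma delay_functional_perturbed: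
  fixes \<eta> :: "nat \<Rightarrow> real \<Rightarrow> real ^ 'n" and G :: "('n, 'k) jet \<Rightarrow> real"
  assumes \<eta>: "derivative_chain m (t1 - \<tau>) t2 \<eta>" and G: "continuous_on ({t1..t2} \<times> UNIV) G"
  shows "delay_functional m e t1 t2 \<tau> G (\<lambda>t. q t + \<eta> 0 t) =
    integral {t1..t2} (\<lambda>t. G (t, delay_pair m e \<tau> (\<lambda>i t. y i t + \<eta> i t) t))"
proof -
  let ?X = "\<lambda>t. (t, delay_pair m e \<tau> (\<lambda>i t. y i t + \<eta> i t) t)"
  obtain N' where N': "negligible N'" "\<forall>t\<in>{t1..t2} - N'.
    delayed_jet m e (t1 - \<tau>) t2 \<tau> (\<lambda>t. q t + \<eta> 0 t) t = ?X t"
    using delayed_jet_perturbed[OF \<eta>] by (elim exE conjE)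
  obtain B where B: "\<forall>i\<le>m. \<forall>t\<in>{t1 - \<tau>..t2}. norm (\<eta> i t) \<le> B"
    using chain_regular(2)[OF \<eta>] by (elim exE conjE)
  have bnd: "\<forall>i\<le>m. \<forall>t\<in>{t1 - \<tau>..t2}. norm (y i t + \<eta> i t) \<le> M + B"
    using y_bound B by (intro allI impI ballI norm_triangle_le add_mono) simp_all
  have int: "(\<lambda>t. G (?X t)) absolutely_integrable_on {t1..t2}"
  proof (rule integrable_continuous_compose[OF compact_box[of "M + B"] continuous_on_subset[OF G box_subset]])
    show "?X \<in> borel_measurable (lebesgue_on {t1..t2})"
      using y_meas chain_regular(1)[OF \<eta>]
      by (intro measurable_jet continuous_imp_measurable_on_sets_lebesgue[OF continuous_on_id])
        (auto intro!: borel_measurable_add)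
    show "\<forall>t\<in>{t1..t2}. ?X t \<in> box (M + B)" using jet_in_box[OF bnd] by simp
  qed
  have int': "(\<lambda>t. G (delayed_jet m e (t1 - \<tau>) t2 \<tau> (\<lambda>t. q t + \<eta> 0 t) t)) absolutely_integrable_on {t1..t2}"
    by (rule absolutely_integrable_spike[OF int N'(1)]) (use N'(2) in simp)
  show ?thesis
    unfolding delay_functional_def set_lebesgue_integral_eq_integral(2)[OF int']
    by (rule integral_spike[OF N'(1)]) (use N'(2) in simp)
qed

end

text \<open>After the shift the test function sits at t and its coefficient at t + \<tau>. Times
  before t1 drop out because the extended test function vanishes there, and the upper limit t2 -
  \<tau> becomes the conditional, so that delayed and undelayed terms are integrals over the same
  interval.\<close>

lemma integral_delayed_test:
  fixes h :: "real \<Rightarrow> 'b::euclidean_space"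
  assumes "0 < \<tau>"
  shows "integral {t1..t2} (\<lambda>t. zero_before t1 f (t - \<tau>) *\<^sub>R h t) =
    integral {t1..t2} (\<lambda>t. f t *\<^sub>R (if t \<le> t2 - \<tau> then h (t + \<tau>) else 0))"
proof -
  have "integral {t1..t2} (\<lambda>t. zero_before t1 f (t - \<tau>) *\<^sub>R h t) =
      integral {t1 - \<tau>..t2 - \<tau>} (\<lambda>s. zero_before t1 f s *\<^sub>R h (s + \<tau>))"
    using integral_shift_Icc_real[of "t1 - \<tau>" "t2 - \<tau>" "\<lambda>t. zero_before t1 f (t - \<tau>) *\<^sub>R h t" \<tau>]
    by (simp add: o_def add.commute)
  also have "\<dots> = integral UNIV (\<lambda>s. if s \<in> {t1 - \<tau>..t2 - \<tau>} then zero_before t1 f s *\<^sub>R h (s + \<tau>) else 0)"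
    by (rule integral_restrict_UNIV[symmetric])
  also have "\<dots> = integral UNIV (\<lambda>t. if t \<in> {t1..t2} then f t *\<^sub>R (if t \<le> t2 - \<tau> then h (t + \<tau>) else 0) else 0)"
    by (rule arg_cong[of _ _ "integral UNIV"]) (use assms in \<open>auto simp: zero_before_def fun_eq_iff\<close>)
  also have "\<dots> = integral {t1..t2} (\<lambda>t. f t *\<^sub>R (if t \<le> t2 - \<tau> then h (t + \<tau>) else 0))"
    by (rule integral_restrict_UNIV)
  finally show ?thesis .
qed

lemma integrable_continuous_scaleR:
  fixes h :: "real \<Rightarrow> 'b::euclidean_space" and f :: "real \<Rightarrow> real"
  assumes f: "continuous_on {a..b} f" and h: "h \<in> borel_measurable (lebesgue_on {a..b})"
    "\<forall>t\<in>{a..b}. norm (h t) \<le> B"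
  shows "(\<lambda>t. f t *\<^sub>R h t) absolutely_integrable_on {a..b}"
proof -
  obtain C where C: "0 \<le> C" "\<And>t. t \<in> {a..b} \<Longrightarrow> norm (f t) \<le> C"
    using f by (rule continuous_on_Icc_norm_bound) (rule that)
  show ?thesis
  proof (rule absolutely_integrable_bounded_measurable)
    show "(\<lambda>t. f t *\<^sub>R h t) \<in> borel_measurable (lebesgue_on {a..b})"
      by (intro borel_measurable_scaleR h continuous_imp_measurable_on_sets_lebesgue[OF f]) simp
    show "norm (f t *\<^sub>R h t) \<le> C * B" if "t \<in> {a..b}" for t
      using C(1) C(2)[OF that] h(2) that by (simp add: mult_mono)
  qed
qed

section \<open>The first variation along the curve\<close>

context regularised_curve
begin

text \<open>These are the functions f_i: the two expressions of the theorem joined into one function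
  on [t1, t2]. At the joint t2 - \<tau> the first formula is used, a choice at a single
  point.\<close>

definition variation_density :: "(('n, 'k) jet \<Rightarrow> real) \<Rightarrow> nat \<Rightarrow> real \<Rightarrow> real ^ 'n" where
  "variation_density G i t = grad_cur G (e i) (Z t) + (if t \<le> t2 - \<tau> then grad_del G (e i) (Z (t + \<tau>)) else 0)"

text \<open>Its inner product with a vector \<open>v\<close> is the derivative of the functional in
  the direction \<phi> v; keeping it vector-valued treats all \<open>v\<close> at once.\<close>

definition first_variation :: "(('n, 'k) jet \<Rightarrow> real) \<Rightarrow> (nat \<Rightarrow> real \<Rightarrow> real) \<Rightarrow> real ^ 'n" where
  "first_variation G \<phi> = (\<Sum>i\<le>m. integral {t1..t2} (\<lambda>t. \<phi> i t *\<^sub>R variation_density G i t))"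

lemma along_curve_regular:
  fixes h :: "('n, 'k) jet \<Rightarrow> 'b::euclidean_space"
  assumes h: "continuous_on ({t1..t2} \<times> UNIV) h"
  shows "(\<lambda>t. h (Z t)) \<in> borel_measurable (lebesgue_on {t1..t2})"
    "\<exists>B\<ge>0. \<forall>t\<in>{t1..t2}. norm (h (Z t)) \<le> B"
proof -
  have c: "continuous_on (box M) h" by (rule continuous_on_subset[OF h box_subset])
  show "(\<lambda>t. h (Z t)) \<in> borel_measurable (lebesgue_on {t1..t2})"
    by (rule measurable_continuous_compose[OF c Z_measurable]) (simp add: Z_in_box)
  obtain B where "0 \<le> B" "\<forall>x\<in>box M. norm (h x) \<le> B"
    using compact_image_norm_bound[OF compact_box c] by (elim exE conjE)
  then show "\<exists>B\<ge>0. \<forall>t\<in>{t1..t2}. norm (h (Z t)) \<le> B"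
    using Z_in_box by (intro exI[of _ B]) simp
qed

lemma along_shifted_curve_regular:
  fixes h :: "('n, 'k) jet \<Rightarrow> 'b::euclidean_space"
  assumes h: "continuous_on ({t1..t2} \<times> UNIV) h"
  shows "(\<lambda>t. if t \<le> t2 - \<tau> then h (Z (t + \<tau>)) else 0) \<in> borel_measurable (lebesgue_on {t1..t2})"
    "\<exists>B\<ge>0. \<forall>t\<in>{t1..t2}. norm (if t \<le> t2 - \<tau> then h (Z (t + \<tau>)) else 0) \<le> B"
proof -
  have "(\<lambda>t. h (Z (t + \<tau>))) \<in> borel_measurable (lebesgue_on {t1..t2 - \<tau>})"
    by (rule measurable_lebesgue_on_subinterval[OF measurable_lebesgue_on_shift[OF along_curve_regular(1)[OF h]]])
      (use \<tau> in auto)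
  then have "(\<lambda>t. if t \<in> {t1..t2 - \<tau>} then h (Z (t + \<tau>)) else 0) \<in> borel_measurable lebesgue"
    by (rule borel_measurable_if_I) simp
  then have "(\<lambda>t. if t \<in> {t1..t2 - \<tau>} then h (Z (t + \<tau>)) else 0) \<in> borel_measurable (lebesgue_on {t1..t2})"
    by (rule measurable_restrict_space1)
  then show "(\<lambda>t. if t \<le> t2 - \<tau> then h (Z (t + \<tau>)) else 0) \<in> borel_measurable (lebesgue_on {t1..t2})"
    by (rule measurable_cong[THEN iffD1, rotated]) auto
  obtain B where "0 \<le> B" "\<forall>t\<in>{t1..t2}. norm (h (Z t)) \<le> B"
    using along_curve_regular(2)[OF h] by (elim exE conjE)
  then show "\<exists>B\<ge>0. \<forall>t\<in>{t1..t2}. norm (if t \<le> t2 - \<tau> then h (Z (t + \<tau>)) else 0) \<le> B"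
    using \<tau> by (intro exI[of _ B]) auto
qed

lemma variation_density_regular:
  assumes "continuous_on ({t1..t2} \<times> UNIV) (grad_cur G (e i))"
    "continuous_on ({t1..t2} \<times> UNIV) (grad_del G (e i))"
  shows "variation_density G i \<in> borel_measurable (lebesgue_on {t1..t2})"
    "\<exists>B. \<forall>t\<in>{t1..t2}. norm (variation_density G i t) \<le> B"
proof -
  note c = along_curve_regular[OF assms(1)] and d = along_shifted_curve_regular[OF assms(2)]
  show "variation_density G i \<in> borel_measurable (lebesgue_on {t1..t2})"
    unfolding variation_density_def[abs_def] by (rule borel_measurable_add[OF c(1) d(1)])
  obtain B where B: "\<forall>t\<in>{t1..t2}. norm (grad_cur G (e i) (Z t)) \<le> B" using c(2) by (elim exE conjE)
  obtain C where C: "\<forall>t\<in>{t1..t2}. norm (if t \<le> t2 - \<tau> then grad_del G (e i) (Z (t + \<tau>)) else 0) \<le> C"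
    using d(2) by (elim exE conjE)
  have "\<forall>t\<in>{t1..t2}. norm (variation_density G i t) \<le> B + C"
  proof
    fix t assume "t \<in> {t1..t2}"
    then show "norm (variation_density G i t) \<le> B + C"
      unfolding variation_density_def using B C by (intro norm_triangle_le add_mono) blast+
  qed
  then show "\<exists>B. \<forall>t\<in>{t1..t2}. norm (variation_density G i t) \<le> B" ..
qed

lemma derivative_along_variation:
  assumes G: "(G has_derivative D) (at (Z t) within {t1..t2} \<times> UNIV)" and t: "t \<in> {t1..t2}"
  shows "D (0, delay_pair m e \<tau> (\<lambda>i t. f i t *\<^sub>R v) t) =
    (\<Sum>i\<le>m. f i t * (grad_cur G (e i) (Z t) \<bullet> v) + f i (t - \<tau>) * (grad_del G (e i) (Z t) \<bullet> v))"
proof -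
  have "D (0, delay_pair m e \<tau> (\<lambda>i t. f i t *\<^sub>R v) t) =
    (\<Sum>k\<in>UNIV. grad_cur G k (Z t) \<bullet> (f (inv_into {..m} e k) t *\<^sub>R v) +
      grad_del G k (Z t) \<bullet> (f (inv_into {..m} e k) (t - \<tau>) *\<^sub>R v))"
    unfolding delay_pair_def using t by (subst derivative_eq_gradients[OF G]) (simp_all add: Z_def)
  also have "\<dots> = (\<Sum>i\<le>m. grad_cur G (e i) (Z t) \<bullet> (f (inv_into {..m} e (e i)) t *\<^sub>R v) +
      grad_del G (e i) (Z t) \<bullet> (f (inv_into {..m} e (e i)) (t - \<tau>) *\<^sub>R v))"
    by (rule sum.reindex_bij_betw[OF e, symmetric])
  also have "\<dots> = (\<Sum>i\<le>m. f i t * (grad_cur G (e i) (Z t) \<bullet> v) + f i (t - \<tau>) * (grad_del G (e i) (Z t) \<bullet> v))"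
    using bij_betw_imp_inj_on[OF e] by (intro sum.cong) simp_all
  finally show ?thesis .
qed

lemma is_variation_extension:
  assumes "is_variation m t1 t2 \<phi>"
  shows "derivative_chain m (t1 - \<tau>) t2 (\<lambda>i. zero_before t1 (\<phi> i))"
  using assms \<tau> t12 by (intro derivative_chain_zero_before) (simp_all add: is_variation_def)

lemma integral_derivative_eq_first_variation:
  assumes G: "\<forall>w\<in>{t1..t2} \<times> UNIV. (G has_derivative G' w) (at w within {t1..t2} \<times> UNIV)"
    and cG: "\<forall>v. continuous_on ({t1..t2} \<times> UNIV) (\<lambda>w. G' w v)"
    and \<phi>: "is_variation m t1 t2 \<phi>"
  shows "integral {t1..t2} (\<lambda>t. G' (Z t) (0, delay_pair m e \<tau> (\<lambda>i t. zero_before t1 (\<phi> i) t *\<^sub>R v) t)) =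
    v \<bullet> first_variation G \<phi>"
proof -
  have cc: "continuous_on ({t1..t2} \<times> UNIV) (grad_cur G k)" "continuous_on ({t1..t2} \<times> UNIV) (grad_del G k)" for k
    using continuous_on_gradients[of "{t1..t2}" G G'] G cG by blast+
  have \<phi>c: "continuous_on {t1..t2} (\<phi> i)" if "i \<le> m" for i
    using \<phi> derivative_chain_continuous that by (auto simp: is_variation_def)
  have ext: "continuous_on {t1 - \<tau>..t2} (zero_before t1 (\<phi> i))" if "i \<le> m" for i
    by (rule derivative_chain_continuous[OF is_variation_extension[OF \<phi>] that])
  have del_c: "continuous_on {t1..t2} (\<lambda>t. zero_before t1 (\<phi> i) (t - \<tau>))" if "i \<le> m" for i
    by (rule continuous_on_compose2[OF ext[OF that]]) (use \<tau> in \<open>auto intro!: continuous_intros\<close>)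
  have int1: "(\<lambda>t. f t * (h (Z t) \<bullet> v)) integrable_on {t1..t2}"
    if f: "continuous_on {t1..t2} f" and h: "continuous_on ({t1..t2} \<times> UNIV) h"
    for f :: "real \<Rightarrow> real" and h :: "('n, 'k) jet \<Rightarrow> real ^ 'n"
  proof -
    have h': "continuous_on ({t1..t2} \<times> UNIV) (\<lambda>w. h w \<bullet> v)" by (intro continuous_intros h)
    obtain B where "\<forall>t\<in>{t1..t2}. norm (h (Z t) \<bullet> v) \<le> B"
      using along_curve_regular(2)[OF h'] by (elim exE conjE)
    from set_lebesgue_integral_eq_integral(1)[OF integrable_continuous_scaleR[OF f along_curve_regular(1)[OF h'] this]]
    show ?thesis by simp
  qed
  have "integral {t1..t2} (\<lambda>t. G' (Z t) (0, delay_pair m e \<tau> (\<lambda>i t. zero_before t1 (\<phi> i) t *\<^sub>R v) t)) =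
    integral {t1..t2} (\<lambda>t. \<Sum>i\<le>m. \<phi> i t * (grad_cur G (e i) (Z t) \<bullet> v) +
      zero_before t1 (\<phi> i) (t - \<tau>) * (grad_del G (e i) (Z t) \<bullet> v))"
  proof (rule integral_cong)
    fix t assume t: "t \<in> {t1..t2}"
    then have "(G has_derivative G' (Z t)) (at (Z t) within {t1..t2} \<times> UNIV)"
      by (intro bspec[OF G]) (simp add: Z_def)
    from derivative_along_variation[OF this t, of "\<lambda>i. zero_before t1 (\<phi> i)" v]
    show "G' (Z t) (0, delay_pair m e \<tau> (\<lambda>i t. zero_before t1 (\<phi> i) t *\<^sub>R v) t) =
      (\<Sum>i\<le>m. \<phi> i t * (grad_cur G (e i) (Z t) \<bullet> v) +
        zero_before t1 (\<phi> i) (t - \<tau>) * (grad_del G (e i) (Z t) \<bullet> v))"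
      using t by (simp add: zero_before_def[of _ _ t])
  qed
  also have "\<dots> = (\<Sum>i\<le>m. integral {t1..t2} (\<lambda>t. \<phi> i t * (grad_cur G (e i) (Z t) \<bullet> v) +
      zero_before t1 (\<phi> i) (t - \<tau>) * (grad_del G (e i) (Z t) \<bullet> v)))"
    by (intro integral_sum integrable_add int1 cc \<phi>c del_c) simp_all
  also have "\<dots> = (\<Sum>i\<le>m. v \<bullet> integral {t1..t2} (\<lambda>t. \<phi> i t *\<^sub>R variation_density G i t))"
  proof (rule sum.cong[OF refl])
    fix i assume "i \<in> {..m}"
    then have i: "i \<le> m" by simp
    have d: "continuous_on ({t1..t2} \<times> UNIV) (\<lambda>w. grad_del G (e i) w \<bullet> v)" by (intro continuous_intros cc)
    obtain B where B: "\<forall>t\<in>{t1..t2}. norm (variation_density G i t) \<le> B"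
      using variation_density_regular(2)[OF cc, of i] by (elim exE)
    obtain C where C: "\<forall>t\<in>{t1..t2}. norm (if t \<le> t2 - \<tau> then grad_del G (e i) (Z (t + \<tau>)) \<bullet> v else 0) \<le> C"
      using along_shifted_curve_regular(2)[OF d] by (elim exE conjE)
    have int_d: "(\<lambda>t. \<phi> i t * (if t \<le> t2 - \<tau> then grad_del G (e i) (Z (t + \<tau>)) \<bullet> v else 0)) integrable_on {t1..t2}"
      using set_lebesgue_integral_eq_integral(1)[OF integrable_continuous_scaleR[OF \<phi>c[OF i] along_shifted_curve_regular(1)[OF d] C]]
      by simp
    have int_f: "(\<lambda>t. \<phi> i t *\<^sub>R variation_density G i t) integrable_on {t1..t2}"
      by (rule set_lebesgue_integral_eq_integral(1)[OF integrable_continuous_scaleR[OF \<phi>c[OF i] variation_density_regular(1)[OF cc] B]])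
    have "integral {t1..t2} (\<lambda>t. \<phi> i t * (grad_cur G (e i) (Z t) \<bullet> v) +
        zero_before t1 (\<phi> i) (t - \<tau>) * (grad_del G (e i) (Z t) \<bullet> v)) =
      integral {t1..t2} (\<lambda>t. \<phi> i t * (grad_cur G (e i) (Z t) \<bullet> v)) +
      integral {t1..t2} (\<lambda>t. zero_before t1 (\<phi> i) (t - \<tau>) * (grad_del G (e i) (Z t) \<bullet> v))"
      by (intro integral_add int1 cc \<phi>c del_c i)
    \<comment> \<open>Here the delayed test function is exchanged for the gradient at the later time
      t + \<tau>.\<close>
    also have "integral {t1..t2} (\<lambda>t. zero_before t1 (\<phi> i) (t - \<tau>) * (grad_del G (e i) (Z t) \<bullet> v)) =
      integral {t1..t2} (\<lambda>t. \<phi> i t * (if t \<le> t2 - \<tau> then grad_del G (e i) (Z (t + \<tau>)) \<bullet> v else 0))"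
      using integral_delayed_test[OF \<tau>(1), of t1 t2 "\<phi> i" "\<lambda>t. grad_del G (e i) (Z t) \<bullet> v"] by simp
    also have "integral {t1..t2} (\<lambda>t. \<phi> i t * (grad_cur G (e i) (Z t) \<bullet> v)) + \<dots> =
      integral {t1..t2} (\<lambda>t. \<phi> i t * (grad_cur G (e i) (Z t) \<bullet> v) +
        \<phi> i t * (if t \<le> t2 - \<tau> then grad_del G (e i) (Z (t + \<tau>)) \<bullet> v else 0))"
      by (intro integral_add[symmetric] int1 cc \<phi>c i int_d)
    also have "\<dots> = integral {t1..t2} (\<lambda>t. v \<bullet> (\<phi> i t *\<^sub>R variation_density G i t))"
      by (rule integral_cong) (simp add: variation_density_def inner_add_right inner_commute distrib_left)
    also have "\<dots> = v \<bullet> integral {t1..t2} (\<lambda>t. \<phi> i t *\<^sub>R variation_density G i t)"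
      using integral_linear[OF int_f bounded_linear_inner_right[of v]] by (simp add: o_def)
    finally show "integral {t1..t2} (\<lambda>t. \<phi> i t * (grad_cur G (e i) (Z t) \<bullet> v) +
        zero_before t1 (\<phi> i) (t - \<tau>) * (grad_del G (e i) (Z t) \<bullet> v)) =
      v \<bullet> integral {t1..t2} (\<lambda>t. \<phi> i t *\<^sub>R variation_density G i t)" .
  qed
  finally show ?thesis by (simp add: first_variation_def inner_sum_right)
qed

end

section \<open>Two-parameter perturbations of an extremizer\<close>

context regularised_curve
begin

lemma perturbation_admissible:
  fixes \<eta> :: "nat \<Rightarrow> real \<Rightarrow> real ^ 'n"
  assumes qA: "q \<in> admissible m e t1 t2 \<tau> g l \<delta> qe qd"
    and \<eta>: "derivative_chain m (t1 - \<tau>) t2 \<eta>"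
    and z1: "\<forall>t\<in>{t1 - \<tau>..t1}. \<eta> 0 t = 0" and z2: "\<forall>i<m. \<eta> i t2 = 0"
    and g: "delay_functional m e t1 t2 \<tau> g (\<lambda>t. q t + \<eta> 0 t) = delay_functional m e t1 t2 \<tau> g q"
  shows "(\<lambda>t. q t + \<eta> 0 t) \<in> admissible m e t1 t2 \<tau> g l \<delta> qe qd"
proof -
  have ab: "t1 - \<tau> < t2" using t12 \<tau> by simp
  obtain A where A: "\<forall>i\<le>m. \<forall>t\<in>{t1 - \<tau>..t2}. t \<notin> A \<or> i < m \<longrightarrow>
     nth_deriv (t1 - \<tau>) t2 i (\<lambda>t. q t + \<eta> 0 t) t = nth_deriv (t1 - \<tau>) t2 i q t + \<eta> i t"
    using nth_deriv_add_chain[OF ab m q \<eta>] by (elim exE conjE)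
  have "nth_deriv (t1 - \<tau>) t2 i (\<lambda>t. q t + \<eta> 0 t) t2 = qd i" if "i \<in> {1..<m}" for i
    using A z2 qA that ab by (simp add: admissible_def)
  then show ?thesis
    using qA sobolev_inf_add_chain[OF ab m q \<eta>] z1 z2 g m
    unfolding admissible_def mem_Collect_eq by simp
qed

text \<open>One parameter moves along \<phi> v, the other along \<psi> w so that the constraint can
  be restored; at an extremizer the Jacobian of the two functionals must be singular. Independent
  directions allow (\<psi>, w) to be fixed later while (\<phi>, v) varies.\<close>

lemma first_variations_proportional:
  fixes L g :: "('n, 'k) jet \<Rightarrow> real"
  assumes L: "C_k_on (Suc k) L ({t1..t2} \<times> UNIV)" and g: "C_k_on (Suc k) g ({t1..t2} \<times> UNIV)"
    and ext: "local_extremizer m (t1 - \<tau>) t2 (delay_functional m e t1 t2 \<tau> L)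
       (admissible m e t1 t2 \<tau> g l \<delta> qe qd) q"
    and \<phi>: "is_variation m t1 t2 \<phi>" and \<psi>: "is_variation m t1 t2 \<psi>"
  shows "(v \<bullet> first_variation L \<phi>) * (w \<bullet> first_variation g \<psi>) =
    (w \<bullet> first_variation L \<psi>) * (v \<bullet> first_variation g \<phi>)"
proof -
  have ab: "t1 - \<tau> < t2" using t12 \<tau> by simp
  define X where "X = (\<lambda>i t. zero_before t1 (\<phi> i) t *\<^sub>R v)"
  define Y where "Y = (\<lambda>i t. zero_before t1 (\<psi> i) t *\<^sub>R w)"
  define \<eta> where "\<eta> = (\<lambda>s :: real \<times> real. \<lambda>i t. fst s *\<^sub>R X i t + snd s *\<^sub>R Y i t)"
  have chain: "derivative_chain m (t1 - \<tau>) t2 (\<eta> s)" for s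
    unfolding \<eta>_def X_def Y_def
    by (rule derivative_chain_lincomb[OF is_variation_extension[OF \<phi>] is_variation_extension[OF \<psi>]])
  have X: "derivative_chain m (t1 - \<tau>) t2 X" using chain[of "(1, 0)"] by (simp add: \<eta>_def)
  have Y: "derivative_chain m (t1 - \<tau>) t2 Y" using chain[of "(0, 1)"] by (simp add: \<eta>_def)
  obtain BX where BX: "BX \<ge> 0" "\<forall>i\<le>m. \<forall>t\<in>{t1 - \<tau>..t2}. norm (X i t) \<le> BX"
    using chain_regular(2)[OF X] by (elim exE conjE)
  obtain BY where BY: "BY \<ge> 0" "\<forall>i\<le>m. \<forall>t\<in>{t1 - \<tau>..t2}. norm (Y i t) \<le> BY"
    using chain_regular(2)[OF Y] by (elim exE conjE)
  define B where "B = BX + BY"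
  have \<eta>_bound: "norm (\<eta> s i t) \<le> norm s * B" if "i \<le> m" "t \<in> {t1 - \<tau>..t2}" for s i t
  proof -
    have "norm (\<eta> s i t) \<le> \<bar>fst s\<bar> * norm (X i t) + \<bar>snd s\<bar> * norm (Y i t)"
      unfolding \<eta>_def by (rule norm_triangle_le) simp
    also have "\<dots> \<le> norm s * BX + norm s * BY"
      using BX BY that norm_fst_le[of "fst s" "snd s"] norm_snd_le[of "snd s" "fst s"]
      by (intro add_mono mult_mono) auto
    finally show ?thesis by (simp add: B_def algebra_simps)
  qed
  have B0: "0 \<le> B" using BX BY by (simp add: B_def)
  define \<zeta>1 where "\<zeta>1 t = (0 :: real, delay_pair m e \<tau> X t)" for t
  define \<zeta>2 where "\<zeta>2 t = (0 :: real, delay_pair m e \<tau> Y t)" for t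
  have line: "(t, delay_pair m e \<tau> (\<lambda>i t. y i t + \<eta> s i t) t) = Z t + fst s *\<^sub>R \<zeta>1 t + snd s *\<^sub>R \<zeta>2 t" for s t
    by (simp add: Z_def \<zeta>1_def \<zeta>2_def \<eta>_def delay_pair_add delay_pair_scaleR)
  have \<zeta>_meas: "\<zeta>1 \<in> borel_measurable (lebesgue_on {t1..t2})" "\<zeta>2 \<in> borel_measurable (lebesgue_on {t1..t2})"
    unfolding \<zeta>1_def[abs_def] \<zeta>2_def[abs_def] using chain_regular(1)[OF X] chain_regular(1)[OF Y]
    by (intro measurable_jet; simp)+
  have pair_bound: "norm (0 :: real, delay_pair m e \<tau> V t) \<le> 2 * (real CARD('k) * C)"
    if "\<forall>i\<le>m. \<forall>t\<in>{t1 - \<tau>..t2}. norm (V i t) \<le> C" "t \<in> {t1..t2}" for V :: "nat \<Rightarrow> real \<Rightarrow> real ^ 'n" and C t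
  proof -
    obtain a b where ab: "delay_pair m e \<tau> V t = (a, b)" by fastforce
    have "norm a \<le> real CARD('k) * C" "norm b \<le> real CARD('k) * C"
      using delay_pair_mem_cball[OF e that \<tau>(1)] unfolding ab by simp_all
    then show ?thesis unfolding ab using norm_Pair_le[of a b] by (simp add: norm_Pair)
  qed
  \<comment> \<open>The factors 2 come from bounding the norm of a pair by the sum of the norms; the
    two bounds are added to serve both directions.\<close>
  define BZ where "BZ = 2 * (real CARD('k) * BX) + 2 * (real CARD('k) * BY)"
  have \<zeta>_bnd: "\<forall>t\<in>{t1..t2}. norm (\<zeta>1 t) \<le> BZ" "\<forall>t\<in>{t1..t2}. norm (\<zeta>2 t) \<le> BZ"
  proof -
    have "norm (\<zeta>1 t) \<le> BZ \<and> norm (\<zeta>2 t) \<le> BZ" if "t \<in> {t1..t2}" for t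
      using pair_bound[OF BX(2) that] pair_bound[OF BY(2) that] BX(1) BY(1)
      by (auto simp: \<zeta>1_def \<zeta>2_def BZ_def intro: add_increasing add_increasing2)
    then show "\<forall>t\<in>{t1..t2}. norm (\<zeta>1 t) \<le> BZ" "\<forall>t\<in>{t1..t2}. norm (\<zeta>2 t) \<le> BZ" by simp_all
  qed
  \<comment> \<open>For parameters of norm below 1 the perturbation is bounded by \<open>B\<close>,
    so enlarging the box from \<open>M\<close> to \<open>M + B\<close> accommodates all perturbed
    jets.\<close>
  have inK: "Z t + fst s *\<^sub>R \<zeta>1 t + snd s *\<^sub>R \<zeta>2 t \<in> box (M + B)"
    if t: "t \<in> {t1..t2}" and s: "norm s < 1" for t and s :: "real \<times> real"
  proof -
    have "norm (y i t + \<eta> s i t) \<le> M + B" if "i \<le> m" "t \<in> {t1 - \<tau>..t2}" for i t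
    proof (intro norm_triangle_le add_mono)
      show "norm (y i t) \<le> M" using y_bound that by simp
      have "norm s * B \<le> 1 * B" using s B0 by (intro mult_right_mono) auto
      then show "norm (\<eta> s i t) \<le> B" using \<eta>_bound[OF that, of s] by simp
    qed
    then show ?thesis unfolding line[symmetric] by (intro jet_in_box t) simp
  qed
  define P where "P G = (\<lambda>s. integral {t1..t2} (\<lambda>t. G (Z t + fst s *\<^sub>R \<zeta>1 t + snd s *\<^sub>R \<zeta>2 t)))"
    for G :: "('n, 'k) jet \<Rightarrow> real"
  have P_eq: "delay_functional m e t1 t2 \<tau> G (\<lambda>t. q t + \<eta> s 0 t) = P G s"
    if "C_k_on (Suc k) G ({t1..t2} \<times> UNIV)" for G s
    unfolding P_def line[symmetric]
    by (rule delay_functional_perturbed[OF chain C_k_on_imp_continuous_on[OF that]])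
  have P0: "delay_functional m e t1 t2 \<tau> G q = P G 0" if "C_k_on (Suc k) G ({t1..t2} \<times> UNIV)" for G
    using P_eq[OF that, of 0] by (simp add: \<eta>_def)
  have P_diff: "(P G has_derivative (\<lambda>s. fst s * (v \<bullet> first_variation G \<phi>) + snd s * (w \<bullet> first_variation G \<psi>))) (at 0)"
    "continuous_on (ball 0 1) (P G)" if G: "C_k_on (Suc k) G ({t1..t2} \<times> UNIV)" for G
  proof -
    obtain G' where G': "\<forall>x\<in>{t1..t2} \<times> UNIV. (G has_derivative G' x) (at x within {t1..t2} \<times> UNIV)"
      "\<forall>u. continuous_on ({t1..t2} \<times> UNIV) (\<lambda>x. G' x u)"
      using C_k_on_derivative[OF G] by (elim exE conjE)
    have 1: "(G has_derivative G' x) (at x within box (M + B))" if "x \<in> box (M + B)" for x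
      by (rule has_derivative_subset[OF bspec[OF G'(1)] box_subset]) (use that box_subset in blast)
    have 2: "continuous_on (box (M + B)) (\<lambda>x. G' x u)" for u
      by (rule continuous_on_subset[OF G'(2)[rule_format] box_subset])
    have t: "t1 \<le> t2" using t12 by simp
    have D: "(P G has_derivative (\<lambda>s. fst s * integral {t1..t2} (\<lambda>t. G' (Z t) (\<zeta>1 t)) +
        snd s * integral {t1..t2} (\<lambda>t. G' (Z t) (\<zeta>2 t)))) (at 0)"
      unfolding P_def
      by (rule has_derivative_parametric_integral[OF t compact_box convex_box 1 2 Z_measurable \<zeta>_meas \<zeta>_bnd inK])
    have "integral {t1..t2} (\<lambda>t. G' (Z t) (\<zeta>1 t)) = v \<bullet> first_variation G \<phi>"
      unfolding \<zeta>1_def X_def by (rule integral_derivative_eq_first_variation[OF G' \<phi>])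
    moreover have "integral {t1..t2} (\<lambda>t. G' (Z t) (\<zeta>2 t)) = w \<bullet> first_variation G \<psi>"
      unfolding \<zeta>2_def Y_def by (rule integral_derivative_eq_first_variation[OF G' \<psi>])
    ultimately show "(P G has_derivative (\<lambda>s. fst s * (v \<bullet> first_variation G \<phi>) + snd s * (w \<bullet> first_variation G \<psi>))) (at 0)"
      using D by simp
    show "continuous_on (ball 0 1) (P G)"
      unfolding P_def by (rule continuous_on_parametric_integral[OF t compact_box convex_box 1 2 Z_measurable \<zeta>_meas \<zeta>_bnd inK])
  qed
  have admissible: "(\<lambda>t. q t + \<eta> s 0 t) \<in> admissible m e t1 t2 \<tau> g l \<delta> qe qd" if "P g s = P g 0" for s
  proof (rule perturbation_admissible[OF _ chain])
    show "q \<in> admissible m e t1 t2 \<tau> g l \<delta> qe qd" using ext by (simp add: local_extremizer_def)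
    show "\<forall>t\<in>{t1 - \<tau>..t1}. \<eta> s 0 t = 0" "\<forall>i<m. \<eta> s i t2 = 0"
      using \<phi> \<psi> by (auto simp: \<eta>_def X_def Y_def zero_before_def is_variation_def dest: antisym)
    show "delay_functional m e t1 t2 \<tau> g (\<lambda>t. q t + \<eta> s 0 t) = delay_functional m e t1 t2 \<tau> g q"
      using that by (simp only: P_eq[OF g] P0[OF g])
  qed
  \<comment> \<open>The Sobolev norm has m + 1 summands, each at most \<open>norm s * B\<close>;
    this dictates the radius. \<open>B + 1\<close> keeps the divisor positive, and the minimum with
    1 stays in the ball where the parametric integrals are controlled.\<close>
  have near: "\<exists>r. 0 < r \<and> r \<le> 1 \<and> (\<forall>s\<in>ball 0 r. sobolev_inf_norm m (t1 - \<tau>) t2 (\<lambda>t. (q t + \<eta> s 0 t) - q t) < ereal \<epsilon>)"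
    if "0 < \<epsilon>" for \<epsilon>
  proof (intro exI conjI ballI)
    show "0 < min 1 (\<epsilon> / (real (Suc m) * (B + 1)))" "min 1 (\<epsilon> / (real (Suc m) * (B + 1))) \<le> 1"
      using that B0 by simp_all
    fix s :: "real \<times> real" assume "s \<in> ball 0 (min 1 (\<epsilon> / (real (Suc m) * (B + 1))))"
    then have s: "norm s * (real (Suc m) * (B + 1)) < \<epsilon>"
      using B0 by (simp add: pos_less_divide_eq)
    have "sobolev_inf_norm m (t1 - \<tau>) t2 (\<eta> s 0) \<le> ereal (real (Suc m) * (norm s * B))"
      by (rule sobolev_inf_norm_chain_le[OF ab chain]) (use \<eta>_bound in blast)
    also have "real (Suc m) * (norm s * B) \<le> norm s * (real (Suc m) * (B + 1))"
      using mult_left_mono[of B "B + 1" "real (Suc m) * norm s"] by (simp add: mult.assoc mult.left_commute)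
    also have "\<dots> < \<epsilon>" by (rule s)
    finally show "sobolev_inf_norm m (t1 - \<tau>) t2 (\<lambda>t. (q t + \<eta> s 0 t) - q t) < ereal \<epsilon>" by simp
  qed
  let ?A = "admissible m e t1 t2 \<tau> g l \<delta> qe qd" and ?J = "delay_functional m e t1 t2 \<tau> L"
  \<comment> \<open>A maximizer is treated as a minimizer of the negated functional, since the
    resulting determinant identity is insensitive to the sign.\<close>
  have "\<exists>r. 0 < r \<and> r \<le> 1 \<and>
    ((\<forall>s\<in>ball 0 r. P g s = P g 0 \<longrightarrow> P L 0 \<le> P L s) \<or> (\<forall>s\<in>ball 0 r. P g s = P g 0 \<longrightarrow> - P L 0 \<le> - P L s))"
  proof -
    obtain \<epsilon> where \<epsilon>: "0 < \<epsilon>"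
      "(\<forall>x\<in>?A. sobolev_inf_norm m (t1 - \<tau>) t2 (\<lambda>t. x t - q t) < ereal \<epsilon> \<longrightarrow> ?J q \<le> ?J x) \<or>
       (\<forall>x\<in>?A. sobolev_inf_norm m (t1 - \<tau>) t2 (\<lambda>t. x t - q t) < ereal \<epsilon> \<longrightarrow> ?J x \<le> ?J q)"
      using ext unfolding local_extremizer_def by blast
    obtain r where r: "0 < r" "r \<le> 1"
      "\<forall>s\<in>ball 0 r. sobolev_inf_norm m (t1 - \<tau>) t2 (\<lambda>t. (q t + \<eta> s 0 t) - q t) < ereal \<epsilon>"
      using near[OF \<epsilon>(1)] by (elim exE conjE)
    show ?thesis
      using \<epsilon>(2)
    proof (elim disjE)
      assume *: "\<forall>x\<in>?A. sobolev_inf_norm m (t1 - \<tau>) t2 (\<lambda>t. x t - q t) < ereal \<epsilon> \<longrightarrow> ?J q \<le> ?J x"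
      have "P L 0 \<le> P L s" if "s \<in> ball 0 r" "P g s = P g 0" for s
        using bspec[OF * admissible[OF that(2)]] bspec[OF r(3) that(1)] by (simp only: P_eq[OF L] P0[OF L])
      with r show ?thesis by blast
    next
      assume *: "\<forall>x\<in>?A. sobolev_inf_norm m (t1 - \<tau>) t2 (\<lambda>t. x t - q t) < ereal \<epsilon> \<longrightarrow> ?J x \<le> ?J q"
      have "- P L 0 \<le> - P L s" if "s \<in> ball 0 r" "P g s = P g 0" for s
        using bspec[OF * admissible[OF that(2)]] bspec[OF r(3) that(1)] by (simp only: P_eq[OF L] P0[OF L] neg_le_iff_le)
      with r show ?thesis by blast
    qed
  qed
  then obtain r where r: "0 < r" "r \<le> 1" and
    min: "(\<forall>s\<in>ball 0 r. P g s = P g 0 \<longrightarrow> P L 0 \<le> P L s) \<or> (\<forall>s\<in>ball 0 r. P g s = P g 0 \<longrightarrow> - P L 0 \<le> - P L s)"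
    by (elim exE conjE)
  have sub: "ball 0 r \<subseteq> ball 0 (1::real)" "ball 0 r \<subseteq> (ball 0 1 :: (real \<times> real) set)" using r by auto
  note cont = continuous_on_subset[OF P_diff(2)[OF L] sub(2)] continuous_on_subset[OF P_diff(2)[OF g] sub(2)]
  from min show ?thesis
  proof (elim disjE)
    assume "\<forall>s\<in>ball 0 r. P g s = P g 0 \<longrightarrow> P L 0 \<le> P L s"
    then show ?thesis
      by (intro constrained_min_two_parameters[OF r(1) cont P_diff(1)[OF L] P_diff(1)[OF g]]) blast
  next
    assume *: "\<forall>s\<in>ball 0 r. P g s = P g 0 \<longrightarrow> - P L 0 \<le> - P L s"
    have neg: "((\<lambda>s. - P L s) has_derivative
      (\<lambda>s. fst s * (- (v \<bullet> first_variation L \<phi>)) + snd s * (- (w \<bullet> first_variation L \<psi>)))) (at 0)"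
      using has_derivative_minus[OF P_diff(1)[OF L]] by (simp add: algebra_simps)
    have "- (v \<bullet> first_variation L \<phi>) * (w \<bullet> first_variation g \<psi>) =
        - (w \<bullet> first_variation L \<psi>) * (v \<bullet> first_variation g \<phi>)"
      by (rule constrained_min_two_parameters[OF r(1) continuous_on_minus[OF cont(1)] cont(2) neg P_diff(1)[OF g]])
        (use * in blast)
    then show ?thesis by simp
  qed
qed

end

section \<open>Test functions and the weak Euler-Lagrange equations\<close>

lemma C_k_on_deriv:
  fixes \<phi> :: "real \<Rightarrow> real"
  assumes "C_k_on (Suc k) \<phi> UNIV"
  shows "(\<phi> has_vector_derivative deriv \<phi> t) (at t)" "C_k_on k (deriv \<phi>) UNIV"
proof -
  obtain \<phi>' where D: "\<forall>x. (\<phi> has_derivative \<phi>' x) (at x)" and C: "\<forall>v. C_k_on k (\<lambda>x. \<phi>' x v) UNIV"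
    using assms by auto
  have der: "(\<phi> has_real_derivative \<phi>' x 1) (at x)" for x
  proof -
    have "\<phi>' x h = \<phi>' x 1 * h" for h
      using linear_scale[OF has_derivative_linear[OF D[rule_format, of x]], of h 1] by simp
    then have "\<phi>' x = (*) (\<phi>' x 1)" by (rule ext)
    from has_derivative_eq_rhs[OF D[rule_format, of x] this] show ?thesis
      unfolding has_field_derivative_def .
  qed
  then have eq: "deriv \<phi> = (\<lambda>x. \<phi>' x 1)" by (intro ext DERIV_imp_deriv)
  show "(\<phi> has_vector_derivative deriv \<phi> t) (at t)"
    using der[of t] by (simp add: eq has_real_derivative_iff_has_vector_derivative)
  show "C_k_on k (deriv \<phi>) UNIV" using C by (simp add: eq)
qed

lemma smooth_on_iterated_deriv:
  fixes \<phi> :: "real \<Rightarrow> real"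
  assumes "smooth_on UNIV \<phi>"
  shows "C_k_on k ((deriv ^^ i) \<phi>) UNIV"
proof (induction i arbitrary: k)
  case (Suc i)
  from C_k_on_deriv(2)[OF Suc[of "Suc k"]] show ?case by simp
qed (use assms in \<open>simp add: smooth_on_def\<close>)

lemma iterated_deriv_eq_0_outside:
  fixes \<phi> :: "real \<Rightarrow> real"
  assumes "\<forall>t. t \<notin> {c..d} \<longrightarrow> \<phi> t = 0"
  shows "\<forall>t. t \<notin> {c..d} \<longrightarrow> (deriv ^^ i) \<phi> t = 0"
proof (induction i)
  case (Suc i)
  have "deriv ((deriv ^^ i) \<phi>) t = 0" if t: "t \<notin> {c..d}" for t
  proof (rule DERIV_imp_deriv, rule has_field_derivative_transform_within_open)
    show "((\<lambda>_. 0) has_real_derivative 0) (at t)" by simp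
    show "open (- {c..d})" "t \<in> - {c..d}" using t by auto
    show "0 = (deriv ^^ i) \<phi> x" if "x \<in> - {c..d}" for x using Suc that by simp
  qed
  then show ?case by simp
qed (use assms in simp)

text \<open>The support stays away from \<open>u\<close> and \<open>v\<close>, so a test function on
  a subinterval, with all its derivatives, vanishes at t1 and t2 and counts as a variation on the
  whole interval.\<close>

lemma test_function_is_variation:
  assumes \<phi>: "\<phi> \<in> test_functions u v" and uv: "t1 \<le> u" "v \<le> t2"
  shows "is_variation m t1 t2 (\<lambda>i. (deriv ^^ i) \<phi>)" "\<forall>t. t \<notin> {u<..<v} \<longrightarrow> (deriv ^^ i) \<phi> t = 0"
proof -
  obtain c d where cd: "smooth_on UNIV \<phi>" "u < c" "d < v" "\<forall>t. t \<notin> {c..d} \<longrightarrow> \<phi> t = 0"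
    using \<phi> by (auto simp: test_functions_def)
  have zero: "(deriv ^^ i) \<phi> t = 0" if "t \<notin> {u<..<v}" for i t
    by (rule iterated_deriv_eq_0_outside[OF cd(4), rule_format]) (use that cd(2,3) in auto)
  then show "\<forall>t. t \<notin> {u<..<v} \<longrightarrow> (deriv ^^ i) \<phi> t = 0" by simp
  have "((deriv ^^ i) \<phi> has_vector_derivative (deriv ^^ Suc i) \<phi> t) (at t within {t1..t2})" for i t
    using C_k_on_deriv(1)[OF smooth_on_iterated_deriv[OF cd(1), of "Suc 0" i], of t]
    by (simp add: has_vector_derivative_at_within)
  moreover have "continuous_on {t1..t2} ((deriv ^^ m) \<phi>)"
    by (rule continuous_on_subset[OF C_k_on_imp_continuous_on[OF smooth_on_iterated_deriv[OF cd(1), of 0]]]) simp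
  moreover have "t1 \<notin> {u<..<v}" "t2 \<notin> {u<..<v}" using uv by auto
  ultimately show "is_variation m t1 t2 (\<lambda>i. (deriv ^^ i) \<phi>)"
    using zero unfolding is_variation_def derivative_chain_def by blast
qed

context regularised_curve
begin

lemma delayed_jet_eq_Z:
  "\<exists>N'. negligible N' \<and> (\<forall>t\<in>{t1..t2} - N'. delayed_jet m e (t1 - \<tau>) t2 \<tau> q t = Z t)"
proof -
  have "derivative_chain m (t1 - \<tau>) t2 (\<lambda>i t. 0 :: real ^ 'n)"
    by (simp add: derivative_chain_def)
  from delayed_jet_perturbed[OF this] show ?thesis by (simp add: Z_def)
qed

lemma delayed_jet_eq_variation_density:
  "\<exists>N'. negligible N' \<and>
    (\<forall>t\<in>{t1..t2 - \<tau>} - N'. grad_cur G (e i) (delayed_jet m e (t1 - \<tau>) t2 \<tau> q t) +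
       grad_del G (e i) (delayed_jet m e (t1 - \<tau>) t2 \<tau> q (t + \<tau>)) = variation_density G i t) \<and>
    (\<forall>t\<in>{t2 - \<tau>..t2} - N'. grad_cur G (e i) (delayed_jet m e (t1 - \<tau>) t2 \<tau> q t) = variation_density G i t)"
proof -
  let ?z = "delayed_jet m e (t1 - \<tau>) t2 \<tau> q"
  obtain A where A: "negligible A" "\<forall>t\<in>{t1..t2} - A. ?z t = Z t"
    using delayed_jet_eq_Z by (elim exE conjE)
  \<comment> \<open>The translate removes times for which \<open>t + \<tau>\<close> is exceptional.
    The point t2 - \<tau> is removed because the density still contains the delayed gradient there,
    unlike the second formula.\<close>
  let ?N = "insert (t2 - \<tau>) (A \<union> (+) (- \<tau>) ` A)"
  have "negligible ?N"
    using A(1) negligible_translation[OF A(1), of "- \<tau>"] by simp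
  moreover have "?z (t + \<tau>) = Z (t + \<tau>)" if "t \<in> {t1..t2 - \<tau>} - ?N" for t
  proof -
    have "t + \<tau> \<notin> A"
    proof
      assume "t + \<tau> \<in> A"
      then have "- \<tau> + (t + \<tau>) \<in> (+) (- \<tau>) ` A" by (rule imageI)
      then show False using that by simp
    qed
    then show ?thesis using A(2) that \<tau> by simp
  qed
  moreover have "?z t = Z t" if "t \<in> {t1..t2} - ?N" for t using A(2) that by simp
  ultimately show ?thesis
    using \<tau> by (intro exI[of _ ?N] conjI ballI) (simp_all add: variation_density_def)
qed

text \<open>The sign in the Euler-Lagrange sum cancels the sign of the distributional derivative,
  and the integral over (u, v) extends to [t1, t2] because the test function and its derivatives
  vanish outside (u, v).\<close>

lemma distr_sum_eq_first_variation:
  assumes G: "\<And>k. continuous_on ({t1..t2} \<times> UNIV) (grad_cur G k)" "\<And>k. continuous_on ({t1..t2} \<times> UNIV) (grad_del G k)"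
    and \<phi>: "\<phi> \<in> test_functions u v" and uv: "t1 \<le> u" "v \<le> t2"
    and h: "\<And>i. \<exists>N'. negligible N' \<and> (\<forall>t\<in>{u<..<v} - N'. h i t = variation_density G i t)"
  shows "(\<Sum>i\<le>m. (-1) ^ i *\<^sub>R distr_deriv u v i (h i) \<phi>) = first_variation G (\<lambda>i. (deriv ^^ i) \<phi>)"
  unfolding first_variation_def
proof (rule sum.cong[OF refl])
  fix i assume "i \<in> {..m}"
  then have i: "i \<le> m" by simp
  let ?F = "\<lambda>t. (deriv ^^ i) \<phi> t *\<^sub>R variation_density G i t"
  note V = test_function_is_variation[OF \<phi> uv]
  have c: "continuous_on {t1..t2} ((deriv ^^ i) \<phi>)"
    using V(1)[of m] derivative_chain_continuous[of m t1 t2 "\<lambda>i. (deriv ^^ i) \<phi>", OF _ i] by (simp add: is_variation_def)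
  obtain B where B: "\<forall>t\<in>{t1..t2}. norm (variation_density G i t) \<le> B"
    using variation_density_regular(2)[OF G, of i] by (elim exE)
  obtain N' where N': "negligible N'" "\<forall>t\<in>{u<..<v} - N'. h i t = variation_density G i t"
    using h[of i] by (elim exE conjE)
  have "?F absolutely_integrable_on {t1..t2}"
    by (rule integrable_continuous_scaleR[OF c variation_density_regular(1)[OF G] B])
  then have F: "?F absolutely_integrable_on {u<..<v}"
    by (rule set_integrable_subset) (use uv in auto)
  have h': "(\<lambda>t. (deriv ^^ i) \<phi> t *\<^sub>R h i t) absolutely_integrable_on {u<..<v}"
    by (rule absolutely_integrable_spike[OF F N'(1)]) (use N'(2) in simp)
  have "(LINT t:{u<..<v}|lebesgue. (deriv ^^ i) \<phi> t *\<^sub>R h i t) = integral {u<..<v} ?F"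
    unfolding set_lebesgue_integral_eq_integral(2)[OF h']
    by (rule integral_spike[OF N'(1)]) (use N'(2) in simp)
  also have "\<dots> = integral UNIV (\<lambda>t. if t \<in> {u<..<v} then ?F t else 0)"
    by (rule integral_restrict_UNIV[symmetric])
  also have "\<dots> = integral UNIV (\<lambda>t. if t \<in> {t1..t2} then ?F t else 0)"
    by (rule arg_cong[of _ _ "integral UNIV"]) (use V(2) uv in \<open>auto simp: fun_eq_iff\<close>)
  also have "\<dots> = integral {t1..t2} ?F" by (rule integral_restrict_UNIV)
  finally show "(-1) ^ i *\<^sub>R distr_deriv u v i (h i) \<phi> = integral {t1..t2} ?F"
    by (simp add: distr_deriv_def flip: power_add)
qed

text \<open>Used in contrapositive form: for a normal extremizer some variation has a nonzero first
  variation of the constraint. Each of the two weak equations is tested by variations supported in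
  its own subinterval.\<close>

lemma euler_lagrange_if_first_variation_zero:
  assumes G: "\<And>k. continuous_on ({t1..t2} \<times> UNIV) (grad_cur G k)" "\<And>k. continuous_on ({t1..t2} \<times> UNIV) (grad_del G k)"
    and zero: "\<And>\<phi>. is_variation m t1 t2 \<phi> \<Longrightarrow> first_variation G \<phi> = 0"
  shows "euler_lagrange m e t1 t2 \<tau> G q"
  unfolding euler_lagrange_def Let_def
proof (intro conjI ballI)
  fix \<phi> assume \<phi>: "\<phi> \<in> test_functions t1 (t2 - \<tau>)"
  have uv: "t1 \<le> t1" "t2 - \<tau> \<le> t2" using \<tau> by simp_all
  have "(\<Sum>i\<le>m. (-1) ^ i *\<^sub>R distr_deriv t1 (t2 - \<tau>) i
      (\<lambda>t. grad_cur G (e i) (delayed_jet m e (t1 - \<tau>) t2 \<tau> q t) +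
         grad_del G (e i) (delayed_jet m e (t1 - \<tau>) t2 \<tau> q (t + \<tau>))) \<phi>) = first_variation G (\<lambda>i. (deriv ^^ i) \<phi>)"
  proof (rule distr_sum_eq_first_variation[OF G \<phi> uv])
    fix i
    from delayed_jet_eq_variation_density[of G i]
    show "\<exists>N'. negligible N' \<and> (\<forall>t\<in>{t1<..<t2 - \<tau>} - N'. grad_cur G (e i) (delayed_jet m e (t1 - \<tau>) t2 \<tau> q t) +
         grad_del G (e i) (delayed_jet m e (t1 - \<tau>) t2 \<tau> q (t + \<tau>)) = variation_density G i t)"
      by (elim ex_forward) simp
  qed
  then show "(\<Sum>i\<le>m. (-1) ^ i *\<^sub>R distr_deriv t1 (t2 - \<tau>) i
      (\<lambda>t. grad_cur G (e i) (delayed_jet m e (t1 - \<tau>) t2 \<tau> q t) +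
         grad_del G (e i) (delayed_jet m e (t1 - \<tau>) t2 \<tau> q (t + \<tau>))) \<phi>) = 0"
    using zero[OF test_function_is_variation(1)[OF \<phi> uv]] by simp
next
  fix \<phi> assume \<phi>: "\<phi> \<in> test_functions (t2 - \<tau>) t2"
  have uv: "t1 \<le> t2 - \<tau>" "t2 \<le> t2" using \<tau> by simp_all
  have "(\<Sum>i\<le>m. (-1) ^ i *\<^sub>R distr_deriv (t2 - \<tau>) t2 i
      (\<lambda>t. grad_cur G (e i) (delayed_jet m e (t1 - \<tau>) t2 \<tau> q t)) \<phi>) = first_variation G (\<lambda>i. (deriv ^^ i) \<phi>)"
  proof (rule distr_sum_eq_first_variation[OF G \<phi> uv])
    fix i
    from delayed_jet_eq_variation_density[of G i]
    show "\<exists>N'. negligible N' \<and> (\<forall>t\<in>{t2 - \<tau><..<t2} - N'.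
        grad_cur G (e i) (delayed_jet m e (t1 - \<tau>) t2 \<tau> q t) = variation_density G i t)"
      by (elim ex_forward) simp
  qed
  then show "(\<Sum>i\<le>m. (-1) ^ i *\<^sub>R distr_deriv (t2 - \<tau>) t2 i
      (\<lambda>t. grad_cur G (e i) (delayed_jet m e (t1 - \<tau>) t2 \<tau> q t)) \<phi>) = 0"
    using zero[OF test_function_is_variation(1)[OF \<phi> uv]] by simp
qed

end

text \<open>For i = m the exponent is -1, hence the integer power. The sign is opposite to the one
  that integration by parts produces; the difference is absorbed by negating the coefficients of the
  polynomial.\<close>

lemma minus_one_powi_pred:
  assumes "i \<le> m"
  shows "(-1 :: real) powi (int m - int i - 1) = - ((-1) ^ (m - i))"
proof -
  have "(-1 :: real) powi (int (m - i) - 1) = - ((-1) ^ (m - i))"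
    by (subst power_int_diff) simp_all
  then show ?thesis using assms by (simp add: of_nat_diff)
qed

section \<open>The multiplier and the integrated equations\<close>

context regularised_curve
begin

lemma gradients_continuous:
  assumes "C_k_on (Suc k) G ({t1..t2} \<times> UNIV)"
  shows "continuous_on ({t1..t2} \<times> UNIV) (grad_cur G \<kappa>)" "continuous_on ({t1..t2} \<times> UNIV) (grad_del G \<kappa>)"
proof -
  obtain G' where G': "\<forall>x\<in>{t1..t2} \<times> UNIV. (G has_derivative G' x) (at x within {t1..t2} \<times> UNIV)"
    "\<forall>u. continuous_on ({t1..t2} \<times> UNIV) (\<lambda>x. G' x u)"
    using C_k_on_derivative[OF assms] by (elim exE conjE)
  show "continuous_on ({t1..t2} \<times> UNIV) (grad_cur G \<kappa>)" "continuous_on ({t1..t2} \<times> UNIV) (grad_del G \<kappa>)"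
    by (rule continuous_on_gradients[OF bspec[OF G'(1)] G'(2)[rule_format]]; simp)+
qed

lemma gradients_diff_scale_on_slab:
  fixes L g :: "('n, 'k) jet \<Rightarrow> real"
  assumes L: "C_k_on (Suc k) L ({t1..t2} \<times> UNIV)" and g: "C_k_on (Suc k) g ({t1..t2} \<times> UNIV)"
    and w: "w \<in> {t1..t2} \<times> UNIV"
  shows "grad_cur (\<lambda>w. L w - r * g w) \<kappa> w = grad_cur L \<kappa> w - r *\<^sub>R grad_cur g \<kappa> w"
    "grad_del (\<lambda>w. L w - r * g w) \<kappa> w = grad_del L \<kappa> w - r *\<^sub>R grad_del g \<kappa> w"
proof -
  obtain L' where L': "\<forall>x\<in>{t1..t2} \<times> UNIV. (L has_derivative L' x) (at x within {t1..t2} \<times> UNIV)"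
    using C_k_on_derivative[OF L] by (elim exE conjE)
  obtain g' where g': "\<forall>x\<in>{t1..t2} \<times> UNIV. (g has_derivative g' x) (at x within {t1..t2} \<times> UNIV)"
    using C_k_on_derivative[OF g] by (elim exE conjE)
  have "fst w \<in> {t1..t2}" using w by auto
  from gradients_diff_scale[OF bspec[OF L' w] bspec[OF g' w] this]
  show "grad_cur (\<lambda>w. L w - r * g w) \<kappa> w = grad_cur L \<kappa> w - r *\<^sub>R grad_cur g \<kappa> w"
    "grad_del (\<lambda>w. L w - r * g w) \<kappa> w = grad_del L \<kappa> w - r *\<^sub>R grad_del g \<kappa> w" by auto
qed

lemma gradients_diff_scale_continuous:
  fixes L g :: "('n, 'k) jet \<Rightarrow> real"
  assumes L: "C_k_on (Suc k) L ({t1..t2} \<times> UNIV)" and g: "C_k_on (Suc k) g ({t1..t2} \<times> UNIV)"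
  shows "continuous_on ({t1..t2} \<times> UNIV) (grad_cur (\<lambda>w. L w - r * g w) \<kappa>)"
    "continuous_on ({t1..t2} \<times> UNIV) (grad_del (\<lambda>w. L w - r * g w) \<kappa>)"
proof -
  have c: "continuous_on ({t1..t2} \<times> UNIV) (\<lambda>w. grad_cur L \<kappa> w - r *\<^sub>R grad_cur g \<kappa> w)"
    "continuous_on ({t1..t2} \<times> UNIV) (\<lambda>w. grad_del L \<kappa> w - r *\<^sub>R grad_del g \<kappa> w)"
    by (intro continuous_intros gradients_continuous[OF L] gradients_continuous[OF g])+
  show "continuous_on ({t1..t2} \<times> UNIV) (grad_cur (\<lambda>w. L w - r * g w) \<kappa>)"
    by (rule continuous_on_eq[OF c(1)]) (simp only: gradients_diff_scale_on_slab[OF L g])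
  show "continuous_on ({t1..t2} \<times> UNIV) (grad_del (\<lambda>w. L w - r * g w) \<kappa>)"
    by (rule continuous_on_eq[OF c(2)]) (simp only: gradients_diff_scale_on_slab[OF L g])
qed

lemma first_variation_diff_scale:
  fixes L g :: "('n, 'k) jet \<Rightarrow> real"
  assumes L: "C_k_on (Suc k) L ({t1..t2} \<times> UNIV)" and g: "C_k_on (Suc k) g ({t1..t2} \<times> UNIV)"
    and \<phi>: "is_variation m t1 t2 \<phi>"
  shows "first_variation (\<lambda>w. L w - r * g w) \<phi> = first_variation L \<phi> - r *\<^sub>R first_variation g \<phi>"
proof -
  have int: "(\<lambda>t. \<phi> i t *\<^sub>R variation_density G i t) integrable_on {t1..t2}"
    if i: "i \<le> m" and G: "C_k_on (Suc k) G ({t1..t2} \<times> UNIV)" for i G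
  proof -
    have c: "continuous_on {t1..t2} (\<phi> i)"
      using \<phi> i derivative_chain_continuous by (auto simp: is_variation_def)
    obtain B where B: "\<forall>t\<in>{t1..t2}. norm (variation_density G i t) \<le> B"
      using variation_density_regular(2)[OF gradients_continuous[OF G], of i] by (elim exE)
    show ?thesis
      by (rule set_lebesgue_integral_eq_integral(1)[OF
            integrable_continuous_scaleR[OF c variation_density_regular(1)[OF gradients_continuous[OF G]] B]])
  qed
  have dens: "variation_density (\<lambda>w. L w - r * g w) i t =
      variation_density L i t - r *\<^sub>R variation_density g i t" if "t \<in> {t1..t2}" for i t
  proof -
    have "Z t \<in> {t1..t2} \<times> UNIV" "t \<le> t2 - \<tau> \<Longrightarrow> Z (t + \<tau>) \<in> {t1..t2} \<times> UNIV"
      using that \<tau> by (auto simp: Z_def)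
    then show ?thesis
      by (simp add: variation_density_def gradients_diff_scale_on_slab[OF L g] scaleR_add_right)
  qed
  have "integral {t1..t2} (\<lambda>t. \<phi> i t *\<^sub>R variation_density (\<lambda>w. L w - r * g w) i t) =
      integral {t1..t2} (\<lambda>t. \<phi> i t *\<^sub>R variation_density L i t) -
      r *\<^sub>R integral {t1..t2} (\<lambda>t. \<phi> i t *\<^sub>R variation_density g i t)" if i: "i \<le> m" for i
  proof -
    have "integral {t1..t2} (\<lambda>t. \<phi> i t *\<^sub>R variation_density (\<lambda>w. L w - r * g w) i t) =
      integral {t1..t2} (\<lambda>t. \<phi> i t *\<^sub>R variation_density L i t - r *\<^sub>R (\<phi> i t *\<^sub>R variation_density g i t))"
      by (rule integral_cong) (simp add: dens scaleR_diff_right mult.commute)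
    also have "\<dots> = integral {t1..t2} (\<lambda>t. \<phi> i t *\<^sub>R variation_density L i t) -
        integral {t1..t2} (\<lambda>t. r *\<^sub>R (\<phi> i t *\<^sub>R variation_density g i t))"
      by (intro integral_diff integrable_cmul int i L g)
    finally show ?thesis by (simp only: integral_cmul)
  qed
  then show ?thesis
    by (simp add: first_variation_def sum_subtractf scaleR_sum_right)
qed

lemma multiplier_rule:
  assumes L: "C_k_on (Suc k) L ({t1..t2} \<times> UNIV)" and g: "C_k_on (Suc k) g ({t1..t2} \<times> UNIV)"
    and normal: "normal_extremizer m e t1 t2 \<tau> L g l \<delta> qe qd q"
  shows "\<exists>r. \<forall>\<phi>. is_variation m t1 t2 \<phi> \<longrightarrow> first_variation (\<lambda>w. L w - r * g w) \<phi> = 0"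
proof -
  have ext: "local_extremizer m (t1 - \<tau>) t2 (delay_functional m e t1 t2 \<tau> L)
       (admissible m e t1 t2 \<tau> g l \<delta> qe qd) q"
    and not_EL: "\<not> euler_lagrange m e t1 t2 \<tau> g q"
    using normal by (simp_all add: normal_extremizer_def)
  obtain \<psi> where \<psi>: "is_variation m t1 t2 \<psi>" "first_variation g \<psi> \<noteq> 0"
    using euler_lagrange_if_first_variation_zero[OF gradients_continuous[OF g]] not_EL by blast
  \<comment> \<open>Taking the nonzero first variation itself as direction makes the divisor
    \<open>w \<bullet> w\<close> nonzero. The multiplier \<open>r\<close> below is built from \<psi>
    alone, hence is the same for every \<phi>.\<close>
  define w where "w = first_variation g \<psi>"
  define r where "r = (w \<bullet> first_variation L \<psi>) / (w \<bullet> w)"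
  have w: "w \<bullet> w \<noteq> 0" using \<psi>(2) by (simp add: w_def)
  have "first_variation (\<lambda>w. L w - r * g w) \<phi> = 0" if \<phi>: "is_variation m t1 t2 \<phi>" for \<phi>
  proof -
    have "v \<bullet> (first_variation L \<phi> - r *\<^sub>R first_variation g \<phi>) = 0" for v
      using first_variations_proportional[OF L g ext \<phi> \<psi>(1), of v w] w
      by (simp add: inner_diff_right r_def w_def[symmetric] field_simps)
    then have "first_variation L \<phi> - r *\<^sub>R first_variation g \<phi> = 0"
      by (metis inner_eq_zero_iff)
    then show ?thesis by (simp add: first_variation_diff_scale[OF L g \<phi>])
  qed
  then show ?thesis by blast
qed

lemma integrated_euler_lagrange:
  assumes cc: "\<And>\<kappa>. continuous_on ({t1..t2} \<times> UNIV) (grad_cur F \<kappa>)"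
    "\<And>\<kappa>. continuous_on ({t1..t2} \<times> UNIV) (grad_del F \<kappa>)"
    and zero: "\<And>\<phi>. is_variation m t1 t2 \<phi> \<Longrightarrow> first_variation F \<phi> = 0"
  shows "\<exists>d N'. negligible N' \<and> (\<forall>t\<in>{t1..t2} - N'.
     (\<Sum>i\<le>m. (-1) ^ (m - i) *\<^sub>R iter_integral (t2 - \<tau>) (m - i) (variation_density F i) t) =
     (\<Sum>i<m. t ^ i *\<^sub>R d i))"
proof -
  have "\<forall>i. \<exists>B. \<forall>t\<in>{t1..t2}. norm (variation_density F i t) \<le> B"
    using variation_density_regular(2)[OF cc] by blast
  from choice[OF this] obtain B where B: "\<forall>i. \<forall>t\<in>{t1..t2}. norm (variation_density F i t) \<le> B i" ..
  show ?thesis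
  proof (rule du_Bois_Reymond_iterated[where M="\<Sum>i\<le>m. B i"])
    show "t1 < t2" "t2 - \<tau> \<in> {t1..t2}" using t12 \<tau> by auto
    show "variation_density F i \<in> borel_measurable (lebesgue_on {t1..t2})" if "i \<le> m" for i
      by (rule variation_density_regular(1)[OF cc])
    have B0: "0 \<le> B i" for i
      using B[rule_format, of t1 i] order_trans[OF norm_ge_zero] t12 by auto
    show "\<forall>t\<in>{t1..t2}. norm (variation_density F i t) \<le> (\<Sum>i\<le>m. B i)" if "i \<le> m" for i
    proof
      fix t assume "t \<in> {t1..t2}"
      then have "norm (variation_density F i t) \<le> B i" using B by simp
      also have "\<dots> \<le> (\<Sum>i\<le>m. B i)" by (rule member_le_sum) (use that B0 in auto)
      finally show "norm (variation_density F i t) \<le> (\<Sum>i\<le>m. B i)" .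
    qed
    fix \<phi> :: "nat \<Rightarrow> real \<Rightarrow> real"
    assume der: "\<And>i t. i \<le> m \<Longrightarrow> t \<in> {t1..t2} \<Longrightarrow> (\<phi> i has_vector_derivative \<phi> (Suc i) t) (at t within {t1..t2})"
      and bd: "\<And>i. i \<le> m \<Longrightarrow> \<phi> i t1 = 0 \<and> \<phi> i t2 = 0"
    \<comment> \<open>The tests have m + 1 derivatives; forgetting the last one leaves a variation
      of order m.\<close>
    have "continuous_on {t1..t2} (\<phi> m)" using der[of m] by (intro continuous_on_vector_derivative) simp
    then have "is_variation m t1 t2 \<phi>" using der bd by (simp add: is_variation_def derivative_chain_def)
    from zero[OF this] show "(\<Sum>i\<le>m. integral {t1..t2} (\<lambda>t. \<phi> i t *\<^sub>R variation_density F i t)) = 0"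
      by (simp add: first_variation_def)
  qed
qed

text \<open>Since the base point t2 - \<tau> belongs to [u, v], the iterated integrals at points of
  [u, v] involve the density on [u, v] only. There the density may be replaced by the formula valid
  on that side, while the polynomial stays the one found on [t1, t2].\<close>

lemma integrated_sum_cong:
  assumes cc: "\<And>\<kappa>. continuous_on ({t1..t2} \<times> UNIV) (grad_cur F \<kappa>)"
    "\<And>\<kappa>. continuous_on ({t1..t2} \<times> UNIV) (grad_del F \<kappa>)"
    and uv: "t1 \<le> u" "v \<le> t2" "t2 - \<tau> \<in> {u..v}"
    and h: "\<And>i. \<exists>N'. negligible N' \<and> (\<forall>t\<in>{u..v} - N'. h i t = variation_density F i t)"
    and N': "negligible N'" "\<forall>t\<in>{t1..t2} - N'.
     (\<Sum>i\<le>m. (-1) ^ (m - i) *\<^sub>R iter_integral (t2 - \<tau>) (m - i) (variation_density F i) t) =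
     (\<Sum>i<m. t ^ i *\<^sub>R d i)"
  shows "AE t in lebesgue_on {u..v}.
     (\<Sum>i\<le>m. (-1) powi (int m - int i - 1) *\<^sub>R iter_integral (t2 - \<tau>) (m - i) (h i) t) =
     (\<Sum>i<m. t ^ i *\<^sub>R (- d i))"
proof -
  from choice[OF allI[OF h]] obtain A where
    A: "\<forall>i. negligible (A i) \<and> (\<forall>t\<in>{u..v} - A i. h i t = variation_density F i t)" ..
  have iter: "iter_integral (t2 - \<tau>) k (h i) t = iter_integral (t2 - \<tau>) k (variation_density F i) t"
    if "t \<in> {u..v} - A i" for i k t
  proof -
    obtain B where B: "\<forall>t\<in>{t1..t2}. norm (variation_density F i t) \<le> B"
      using variation_density_regular(2)[OF cc, of i] by (elim exE)
    have "variation_density F i \<in> borel_measurable (lebesgue_on {u..v})"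
      by (rule measurable_lebesgue_on_subinterval[OF variation_density_regular(1)[OF cc]]) (use uv in auto)
    moreover have "\<forall>t\<in>{u..v}. norm (variation_density F i t) \<le> B" using B uv by auto
    moreover have "negligible (A i)" "\<forall>t\<in>{u..v} - A i. h i t = variation_density F i t" using A by auto
    ultimately show ?thesis using iter_integral_cong_negligible[OF uv(3)] that by blast
  qed
  show ?thesis
    unfolding AE_lebesgue_on_iff_negligible[OF lmeasurable_interval(1)[THEN fmeasurableD]]
  proof (intro exI conjI ballI)
    show "negligible (N' \<union> (\<Union>i\<le>m. A i))"
      using N'(1) A by (intro negligible_Un negligible_Union) auto
    fix t assume t: "t \<in> {u..v} - (N' \<union> (\<Union>i\<le>m. A i))"
    have "(\<Sum>i\<le>m. (-1) powi (int m - int i - 1) *\<^sub>R iter_integral (t2 - \<tau>) (m - i) (h i) t) =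
      (\<Sum>i\<le>m. - ((-1) ^ (m - i) *\<^sub>R iter_integral (t2 - \<tau>) (m - i) (variation_density F i) t))"
      using t by (intro sum.cong) (simp_all add: minus_one_powi_pred iter)
    also have "\<dots> = - (\<Sum>i<m. t ^ i *\<^sub>R d i)"
      using t N'(2) uv by (simp add: sum_negf)
    finally show "(\<Sum>i\<le>m. (-1) powi (int m - int i - 1) *\<^sub>R iter_integral (t2 - \<tau>) (m - i) (h i) t) =
      (\<Sum>i<m. t ^ i *\<^sub>R (- d i))" by (simp add: sum_negf)
  qed
qed

end

theorem theorem16:
  fixes m :: nat and e :: "nat \<Rightarrow> 'k::finite" and t1 t2 \<tau> l :: real
    and L g :: "('n::finite, 'k) jet \<Rightarrow> real"
    and \<delta> q :: "real \<Rightarrow> real ^ 'n" and qe :: "real ^ 'n" and qd :: "nat \<Rightarrow> real ^ 'n"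
  assumes "1 \<le> m"
    and "bij_betw e {..m} (UNIV :: 'k set)"
    and "t1 < t2" and "0 < \<tau>" and "\<tau> < t2 - t1"
    and "C_k_on (m + 1) L ({t1..t2} \<times> UNIV)"
    and "C_k_on (m + 1) g ({t1..t2} \<times> UNIV)"
    and "piecewise_smooth_on (t1 - \<tau>) t1 \<delta>"
    and "normal_extremizer m e t1 t2 \<tau> L g l \<delta> qe qd q"
  shows "\<exists>(lam :: real) (c :: nat \<Rightarrow> real ^ 'n).
    let F = (\<lambda>w. L w - lam * g w);
        z = delayed_jet m e (t1 - \<tau>) t2 \<tau> q;
        p = (\<lambda>t. \<Sum>i<m. t ^ i *\<^sub>R c i)
    in (AE t in lebesgue_on {t1..t2 - \<tau>}.
          (\<Sum>i\<le>m. (-1) powi (int m - int i - 1) *\<^sub>R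
             iter_integral (t2 - \<tau>) (m - i)
               (\<lambda>s. grad_cur F (e i) (z s) + grad_del F (e i) (z (s + \<tau>))) t) = p t) \<and>
       (AE t in lebesgue_on {t2 - \<tau>..t2}.
          (\<Sum>i\<le>m. (-1) powi (int m - int i - 1) *\<^sub>R
             iter_integral (t2 - \<tau>) (m - i)
               (\<lambda>s. grad_cur F (e i) (z s)) t) = p t)"
proof -
  have ext: "q \<in> admissible m e t1 t2 \<tau> g l \<delta> qe qd"
    using assms(9) by (simp add: normal_extremizer_def local_extremizer_def)
  then have q: "q \<in> sobolev_inf m (t1 - \<tau>) t2" by (simp add: admissible_def)
  \<comment> \<open>From here on the extremizer is studied through everywhere bounded
    representatives of its derivatives; the final equations return to its delayed jet up to null
    sets.\<close>
  from sobolev_inf_regularised_derivatives[OF q] obtain y N M where "negligible N"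
    "\<forall>i\<le>m. \<forall>t\<in>{t1 - \<tau>..t2} - N. nth_deriv (t1 - \<tau>) t2 i q t = y i t"
    "\<forall>i\<le>m. y i \<in> borel_measurable (lebesgue_on {t1 - \<tau>..t2}) \<and> (\<forall>t\<in>{t1 - \<tau>..t2}. norm (y i t) \<le> M)"
    by (elim exE conjE)
  then interpret regularised_curve m e t1 t2 \<tau> q y N M
    using assms(1-5) q by unfold_locales simp_all
  have L: "C_k_on (Suc m) L ({t1..t2} \<times> UNIV)" and g: "C_k_on (Suc m) g ({t1..t2} \<times> UNIV)"
    using assms(6,7) by (simp_all only: Suc_eq_plus1)
  obtain r where r: "\<forall>\<phi>. is_variation m t1 t2 \<phi> \<longrightarrow> first_variation (\<lambda>w. L w - r * g w) \<phi> = 0"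
    using multiplier_rule[OF L g assms(9)] by (elim exE)
  let ?F = "\<lambda>w. L w - r * g w"
  note cc = gradients_diff_scale_continuous[OF L g, of r]
  obtain d N' where N': "negligible N'" "\<forall>t\<in>{t1..t2} - N'.
     (\<Sum>i\<le>m. (-1) ^ (m - i) *\<^sub>R iter_integral (t2 - \<tau>) (m - i) (variation_density ?F i) t) =
     (\<Sum>i<m. t ^ i *\<^sub>R d i)"
    using integrated_euler_lagrange[OF cc] r by blast
  show ?thesis
    unfolding Let_def
  proof (intro exI conjI)
    \<comment> \<open>The first equation fixes the witnesses, \<open>r\<close> and the coefficients
      \<open>- d i\<close>. The second must hold with the same ones, and does because both are
      restrictions of a single identity on [t1, t2].\<close>
    show "AE t in lebesgue_on {t1..t2 - \<tau>}.
      (\<Sum>i\<le>m. (-1) powi (int m - int i - 1) *\<^sub>R iter_integral (t2 - \<tau>) (m - i)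
        (\<lambda>s. grad_cur ?F (e i) (delayed_jet m e (t1 - \<tau>) t2 \<tau> q s) +
          grad_del ?F (e i) (delayed_jet m e (t1 - \<tau>) t2 \<tau> q (s + \<tau>))) t) =
      (\<Sum>i<m. t ^ i *\<^sub>R (- d i))"
    proof (rule integrated_sum_cong[OF cc _ _ _ _ N'])
      show "t1 \<le> t1" "t2 - \<tau> \<le> t2" "t2 - \<tau> \<in> {t1..t2 - \<tau>}" using \<tau> by auto
      show "\<exists>N'. negligible N' \<and> (\<forall>t\<in>{t1..t2 - \<tau>} - N'.
          grad_cur ?F (e i) (delayed_jet m e (t1 - \<tau>) t2 \<tau> q t) +
          grad_del ?F (e i) (delayed_jet m e (t1 - \<tau>) t2 \<tau> q (t + \<tau>)) = variation_density ?F i t)" for i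
        using delayed_jet_eq_variation_density[of ?F i] by (elim ex_forward) simp
    qed
    show "AE t in lebesgue_on {t2 - \<tau>..t2}.
      (\<Sum>i\<le>m. (-1) powi (int m - int i - 1) *\<^sub>R iter_integral (t2 - \<tau>) (m - i)
        (\<lambda>s. grad_cur ?F (e i) (delayed_jet m e (t1 - \<tau>) t2 \<tau> q s)) t) =
      (\<Sum>i<m. t ^ i *\<^sub>R (- d i))"
    proof (rule integrated_sum_cong[OF cc _ _ _ _ N'])
      show "t1 \<le> t2 - \<tau>" "t2 \<le> t2" "t2 - \<tau> \<in> {t2 - \<tau>..t2}" using \<tau> by auto
      show "\<exists>N'. negligible N' \<and> (\<forall>t\<in>{t2 - \<tau>..t2} - N'.
          grad_cur ?F (e i) (delayed_jet m e (t1 - \<tau>) t2 \<tau> q t) = variation_density ?F i t)" for i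
        using delayed_jet_eq_variation_density[of ?F i] by (elim ex_forward) simp
    qed
  qed
qed

end
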